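(* Let $d\ge 1$, let $A\in SL(d,\mathbb{Z})$ be a matrix having no eigenvalue that is a root of unity, and let $B$ be a $d\times d$ matrix with integer coefficients and $\det B\neq 0$. Let $\lambda$ be the Lebesgue (Haar) probability measure on $\mathbb{T}^d=\mathbb{R}^d/\mathbb{Z}^d$. Then for every real-valued Hölder continuous function $\varphi$ on $\mathbb{T}^d$ with $\int\varphi\,d\lambda=0$, as $n\to\infty$, $$\lambda\Big\{x:\ \frac{1}{\sqrt n}\sum_{k=0}^{n-1}\varphi\big((A^k-B)x\big)<t\Big\}\longrightarrow \int_{\mathbb{T}^d}\frac{1}{\sqrt{2\pi}\,\sigma_y}\int_{-\infty}^t \exp\Big(\frac{-s^2}{2\sigma_y^2}\Big)\,ds\,d\lambda(y)$$ for every $t\in\mathbb{R}$ which is a continuity point of the right-hand side (as a function of $t$).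
   Context: For $y\in\mathbb{T}^d$, $\varphi_y(x):=\varphi(x+y)$, and $\sigma_y\ge 0$ is the square root of the asymptotic variance of $\varphi_y$ under the automorphism $x\mapsto Ax$ of $\mathbb{T}^d$: $\sigma_y^2=\lim_{n\to\infty}\frac1n\big\|\sum_{k=0}^{n-1}\varphi_y(A^k\cdot)\big\|_{L^2(\lambda)}^2$. Convention: when $\sigma_y=0$, the inner expression $\frac{1}{\sqrt{2\pi}\sigma_y}\int_{-\infty}^t e^{-s^2/(2\sigma_y^2)}ds$ is interpreted as the distribution function at $t$ of the Dirac mass at $0$. *)

theory Defs
  imports "HOL-Probability.Probability"
begin

definition int_lattice :: "(real ^ 'd::finite) set" where
  "int_lattice = {m. \<forall>i. m $ i \<in> \<int>}"

lemma int_lattice_zero: "0 \<in> int_lattice"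
  and int_lattice_add: "x \<in> int_lattice \<Longrightarrow> y \<in> int_lattice \<Longrightarrow> x + y \<in> int_lattice"
  and int_lattice_minus: "x \<in> int_lattice \<Longrightarrow> - x \<in> int_lattice"
  and int_lattice_diff: "x \<in> int_lattice \<Longrightarrow> y \<in> int_lattice \<Longrightarrow> x - y \<in> int_lattice"
  by (auto simp: int_lattice_def)

lemma closed_int_lattice: "closed int_lattice"
proof -
  have "int_lattice = (\<Inter>i. (\<lambda>m :: real ^ 'd. m $ i) -` \<int>)"
    by (auto simp: int_lattice_def)
  moreover have "closed ((\<lambda>m :: real ^ 'd. m $ i) -` \<int>)" for i
    by (intro continuous_closed_vimage) (auto intro: continuous_intros)
  ultimately show ?thesis
    by (metis closed_INT)
qed

quotient_type (overloaded) 'd torus = "real ^ 'd::finite" / "\<lambda>x y. x - y \<in> int_lattice"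
  morphisms rep_torus to_torus
proof (intro equivpI reflpI sympI transpI)
  show "x - x \<in> int_lattice" for x :: "real ^ 'd"
    by (simp add: int_lattice_zero)
  show "y - x \<in> int_lattice" if "x - y \<in> int_lattice" for x y :: "real ^ 'd"
    using int_lattice_minus[OF that] by simp
  show "x - z \<in> int_lattice" if "x - y \<in> int_lattice" "y - z \<in> int_lattice"
    for x y z :: "real ^ 'd"
    using int_lattice_add[OF that] by simp
qed

instantiation torus :: (finite) ab_group_add
begin

lift_definition zero_torus :: "'a torus" is 0 .

lift_definition plus_torus :: "'a torus \<Rightarrow> 'a torus \<Rightarrow> 'a torus" is "(+)"
  using int_lattice_add by (fastforce simp: algebra_simps)

lift_definition minus_torus :: "'a torus \<Rightarrow> 'a torus \<Rightarrow> 'a torus" is "(-)"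
  using int_lattice_diff by (fastforce simp: algebra_simps)

lift_definition uminus_torus :: "'a torus \<Rightarrow> 'a torus" is uminus
  using int_lattice_minus by (fastforce simp: algebra_simps)

instance
  by standard (transfer, simp add: algebra_simps int_lattice_zero)+

end

lemma infdist_int_lattice_cong:
  assumes "x - y \<in> int_lattice"
  shows "infdist x int_lattice = infdist y int_lattice"
proof -
  have le: "infdist x int_lattice \<le> infdist y int_lattice" if "x - y \<in> int_lattice"
    for x y :: "real ^ 'd"
  proof (subst (2) infdist_notempty)
    show "int_lattice \<noteq> {}" using int_lattice_zero by auto
    show "infdist x int_lattice \<le> (INF a\<in>int_lattice. dist y a)"
    proof (rule cINF_greatest)
      show "int_lattice \<noteq> {}" using int_lattice_zero by auto
      fix a :: "real ^ 'd" assume "a \<in> int_lattice"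
      then have "a + (x - y) \<in> int_lattice" using that int_lattice_add by blast
      moreover have "dist x (a + (x - y)) = dist y a" by (simp add: dist_norm algebra_simps)
      ultimately show "infdist x int_lattice \<le> dist y a" by (metis infdist_le)
    qed
  qed
  show ?thesis
    using le[OF assms] le[of y x] int_lattice_minus[OF assms] by simp
qed

lemma infdist_int_lattice_minus:
  "infdist (- x) int_lattice = infdist x int_lattice"
proof -
  have "(\<lambda>a. dist (- x) a) ` int_lattice = (\<lambda>a. dist x a) ` int_lattice"
  proof (intro equalityI subsetI)
    fix r assume "r \<in> (\<lambda>a. dist (- x) a) ` int_lattice"
    then obtain a where "a \<in> int_lattice" "r = dist (- x) a" by auto
    then show "r \<in> (\<lambda>a. dist x a) ` int_lattice"
      using int_lattice_minus[of a] by (intro image_eqI[of _ _ "- a"]) (auto simp: dist_norm norm_minus_commute add.commute)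
  next
    fix r assume "r \<in> (\<lambda>a. dist x a) ` int_lattice"
    then obtain a where "a \<in> int_lattice" "r = dist x a" by auto
    then show "r \<in> (\<lambda>a. dist (- x) a) ` int_lattice"
      using int_lattice_minus[of a] by (intro image_eqI[of _ _ "- a"]) (auto simp: dist_norm norm_minus_commute add.commute)
  qed
  then show ?thesis by (simp add: infdist_def)
qed

lemma infdist_int_lattice_add:
  "infdist (x + y) int_lattice \<le> infdist x int_lattice + infdist y int_lattice"
proof -
  have "infdist (x + y) int_lattice - infdist x int_lattice \<le> dist y a"
    if a: "a \<in> int_lattice" for a
  proof -
    have "infdist (x + y) int_lattice \<le> infdist (x + a) int_lattice + dist (x + y) (x + a)"
      by (rule infdist_triangle)
    also have "infdist (x + a) int_lattice = infdist x int_lattice"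
      using a by (intro infdist_int_lattice_cong) simp
    finally show ?thesis by simp
  qed
  then have "infdist (x + y) int_lattice - infdist x int_lattice \<le> infdist y int_lattice"
    using int_lattice_zero by (subst (3) infdist_notempty) (auto intro!: cINF_greatest)
  then show ?thesis by simp
qed

text \<open>
  The distance on the torus is the quotient of the Euclidean distance, i.e. the infimum of
  \<open>norm (x - y - m)\<close> over all integer vectors \<open>m\<close>; it induces the quotient topology.
\<close>

instantiation torus :: (finite) metric_space
begin

lift_definition dist_torus :: "'a torus \<Rightarrow> 'a torus \<Rightarrow> real" is
  "\<lambda>x y. infdist (x - y) int_lattice"
  using int_lattice_diff by (intro infdist_int_lattice_cong) (fastforce simp: algebra_simps)

definition uniformity_torus :: "('a torus \<times> 'a torus) filter" where
  "uniformity_torus = (INF e\<in>{0 <..}. principal {(x, y). dist x y < e})"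

definition open_torus :: "'a torus set \<Rightarrow> bool" where
  "open_torus U \<longleftrightarrow> (\<forall>x\<in>U. eventually (\<lambda>(x', y). x' = x \<longrightarrow> y \<in> U) uniformity)"

instance
proof
  show "dist x y = 0 \<longleftrightarrow> x = y" for x y :: "'a torus"
  proof transfer
    show "infdist (x - y) int_lattice = 0 \<longleftrightarrow> x - y \<in> int_lattice" for x y :: "real ^ 'a"
      using in_closed_iff_infdist_zero[OF closed_int_lattice] int_lattice_zero by blast
  qed
  show "dist x y \<le> dist x z + dist y z" for x y z :: "'a torus"
  proof transfer
    show "infdist (x - y) int_lattice \<le> infdist (x - z) int_lattice + infdist (y - z) int_lattice"
      for x y z :: "real ^ 'a"
      using infdist_int_lattice_add[of "x - z" "z - y"] infdist_int_lattice_minus[of "y - z"]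
      by simp
  qed
qed (fact uniformity_torus_def open_torus_def)+

end

definition unit_cube :: "(real ^ 'd::finite) set" where
  "unit_cube = {x. \<forall>i. 0 \<le> x $ i \<and> x $ i < 1}"

definition torus_haar :: "'d::finite torus measure" where
  "torus_haar = distr (restrict_space lborel unit_cube) borel to_torus"

lemma dist_to_torus_le: "dist (to_torus x) (to_torus y) \<le> dist x y"
  using infdist_le[OF int_lattice_zero, of "x - y"]
  by (simp add: dist_torus.abs_eq dist_norm)

lemma continuous_to_torus: "continuous_on UNIV to_torus"
  unfolding continuous_on_iff using dist_to_torus_le order_le_less_trans by blast

lemma to_torus_measurable [measurable]: "to_torus \<in> borel_measurable borel"
  by (rule borel_measurable_continuous_onI[OF continuous_to_torus])

lemma unit_cube_borel [measurable]: "unit_cube \<in> sets borel"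
proof -
  have "unit_cube = {x \<in> space borel. \<forall>i. 0 \<le> (x :: real ^ 'd) $ i \<and> x $ i < 1}"
    by (simp add: unit_cube_def)
  also have "\<dots> \<in> sets borel"
    by measurable
  finally show ?thesis .
qed

lemma space_torus_haar [simp]: "space torus_haar = UNIV"
  and sets_torus_haar [simp, measurable_cong]: "sets torus_haar = sets borel"
  by (simp_all add: torus_haar_def)

lemma emeasure_unit_cube: "emeasure lborel (unit_cube :: (real ^ 'd::finite) set) = 1"
proof (rule antisym)
  have "(unit_cube :: (real ^ 'd) set) \<subseteq> cbox 0 One"
  proof
    fix x :: "real ^ 'd" assume x: "x \<in> unit_cube"
    have "0 \<bullet> b \<le> x \<bullet> b \<and> x \<bullet> b \<le> One \<bullet> b" if b: "b \<in> Basis" for b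
    proof -
      from b obtain i where "b = axis i 1" by (auto simp: Basis_vec_def)
      then have "x \<bullet> b = x $ i" by (simp add: inner_axis)
      then show ?thesis
        using x b by (simp add: unit_cube_def inner_sum_left_Basis less_imp_le)
    qed
    then show "x \<in> cbox 0 One" by (simp add: mem_box)
  qed
  then have "emeasure lborel (unit_cube :: (real ^ 'd) set) \<le> emeasure lborel (cbox 0 (One :: real ^ 'd))"
    by (intro emeasure_mono) auto
  also have "\<dots> = 1"
    by (subst emeasure_lborel_cbox) auto
  finally show "emeasure lborel (unit_cube :: (real ^ 'd) set) \<le> 1" .
  have "box 0 One \<subseteq> (unit_cube :: (real ^ 'd) set)"
  proof
    fix x :: "real ^ 'd" assume x: "x \<in> box 0 One"
    have "0 \<le> x $ i \<and> x $ i < 1" for i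
    proof -
      have b: "axis i 1 \<in> (Basis :: (real ^ 'd) set)" by simp
      have "(0 :: real ^ 'd) \<bullet> axis i 1 < x \<bullet> axis i 1 \<and> x \<bullet> axis i 1 < (One :: real ^ 'd) \<bullet> axis i 1"
        by (rule bspec[OF x[unfolded mem_box] b])
      moreover have "(One :: real ^ 'd) \<bullet> axis i 1 = 1"
        using b by simp
      ultimately have "0 < x \<bullet> axis i 1 \<and> x \<bullet> axis i 1 < 1"
        by simp
      then show ?thesis
        by (simp add: inner_axis)
    qed
    then show "x \<in> unit_cube" by (simp add: unit_cube_def)
  qed
  then have "emeasure lborel (box 0 (One :: real ^ 'd)) \<le> emeasure lborel (unit_cube :: (real ^ 'd) set)"
    by (intro emeasure_mono) auto
  moreover have "emeasure lborel (box 0 (One :: real ^ 'd)) = 1"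
    by (subst emeasure_lborel_box) auto
  ultimately show "1 \<le> emeasure lborel (unit_cube :: (real ^ 'd) set)" by simp
qed

lemma prob_space_torus_haar: "prob_space (torus_haar :: 'd::finite torus measure)"
  unfolding torus_haar_def
proof (rule prob_space.prob_space_distr)
  show "prob_space (restrict_space lborel (unit_cube :: (real ^ 'd) set))"
    by (rule prob_spaceI) (simp add: space_restrict_space emeasure_restrict_space emeasure_unit_cube)
  show "to_torus \<in> measurable (restrict_space lborel unit_cube) borel"
    by (intro measurable_restrict_space1) simp
qed

lemma int_matrix_int_lattice:
  fixes M :: "int ^ 'd ^ 'd"
  assumes "x \<in> int_lattice"
  shows "map_matrix of_int M *v x \<in> int_lattice"
  using assms by (auto simp: int_lattice_def matrix_vector_mult_def intro!: Ints_sum)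

lift_definition torus_mult :: "int ^ 'd::finite ^ 'd \<Rightarrow> 'd torus \<Rightarrow> 'd torus" is
  "\<lambda>M x. map_matrix of_int M *v x"
  using int_matrix_int_lattice by (fastforce simp: matrix_vector_mult_diff_distrib[symmetric])

text \<open>
  The operation \<open>(^)\<close> on the vector type is the componentwise power, hence a separate definition
  of the power of a matrix.
\<close>

primrec matrix_power :: "'a::semiring_1 ^ 'd::finite ^ 'd \<Rightarrow> nat \<Rightarrow> 'a ^ 'd ^ 'd" where
  "matrix_power A 0 = mat 1"
| "matrix_power A (Suc k) = A ** matrix_power A k"

definition eigenvalue_of :: "int ^ 'd::finite ^ 'd \<Rightarrow> complex \<Rightarrow> bool" where
  "eigenvalue_of A z \<longleftrightarrow> (\<exists>v. v \<noteq> 0 \<and> map_matrix of_int A *v v = z *s v)"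

definition root_of_unity :: "complex \<Rightarrow> bool" where
  "root_of_unity z \<longleftrightarrow> (\<exists>n>0. z ^ n = 1)"

definition hoelder_continuous :: "('a::metric_space \<Rightarrow> real) \<Rightarrow> bool" where
  "hoelder_continuous f \<longleftrightarrow>
     (\<exists>\<alpha> C. 0 < \<alpha> \<and> \<alpha> \<le> 1 \<and> (\<forall>x y. \<bar>f x - f y\<bar> \<le> C * dist x y powr \<alpha>))"

definition asymptotic_variance ::
    "int ^ 'd::finite ^ 'd \<Rightarrow> ('d torus \<Rightarrow> real) \<Rightarrow> real" where
  "asymptotic_variance A \<psi> =
     lim (\<lambda>n. 1 / real n *
       (\<integral>x. (\<Sum>k<n. \<psi> (torus_mult (matrix_power A k) x))\<^sup>2 \<partial>torus_haar))"

definition asymptotic_sd ::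
    "int ^ 'd::finite ^ 'd \<Rightarrow> ('d torus \<Rightarrow> real) \<Rightarrow> 'd torus \<Rightarrow> real" where
  "asymptotic_sd A \<phi> y = sqrt (asymptotic_variance A (\<lambda>x. \<phi> (x + y)))"

definition centered_gaussian_cdf :: "real \<Rightarrow> real \<Rightarrow> real" where
  "centered_gaussian_cdf s t =
     (if s = 0 then cdf (return borel 0) t
      else 1 / (sqrt (2 * pi) * s) * (LBINT u:{..t}. exp (- u\<^sup>2 / (2 * s\<^sup>2))))"

end

theory Submission
  imports Defs "HOL-Analysis.Kronecker_Approximation_Theorem"
    "HOL-Computational_Algebra.Fundamental_Theorem_Algebra"
begin

text \<open>
  With \<open>T\<close> the transpose of \<open>A\<close>, Fourier analysis reduces everything to counting solutions of
  integer equations such as \<open>T\<^sup>k m + T\<^sup>l m' = B\<^sup>T (m + m')\<close>. These are controlled by a seminorm on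
  integer vectors, the size of the unstable component, which \<open>T\<close> expands and which is
  bounded below by a negative power of the length (Katznelson). A Hoelder function is a uniform limit
  of Fejer means; its dyadic Fejer bands decorrelate after a number of steps proportional to
  the scale, so the normalised sums of \<open>\<phi>\<close>, twisted by \<open>B\<close> or not, are uniformly
  approximated in the square norm by those of trigonometric polynomials. For these, sums over
  Bernstein blocks with constant gaps have exactly independent second-order Taylor factors, which
  gives the central limit theorem for each fixed translate \<open>y\<close>, even when tested against a character
  of \<open>x\<close>. Smoothing in \<open>y\<close> by a Fejer kernel then allows \<open>y\<close> to be replaced by \<open>- B x\<close>, and the
  limit is a Gaussian mixture by Levy's continuity theorem.
\<close>

section \<open>Products of linear factors of an operator\<close>

text \<open>\<open>A\<close> need not be hyperbolic: eigenvalues on the unit circle are allowed as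
  long as they are not roots of unity, so nonzero integer vectors can come arbitrarily close to the
  centre-stable space. A polynomial lower bound is exactly what can be afforded, since it costs only
  a logarithm of the frequency in time, and the bands decay geometrically. The spectral theory runs
  on products of linear factors, whose kernels play the role of spectral subspaces. The exponential
  of a block sum has infinite spectrum. Truncation at order two leaves sums of at most two
  frequencies, and their seminorms are bounded above and, unless zero, below, uniformly in the block
  length; this is why the gap can stay constant while blocks grow. For the twist, the kernel of
  order \<open>N\<close> creates the test frequencies \<open>transpose E *v (k - l)\<close>;
  \<open>det B \<noteq> 0\<close> keeps them nonzero for \<open>k \<noteq> l\<close>. The smoothing
  error does not grow with \<open>n\<close>, because the variation of an orbit sum in
  \<open>y\<close> is governed by exponential sums of square norm \<open>sqrt (real n)\<close>, the
  order of the normalisation.\<close>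

definition clinear_op :: "(complex ^ 'd \<Rightarrow> complex ^ 'd::finite) \<Rightarrow> bool" where
  "clinear_op U \<longleftrightarrow> (\<forall>v w. U (v + w) = U v + U w) \<and> (\<forall>c v. U (c *s v) = c *s U v)"

lemma clinear_op_add: "clinear_op U \<Longrightarrow> U (v + w) = U v + U w"
  and clinear_op_scale: "clinear_op U \<Longrightarrow> U (c *s v) = c *s U v"
  by (auto simp: clinear_op_def)

lemma clinear_op_zero: "clinear_op U \<Longrightarrow> U 0 = 0"
  using clinear_op_scale[of U 0 0] by simp

lemma clinear_op_diff: "clinear_op U \<Longrightarrow> U (v - w) = U v - U w"
  using clinear_op_add[of U "v - w" w] by simp

lemma clinear_op_uminus: "clinear_op U \<Longrightarrow> U (- v) = - U v"
  using clinear_op_diff[of U 0 v] by (simp add: clinear_op_zero)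

lemma scaleR_eq_smult: "r *\<^sub>R (v :: complex ^ 'd::finite) = complex_of_real r *s v"
  by (simp add: vec_eq_iff scaleR_conv_of_real[where 'a = complex])

lemma norm_smult: "norm (c *s v) = norm c * norm (v :: complex ^ 'd::finite)"
  by (simp add: norm_vec_def L2_set_def norm_mult power_mult_distrib real_sqrt_mult
      flip: sum_distrib_left)

lemma clinear_op_bounded_linear: "clinear_op U \<Longrightarrow> bounded_linear U"
  by (intro linear_conv_bounded_linear[THEN iffD1] linearI)
     (auto simp: clinear_op_add clinear_op_scale scaleR_eq_smult)

lemma clinear_op_bound:
  assumes "clinear_op U"
  obtains K where "K \<ge> 1" "\<And>v. norm (U v) \<le> K * norm v"
proof -
  obtain K where K: "\<And>v. norm (U v) \<le> norm v * K"
    using bounded_linear.bounded[OF clinear_op_bounded_linear[OF assms]] by auto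
  have "norm (U v) \<le> max K 1 * norm v" for v
    using K[of v] mult_right_mono[OF max.cobounded1[of K 1] norm_ge_zero[of v]]
    by (simp add: mult.commute)
  then show ?thesis by (intro that[of "max K 1"]) auto
qed

lemma clinear_op_id: "clinear_op (\<lambda>v. v)"
  and clinear_op_compose: "clinear_op U \<Longrightarrow> clinear_op V \<Longrightarrow> clinear_op (\<lambda>v. U (V v))"
  and clinear_op_plus: "clinear_op U \<Longrightarrow> clinear_op V \<Longrightarrow> clinear_op (\<lambda>v. U v + V v)"
  and clinear_op_minus: "clinear_op U \<Longrightarrow> clinear_op V \<Longrightarrow> clinear_op (\<lambda>v. U v - V v)"
  and clinear_op_smult: "clinear_op U \<Longrightarrow> clinear_op (\<lambda>v. c *s U v)"
  and clinear_op_matrix: "clinear_op (\<lambda>v. M *v v)"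
  by (auto simp: clinear_op_def algebra_simps vector_add_ldistrib vec.scale vec.add
      vector_sub_rdistrib vector_smult_assoc)

lemma clinear_op_funpow: "clinear_op U \<Longrightarrow> clinear_op (U ^^ n)"
  by (induction n) (auto simp: clinear_op_def)

lemma clinear_op_diff_scale: "clinear_op U \<Longrightarrow> clinear_op (\<lambda>v. U v - r *s v)"
  by (intro clinear_op_minus clinear_op_smult clinear_op_id)

text \<open>Stands in for spectral projections: when the whole list annihilates \<open>U\<close>,
  the kernel of the product over the roots of modulus at most 1 is the centre-stable space, and
  generalised eigenvectors never appear explicitly.\<close>

primrec lin_prod ::
    "(complex ^ 'd \<Rightarrow> complex ^ 'd::finite) \<Rightarrow> complex list \<Rightarrow> complex ^ 'd \<Rightarrow> complex ^ 'd" where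
  "lin_prod U [] v = v"
| "lin_prod U (r # rs) v = lin_prod U rs (U v - r *s v)"

lemma clinear_op_lin_prod: "clinear_op U \<Longrightarrow> clinear_op (lin_prod U rs)"
proof (induction rs)
  case Nil
  show ?case using clinear_op_id by (simp add: clinear_op_def)
next
  case (Cons r rs)
  then show ?case
    using clinear_op_compose[of "lin_prod U rs" "\<lambda>v. U v - r *s v"] clinear_op_diff_scale[of U r]
    by (simp add: clinear_op_def)
qed

lemma lin_prod_commute:
  assumes "clinear_op W" "\<And>v. W (U v) = U (W v)"
  shows "W (lin_prod U rs v) = lin_prod U rs (W v)"
  by (induction rs arbitrary: v)
     (simp_all add: assms(2) clinear_op_diff[OF assms(1)] clinear_op_scale[OF assms(1)])

text \<open>The factors commute, so an annihilating product can be split by the modulus of its roots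
  into a centre-stable and an unstable product.\<close>

lemma lin_prod_filter:
  assumes "clinear_op U"
  shows "lin_prod U rs v = lin_prod U (filter (\<lambda>r. \<not> P r) rs) (lin_prod U (filter P rs) v)"
proof (induction rs arbitrary: v)
  case (Cons r rs)
  have "(\<lambda>v. U v - r *s v) (lin_prod U (filter P rs) v) = lin_prod U (filter P rs) (U v - r *s v)"
    by (rule lin_prod_commute)
       (use assms in \<open>auto intro: clinear_op_diff_scale simp: clinear_op_diff clinear_op_scale\<close>)
  then show ?case using Cons by simp
qed simp

text \<open>Each \<open>U - f r\<close> is divisible by \<open>T - r\<close>; the quotients
  \<open>W\<close> commute with \<open>U\<close>, can therefore be collected in front, and
  contribute only a bounded operator. Vectors killed by the product for \<open>T\<close> are thus
  killed by the product for \<open>U\<close>.\<close>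

lemma lin_prod_transfer:
  fixes U T :: "complex ^ 'd \<Rightarrow> complex ^ 'd::finite"
  assumes "\<And>r. r \<in> set rs \<Longrightarrow> \<exists>W. clinear_op W \<and> (\<forall>v. W (U v) = U (W v)) \<and>
             (\<forall>v. U v - f r *s v = W (T v - r *s v))"
  shows "\<exists>K\<ge>0. \<forall>v. norm (lin_prod U (map f rs) v) \<le> K * norm (lin_prod T rs v)"
  using assms
proof (induction rs)
  case Nil
  show ?case by (intro exI[of _ 1]) simp
next
  case (Cons r rs)
  then obtain K where K: "K \<ge> 0" "\<And>v. norm (lin_prod U (map f rs) v) \<le> K * norm (lin_prod T rs v)"
    by force
  obtain W where W: "clinear_op W" "\<And>v. W (U v) = U (W v)"
      "\<And>v. U v - f r *s v = W (T v - r *s v)"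
    using Cons.prems[of r] by auto
  obtain K' where K': "K' \<ge> 1" "\<And>v. norm (W v) \<le> K' * norm v"
    using clinear_op_bound[OF W(1)] by blast
  have "norm (lin_prod U (map f (r # rs)) v) \<le> (K' * K) * norm (lin_prod T (r # rs) v)" for v
  proof -
    have "lin_prod U (map f (r # rs)) v = W (lin_prod U (map f rs) (T v - r *s v))"
      by (simp add: W(3) lin_prod_commute[of W U, OF W(1,2)])
    also have "norm \<dots> \<le> K' * norm (lin_prod U (map f rs) (T v - r *s v))"
      by (rule K')
    also have "\<dots> \<le> K' * (K * norm (lin_prod T rs (T v - r *s v)))"
      using K' by (intro mult_left_mono K) auto
    finally show ?thesis by (simp add: mult_ac)
  qed
  then show ?case using K K' by (intro exI[of _ "K' * K"]) auto
qed

text \<open>The constants solve \<open>\<tau> * y = \<theta> * y + a\<close> and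
  \<open>K * y = \<theta> * y + b\<close>: a source growing faster than \<theta> passes its own rate
  on to the solution.\<close>

lemma geometric_recursion_bound:
  fixes x :: "nat \<Rightarrow> real"
  assumes "0 \<le> \<theta>" "\<theta> < \<tau>" "\<tau> < K" "0 \<le> a" "0 \<le> b" "0 \<le> x 0"
    and "\<And>n. x (Suc n) \<le> \<theta> * x n + a * \<tau> ^ n + b * K ^ n"
  shows "x n \<le> (x 0 + a / (\<tau> - \<theta>)) * \<tau> ^ n + b / (K - \<theta>) * K ^ n"
proof (induction n)
  case 0
  show ?case using assms by simp
next
  case (Suc n)
  have "x (Suc n) \<le> \<theta> * ((x 0 + a / (\<tau> - \<theta>)) * \<tau> ^ n + b / (K - \<theta>) * K ^ n) + a * \<tau> ^ n + b * K ^ n"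
    using assms(7)[of n] mult_left_mono[OF Suc assms(1)] by linarith
  also have "\<dots> = \<theta> * x 0 * \<tau> ^ n + (\<theta> * (a / (\<tau> - \<theta>)) + a) * \<tau> ^ n
      + (\<theta> * (b / (K - \<theta>)) + b) * K ^ n"
    by (simp add: algebra_simps)
  also have "\<theta> * (a / (\<tau> - \<theta>)) + a = \<tau> * (a / (\<tau> - \<theta>))"
    using assms by (simp add: field_simps)
  also have "\<theta> * (b / (K - \<theta>)) + b = K * (b / (K - \<theta>))"
    using assms by (simp add: field_simps)
  also have "\<theta> * x 0 * \<tau> ^ n \<le> \<tau> * x 0 * \<tau> ^ n"
    using assms by (intro mult_right_mono) auto
  finally show ?case by (simp add: algebra_simps)
qed

text \<open>Peeling off one factor with \<open>w = U v - r *s v\<close> gives the recursion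
  \<open>U^(n+1) v = r U^n v + U^n w\<close>. As \<open>norm r < \<tau>\<close> strictly, the
  polynomial growth caused by multiple roots is absorbed by \<open>\<tau> ^ n\<close>. The second
  summand measures how far \<open>v\<close> is from the kernel of the product.\<close>

lemma funpow_lin_prod_bound:
  fixes U :: "complex ^ 'd \<Rightarrow> complex ^ 'd::finite"
  assumes U: "clinear_op U" and K: "\<And>v. norm (U v) \<le> K * norm v" "\<tau> < K"
    and "\<And>r. r \<in> set rs \<Longrightarrow> norm r < \<tau>" "0 \<le> \<tau>"
  shows "\<exists>C\<ge>0. \<forall>n v. norm ((U ^^ n) v) \<le> C * (\<tau> ^ n * norm v + K ^ n * norm (lin_prod U rs v))"
  using assms(4)
proof (induction rs)
  case Nil
  have "norm ((U ^^ n) v) \<le> K ^ n * norm v" for n v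
  proof (induction n)
    case (Suc n)
    have "norm ((U ^^ Suc n) v) \<le> K * norm ((U ^^ n) v)" using K by simp
    also have "\<dots> \<le> K * (K ^ n * norm v)" using Suc K assms by (intro mult_left_mono) auto
    finally show ?case by simp
  qed simp
  moreover have "K ^ n * norm v \<le> \<tau> ^ n * norm v + K ^ n * norm v" for n and v :: "complex ^ 'd"
    using assms by simp
  ultimately have "norm ((U ^^ n) v) \<le> \<tau> ^ n * norm v + K ^ n * norm v" for n v
    by (rule order_trans)
  then show ?case by (intro exI[of _ 1]) auto
next
  case (Cons r rs)
  then obtain C where C: "C \<ge> 0"
      "\<And>n v. norm ((U ^^ n) v) \<le> C * (\<tau> ^ n * norm v + K ^ n * norm (lin_prod U rs v))"
    by force
  define \<theta> where "\<theta> = norm r"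
  have \<theta>: "0 \<le> \<theta>" "\<theta> < \<tau>" "\<theta> < K" using Cons.prems[of r] K by (auto simp: \<theta>_def)
  have K0: "0 \<le> K" using K assms by linarith
  \<comment> \<open>Both constants are those of \<open>geometric_recursion_bound\<close> once
    \<open>norm w \<le> (K + \<theta>) * norm v\<close> is inserted; the 1 accounts for the initial
    value.\<close>
  define C1 where "C1 = 1 + C * (K + \<theta>) / (\<tau> - \<theta>)"
  define C2 where "C2 = C / (K - \<theta>)"
  have C12: "0 \<le> C1" "0 \<le> C2" using C \<theta> K0 by (auto simp: C1_def C2_def)
  have "norm ((U ^^ n) v) \<le> (C1 + C2) * (\<tau> ^ n * norm v + K ^ n * norm (lin_prod U (r # rs) v))" for n v
  proof -
    define w where "w = U v - r *s v"
    define e where "e = norm (lin_prod U rs w)"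
    have w: "norm w \<le> (K + \<theta>) * norm v"
      using norm_triangle_ineq4[of "U v" "r *s v"] K(1)[of v]
      by (simp add: w_def norm_smult \<theta>_def algebra_simps)
    have step: "norm ((U ^^ Suc m) v) \<le> \<theta> * norm ((U ^^ m) v)
        + (C * ((K + \<theta>) * norm v)) * \<tau> ^ m + (C * e) * K ^ m" for m
    proof -
      have "(U ^^ Suc m) v = (U ^^ m) (w + r *s v)"
        by (simp add: w_def funpow_swap1)
      also have "\<dots> = (U ^^ m) w + r *s (U ^^ m) v"
        using clinear_op_funpow[OF U, of m] by (simp add: clinear_op_add clinear_op_scale)
      finally have "norm ((U ^^ Suc m) v) \<le> norm ((U ^^ m) w) + \<theta> * norm ((U ^^ m) v)"
        using norm_triangle_ineq[of "(U ^^ m) w" "r *s (U ^^ m) v"]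
        by (simp only: norm_smult \<theta>_def)
      also have "norm ((U ^^ m) w) \<le> C * (\<tau> ^ m * ((K + \<theta>) * norm v) + K ^ m * e)"
        using C(2)[of m w] C(1) w assms(5)
        by (auto simp: e_def intro!: order_trans[OF C(2)[of m w]] mult_left_mono)
      finally show ?thesis by (simp add: algebra_simps)
    qed
    have "norm ((U ^^ n) v) \<le> (norm ((U ^^ 0) v) + (C * ((K + \<theta>) * norm v)) / (\<tau> - \<theta>)) * \<tau> ^ n
        + (C * e) / (K - \<theta>) * K ^ n"
      by (rule geometric_recursion_bound[where x = "\<lambda>n. norm ((U ^^ n) v)"])
         (use \<theta> K C step K0 in \<open>auto simp: e_def intro!: mult_nonneg_nonneg\<close>)
    also have "\<dots> = C1 * (\<tau> ^ n * norm v) + C2 * (K ^ n * e)"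
      using \<theta> by (simp add: C1_def C2_def field_simps)
    also have "\<dots> \<le> (C1 + C2) * (\<tau> ^ n * norm v + K ^ n * e)"
    proof -
      have "0 \<le> \<tau> ^ n * norm v" "0 \<le> K ^ n * e"
        using assms(5) K0 by (auto simp: e_def)
      then have "0 \<le> C2 * (\<tau> ^ n * norm v)" "0 \<le> C1 * (K ^ n * e)"
        using C12 by auto
      then show ?thesis by (simp add: algebra_simps)
    qed
    finally show ?thesis by (simp add: e_def w_def)
  qed
  then show ?case using C12 by (intro exI[of _ "C1 + C2"]) auto
qed

section \<open>Polynomials of an operator and annihilating products\<close>

definition poly_act :: "(complex ^ 'd \<Rightarrow> complex ^ 'd::finite) \<Rightarrow> complex poly \<Rightarrow> complex ^ 'd \<Rightarrow> complex ^ 'd" where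
  "poly_act U p v = (\<Sum>i\<le>degree p. coeff p i *s (U ^^ i) v)"

lemma poly_act_bound:
  assumes "degree p \<le> n"
  shows "poly_act U p v = (\<Sum>i\<le>n. coeff p i *s (U ^^ i) v)"
  unfolding poly_act_def using assms
  by (intro sum.mono_neutral_left) (auto simp: coeff_eq_0)

lemma poly_act_linear_factor:
  assumes "clinear_op U"
  shows "poly_act U ([:- r, 1:] * q) v = poly_act U q (U v - r *s v)"
proof -
  define n where "n = degree q"
  have cf: "coeff ([:- r, 1:] * q) i = (case i of 0 \<Rightarrow> 0 | Suc j \<Rightarrow> coeff q j) - r * coeff q i" for i
    by (simp add: coeff_pCons)
  have deg: "degree ([:- r, 1:] * q) \<le> Suc n"
    unfolding n_def by (rule order_trans[OF degree_mult_le]) auto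
  have "poly_act U ([:- r, 1:] * q) v
      = (\<Sum>i\<le>Suc n. (case i of 0 \<Rightarrow> 0 | Suc j \<Rightarrow> coeff q j) *s (U ^^ i) v)
        - (\<Sum>i\<le>Suc n. (r * coeff q i) *s (U ^^ i) v)"
    unfolding poly_act_bound[OF deg] cf by (simp only: vector_sub_rdistrib sum_subtractf)
  also have "(\<Sum>i\<le>Suc n. (case i of 0 \<Rightarrow> 0 | Suc j \<Rightarrow> coeff q j) *s (U ^^ i) v)
      = (\<Sum>j\<le>n. coeff q j *s (U ^^ Suc j) v)"
    by (subst sum.atMost_Suc_shift) simp
  also have "(\<Sum>i\<le>Suc n. (r * coeff q i) *s (U ^^ i) v) = (\<Sum>i\<le>n. (r * coeff q i) *s (U ^^ i) v)"
    by (simp add: coeff_eq_0 n_def)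
  also have "(\<Sum>j\<le>n. coeff q j *s (U ^^ Suc j) v) - (\<Sum>i\<le>n. (r * coeff q i) *s (U ^^ i) v)
      = (\<Sum>j\<le>n. coeff q j *s (U ^^ j) (U v - r *s v))"
    unfolding sum_subtractf[symmetric]
    by (intro sum.cong refl)
       (simp add: clinear_op_diff[OF clinear_op_funpow[OF assms]] funpow_swap1
         clinear_op_scale[OF clinear_op_funpow[OF assms]] vector_ssub_ldistrib vector_smult_assoc mult.commute)
  finally show ?thesis by (simp add: poly_act_def n_def)
qed

lemma poly_act_factorization:
  assumes "clinear_op U" "p \<noteq> 0"
  obtains rs where "\<And>r. r \<in> set rs \<longleftrightarrow> poly p r = 0" "\<And>v. poly_act U p v = lead_coeff p *s lin_prod U rs v"
proof -
  obtain A where A: "p = smult (lead_coeff p) (\<Prod>x\<in>#A. [:-x, 1:])"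
    using alg_closed_imp_factorization[OF assms(2)] by blast
  obtain rs where rs: "mset rs = A" using ex_mset by blast
  define q where "q = (\<Prod>x\<leftarrow>rs. [:-x, 1:])"
  have p: "p = smult (lead_coeff p) q"
    using A by (simp add: q_def prod_mset_prod_list flip: rs mset_map)
  have l: "lead_coeff p \<noteq> 0" using assms by simp
  have 1: "poly q r = 0 \<longleftrightarrow> r \<in> set rs" for r
    unfolding q_def by (induction rs) auto
  have 2: "poly_act U q v = lin_prod U rs v" for v
    unfolding q_def
  proof (induction rs arbitrary: v)
    case Nil
    show ?case by (simp add: poly_act_def)
  next
    case (Cons r rs)
    then show ?case by (simp only: list.map prod_list.Cons poly_act_linear_factor[OF assms(1)] lin_prod.simps)
  qed
  have 3: "poly_act U p v = lead_coeff p *s poly_act U q v" for v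
    by (subst p, subst poly_act_bound[of _ "degree q"]) (use l in \<open>auto simp: poly_act_def vec.scale_sum_right vector_smult_assoc\<close>)
  have "poly p r = lead_coeff p * poly q r" for r
    by (subst p) simp
  then show ?thesis using 1 2 3 l by (intro that[of rs]) auto
qed

text \<open>Some factor is the first to send its argument to zero; that argument is an
  eigenvector.\<close>

lemma lin_prod_eigenvector:
  assumes "lin_prod U rs v = 0" "v \<noteq> 0"
  shows "\<exists>r\<in>set rs. \<exists>w. w \<noteq> 0 \<and> U w = r *s w"
  using assms
proof (induction rs arbitrary: v)
  case (Cons r rs)
  show ?case
  proof (cases "U v - r *s v = 0")
    case True
    then show ?thesis using Cons by auto
  next
    case False
    then show ?thesis using Cons by auto
  qed
qed simp

text \<open>The product over the roots of \<open>z ^ k - 1\<close> kills \<open>v\<close>, so one of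
  these roots of unity is an eigenvalue.\<close>

lemma funpow_fixed_eigenvector:
  assumes U: "clinear_op U" and "(U ^^ k) v = v" "v \<noteq> 0" "k > 0"
  shows "\<exists>r w. r ^ k = 1 \<and> w \<noteq> 0 \<and> U w = r *s w"
proof -
  define p where "p = monom 1 k - (1 :: complex poly)"
  have d: "degree p \<le> k"
    unfolding p_def by (intro degree_diff_le) (auto simp: degree_monom_le)
  have "coeff p k = 1" using assms(4) by (simp add: p_def)
  then have p0: "p \<noteq> 0" by auto
  obtain rs where rs: "\<And>r. r \<in> set rs \<longleftrightarrow> poly p r = 0" "\<And>v. poly_act U p v = lead_coeff p *s lin_prod U rs v"
    using poly_act_factorization[OF U p0] by metis
  have "poly_act U p v = (\<Sum>i\<le>k. coeff p i *s (U ^^ i) v)"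
    by (rule poly_act_bound[OF d])
  also have "\<dots> = (\<Sum>i\<le>k. if i = k then (U ^^ k) v else 0) - (\<Sum>i\<le>k. if i = 0 then v else 0)"
    unfolding sum_subtractf[symmetric]
    by (intro sum.cong refl) (auto simp: p_def coeff_monom vector_sub_rdistrib)
  also have "\<dots> = 0" using assms(2) by (simp add: sum.delta)
  finally have "lin_prod U rs v = 0" using rs(2)[of v] p0 by simp
  from lin_prod_eigenvector[OF this assms(3)] show ?thesis
    using rs(1) by (force simp: p_def poly_monom)
qed

lemma matrix_power_mult_vec: "matrix_power M k *v v = (((*v) M) ^^ k) v"
  by (induction k) (simp_all flip: matrix_vector_mul_assoc)

text \<open>Applied to the powers of a matrix it yields an annihilating polynomial. A family that is
  not injective is treated apart: the image set forgets the repetition, but the difference of two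
  equal members is itself a relation.\<close>

lemma linear_relation_exists:
  fixes f :: "nat \<Rightarrow> 'a::euclidean_space"
  shows "\<exists>n a. (\<exists>i\<le>n. a i \<noteq> 0) \<and> (\<Sum>i\<le>n. a i *\<^sub>R f i) = 0"
proof -
  define n where "n = DIM('a)"
  show ?thesis
  proof (cases "inj_on f {..n}")
    case True
    then have "card (f ` {..n}) > DIM('a)" by (simp add: card_image n_def)
    then have "dependent (f ` {..n})" by (intro dependent_biggerset) auto
    then obtain u where u: "\<exists>v\<in>f ` {..n}. u v \<noteq> 0" "(\<Sum>v\<in>f ` {..n}. u v *\<^sub>R v) = 0"
      using real_vector.dependent_finite[of "f ` {..n}"] by auto
    have "(\<Sum>i\<le>n. u (f i) *\<^sub>R f i) = 0"
      using u(2) by (subst (asm) sum.reindex[OF True]) (simp add: o_def)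
    then show ?thesis using u(1) by (intro exI[of _ n] exI[of _ "\<lambda>i. u (f i)"]) auto
  next
    case False
    then obtain i j where ij: "i \<le> n" "j \<le> n" "i \<noteq> j" "f i = f j" by (auto simp: inj_on_def)
    define a where "a k = (if k = i then 1 else if k = j then -1 else 0 :: real)" for k
    have "(\<Sum>k\<le>n. a k *\<^sub>R f k) = (\<Sum>k\<in>{i, j}. a k *\<^sub>R f k)"
      using ij by (intro sum.mono_neutral_right) (auto simp: a_def)
    also have "\<dots> = 0" using ij by (simp add: a_def)
    finally show ?thesis using ij by (intro exI[of _ n] exI[of _ a]) (auto simp: a_def)
  qed
qed

lemma scaleR_matrix_vector_mult: "(a *\<^sub>R M) *v v = a *\<^sub>R (M *v v)"
  for M :: "complex ^ 'd ^ 'd::finite"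
  by (simp add: vec_eq_iff matrix_vector_mult_def scaleR_sum_right)

lemma lin_prod_annihilator:
  fixes M :: "complex ^ 'd ^ 'd::finite"
  obtains rs where "\<And>v. lin_prod ((*v) M) rs v = 0"
proof -
  obtain n and a :: "nat \<Rightarrow> real" and i where a: "i \<le> n" "a i \<noteq> 0" "(\<Sum>i\<le>n. a i *\<^sub>R matrix_power M i) = 0"
    using linear_relation_exists[of "matrix_power M"] by blast
  define p where "p = (\<Sum>i\<le>n. monom (complex_of_real (a i)) i)"
  have cf: "coeff p j = (if j \<le> n then complex_of_real (a j) else 0)" for j
    by (simp add: p_def coeff_sum coeff_monom)
  have U: "clinear_op ((*v) M)" by (rule clinear_op_matrix)
  have p0: "p \<noteq> 0" using cf[of i] a by auto
  have "degree p \<le> n" by (intro degree_le) (simp add: cf)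
  then have "poly_act ((*v) M) p v = (\<Sum>i\<le>n. coeff p i *s (((*v) M) ^^ i) v)" for v
    by (rule poly_act_bound)
  also have "\<dots> v = (\<Sum>i\<le>n. a i *\<^sub>R (matrix_power M i *v v))" for v
    by (intro sum.cong refl) (simp add: cf matrix_power_mult_vec scaleR_eq_smult)
  also have "\<dots> v = (\<Sum>i\<le>n. a i *\<^sub>R matrix_power M i) *v v" for v
    by (induction n) (simp_all add: matrix_vector_mult_add_rdistrib scaleR_matrix_vector_mult)
  finally have "poly_act ((*v) M) p v = 0" for v using a by simp
  moreover obtain rs where "\<And>v. poly_act ((*v) M) p v = lead_coeff p *s lin_prod ((*v) M) rs v"
    using poly_act_factorization[OF U p0] by metis
  ultimately show ?thesis using p0 by (intro that[of rs]) simp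
qed

text \<open>Dirichlet's theorem supplies one \<open>k\<close> with \<open>r ^ k\<close> close to 1
  for all roots on the unit circle at once. On these the factor \<open>r ^ j\<close> has modulus
  one, so \<open>j\<close> may be taken large to handle the roots inside the disc.\<close>

lemma simultaneous_contraction:
  fixes rs :: "complex list"
  assumes "\<And>r. r \<in> set rs \<Longrightarrow> norm r \<le> 1"
  obtains j k where "k > 0" "\<And>r. r \<in> set rs \<Longrightarrow> norm (r ^ j * (r ^ k - 1)) < 1"
proof -
  define \<theta> where "\<theta> i = Arg (rs ! i) / (2 * pi)" for i
  \<comment> \<open>The accuracy 1/7 makes the error in the angle less than
    \<open>2 * pi / 7\<close>, which is below 1.\<close>
  obtain q p where q: "0 < q" "\<And>i. i < length rs \<Longrightarrow> \<bar>of_int q * \<theta> i - of_int (p i)\<bar> < 1 / real 7"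
    using Dirichlet_approx_simult[of 7 "length rs" \<theta>] by (metis zero_less_numeral)
  define k where "k = nat q"
  have k: "k > 0" "real k = of_int q" using q by (auto simp: k_def)
  have unit: "norm (r ^ k - 1) < 1" if r: "r \<in> set rs" "norm r = 1" for r
  proof -
    obtain i where i: "i < length rs" "r = rs ! i" using r by (metis in_set_conv_nth)
    define x where "x = 2 * pi * (of_int q * (Arg r / (2 * pi)) - of_int (p i))"
    have "r = cis (Arg r)" using r by (metis cis_Arg norm_eq_zero rcis_cmod_Arg rcis_def mult_1 of_real_1 zero_neq_one)
    then have "r ^ k = cis (Arg r) ^ k" by (rule arg_cong)
    also have "\<dots> = cis (real k * Arg r)" by (rule Complex.DeMoivre)
    also have "real k * Arg r = x + 2 * pi * of_int (p i)" by (simp add: x_def k field_simps)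
    also have "cis \<dots> = cis x" by (simp add: cis_mult[symmetric] cis_multiple_2pi)
    finally have "norm (r ^ k - 1) = norm (cis x - cis 0)" by simp
    also have "\<dots> \<le> \<bar>x\<bar>"
      using iexp_approx1[of x 0] by (simp add: cis_conv_exp)
    also have "\<bar>x\<bar> = 2 * pi * \<bar>of_int q * (Arg r / (2 * pi)) - of_int (p i)\<bar>" by (simp add: x_def abs_mult)
    also have "\<dots> < 2 * pi * (1 / 7)" using q(2)[OF i(1)] i unfolding \<theta>_def by (intro mult_strict_left_mono) auto
    also have "\<dots> < 1" using pi_approx by simp
    finally show ?thesis .
  qed
  have ex: "\<exists>j0. \<forall>j\<ge>j0. norm (r ^ j * (r ^ k - 1)) < 1" if r: "r \<in> set rs" for r
  proof (cases "norm r = 1")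
    case True
    then show ?thesis using unit[OF r] by (auto simp: norm_mult norm_power)
  next
    case False
    then have "norm r < 1" using assms[OF r] by simp
    then have "(\<lambda>j. norm r ^ j * norm (r ^ k - 1)) \<longlonglongrightarrow> 0 * norm (r ^ k - 1)"
      by (intro tendsto_mult LIMSEQ_realpow_zero tendsto_const) auto
    then have "\<forall>\<^sub>F j in sequentially. norm r ^ j * norm (r ^ k - 1) < 1"
      by (intro order_tendstoD) auto
    then show ?thesis by (simp add: eventually_sequentially norm_mult norm_power)
  qed
  then obtain J where J: "\<And>r j. r \<in> set rs \<Longrightarrow> j \<ge> J r \<Longrightarrow> norm (r ^ j * (r ^ k - 1)) < 1"
    by metis
  show ?thesis
  proof (rule that[OF k(1)])
    fix r assume r: "r \<in> set rs"
    then have "J r \<le> Max (J ` set rs)" by (intro Max_ge) auto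
    then show "norm (r ^ Max (J ` set rs) * (r ^ k - 1)) < 1" using J r by blast
  qed
qed

section \<open>Expansion of integer vectors\<close>

definition cvec :: "int ^ 'd \<Rightarrow> complex ^ 'd::finite" where
  "cvec m = (\<chi> i. of_int (m $ i))"

definition int_norm :: "int ^ 'd::finite \<Rightarrow> real" where
  "int_norm m = (\<Sum>i\<in>UNIV. \<bar>real_of_int (m $ i)\<bar>)"

lemma cvec_add: "cvec (m + n) = cvec m + cvec n"
  and cvec_diff: "cvec (m - n) = cvec m - cvec n"
  and cvec_minus: "cvec (- m) = - cvec m"
  and cvec_0: "cvec 0 = 0"
  by (simp_all add: cvec_def vec_eq_iff)

lemma cvec_eq_0: "cvec m = 0 \<longleftrightarrow> m = 0"
  by (simp add: cvec_def vec_eq_iff)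

lemma cvec_mult: "cvec (M *v m) = map_matrix of_int M *v cvec m"
  by (simp add: cvec_def vec_eq_iff matrix_vector_mult_def)

lemma norm_cvec_le: "norm (cvec m) \<le> int_norm m"
  unfolding norm_vec_def int_norm_def by (rule order_trans[OF L2_set_le_sum]) (auto simp: cvec_def)

lemma norm_cvec_ge:
  assumes "m \<noteq> 0"
  shows "1 \<le> norm (cvec m)"
proof -
  obtain i where i: "m $ i \<noteq> 0" using assms by (auto simp: vec_eq_iff)
  then have "1 \<le> \<bar>m $ i\<bar>" by linarith
  then have "1 \<le> \<bar>real_of_int (m $ i)\<bar>" by linarith
  then have "1 \<le> norm (cvec m $ i)" by (simp add: cvec_def)
  also have "\<dots> \<le> norm (cvec m)" by (rule Finite_Cartesian_Product.norm_nth_le)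
  finally show ?thesis .
qed

lemma int_norm_nonneg: "0 \<le> int_norm m"
  and int_norm_add: "int_norm (m + n) \<le> int_norm m + int_norm n"
  by (auto simp: int_norm_def sum_nonneg abs_triangle_ineq simp flip: sum.distrib intro!: sum_mono)

lemma int_norm_ge_1: "m \<noteq> 0 \<Longrightarrow> 1 \<le> int_norm m"
  using norm_cvec_ge norm_cvec_le order_trans by blast

lemma int_norm_mult_bound:
  fixes M :: "int ^ 'd ^ 'd::finite"
  obtains K where "K \<ge> 0" "\<And>m. int_norm (M *v m) \<le> K * int_norm m"
proof -
  define K where "K = (\<Sum>i\<in>UNIV. \<Sum>j\<in>UNIV. \<bar>real_of_int (M $ i $ j)\<bar>)"
  have "int_norm (M *v m) \<le> K * int_norm m" for m
  proof -
    have le: "\<bar>real_of_int (m $ j)\<bar> \<le> int_norm m" for j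
      unfolding int_norm_def by (rule member_le_sum) auto
    have "int_norm (M *v m) = (\<Sum>i\<in>UNIV. \<bar>\<Sum>j\<in>UNIV. real_of_int (M $ i $ j) * real_of_int (m $ j)\<bar>)"
      by (simp add: int_norm_def matrix_vector_mult_def)
    also have "\<dots> \<le> (\<Sum>i\<in>UNIV. \<Sum>j\<in>UNIV. \<bar>real_of_int (M $ i $ j) * real_of_int (m $ j)\<bar>)"
      by (intro sum_mono sum_abs)
    also have "\<dots> \<le> (\<Sum>i\<in>UNIV. \<Sum>j\<in>UNIV. \<bar>real_of_int (M $ i $ j)\<bar> * int_norm m)"
      unfolding abs_mult by (intro sum_mono mult_left_mono le) auto
    also have "\<dots> = K * int_norm m" by (simp add: K_def sum_distrib_right)
    finally show ?thesis .
  qed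
  moreover have "K \<ge> 0" by (auto simp: K_def intro!: sum_nonneg)
  ultimately show ?thesis by (rule that[rotated])
qed

lemma finite_strict_upper_bound:
  assumes "finite S" "\<And>x. x \<in> S \<Longrightarrow> x < (1 :: real)"
  obtains \<tau> where "0 < \<tau>" "\<tau> < 1" "\<And>x. x \<in> S \<Longrightarrow> x < \<tau>"
proof -
  have "\<exists>\<tau>. 0 < \<tau> \<and> \<tau> < 1 \<and> (\<forall>x\<in>S. x < \<tau>)"
    using assms
  proof (induction S)
    case empty
    show ?case by (intro exI[of _ "1 / 2"]) auto
  next
    case (insert y S)
    then obtain \<tau> where "0 < \<tau>" "\<tau> < 1" "\<forall>x\<in>S. x < \<tau>" by auto
    moreover obtain z where "max y \<tau> < z" "z < 1"
      using dense[of "max y \<tau>" 1] insert.prems \<open>\<tau> < 1\<close> by auto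
    ultimately show ?case by (intro exI[of _ z]) auto
  qed
  then show ?thesis using that by blast
qed

text \<open>The quotients constructed next are polynomials in \<open>T\<close>; the property
  retained is that they commute with whatever commutes with \<open>T\<close>, in particular with the
  contraction built from \<open>T\<close>.\<close>

definition bicommutant :: "(complex ^ 'd \<Rightarrow> complex ^ 'd::finite) \<Rightarrow> (complex ^ 'd \<Rightarrow> complex ^ 'd) \<Rightarrow> bool" where
  "bicommutant T W \<longleftrightarrow> clinear_op W \<and>
     (\<forall>V. clinear_op V \<longrightarrow> (\<forall>v. T (V v) = V (T v)) \<longrightarrow> (\<forall>v. W (V v) = V (W v)))"

lemma bicommutantD:
  assumes "bicommutant T W"
  shows "clinear_op W" "clinear_op V \<Longrightarrow> (\<And>v. T (V v) = V (T v)) \<Longrightarrow> W (V v) = V (W v)"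
  using assms by (auto simp: bicommutant_def)

text \<open>The quotient in \<open>T^n - r^n = W_n (T - r)\<close> is built by
  \<open>W_{n+1} = T W_n + r^n\<close>, starting from zero.\<close>

lemma funpow_diff_factor:
  assumes T: "clinear_op T"
  shows "\<exists>W. bicommutant T W \<and> (\<forall>v. (T ^^ n) v - r ^ n *s v = W (T v - r *s v))"
proof (induction n)
  case 0
  have "bicommutant T (\<lambda>v. 0)" by (auto simp: bicommutant_def clinear_op_zero) (simp add: clinear_op_def)
  then show ?case by (intro exI[of _ "\<lambda>v. 0"]) simp
next
  case (Suc n)
  then obtain W where W: "bicommutant T W" "\<forall>v. (T ^^ n) v - r ^ n *s v = W (T v - r *s v)"
    by (elim exE conjE)
  note W1 = bicommutantD[OF W(1)]
  have "(T ^^ Suc n) v - r ^ Suc n *s v = T (W (T v - r *s v)) + r ^ n *s (T v - r *s v)" for v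
    by (simp add: W(2)[rule_format, symmetric] clinear_op_diff[OF T] clinear_op_scale[OF T] vector_ssub_ldistrib
        vector_smult_assoc mult.commute)
  moreover have "bicommutant T (\<lambda>v. T (W v) + r ^ n *s v)"
    unfolding bicommutant_def
    using clinear_op_plus[OF clinear_op_compose[OF T W1(1)] clinear_op_smult[OF clinear_op_id]]
    by (auto simp: W1(2) clinear_op_add clinear_op_scale)
  ultimately show ?case
    by (intro exI[of _ "\<lambda>v. T (W v) + r ^ n *s v"]) simp
qed

text \<open>
  Katznelson's lemma. If \<open>m\<close> were too close to the centre-stable space, an operator
  \<open>U = T^j (T^k - 1)\<close> contracting that space would map the nonzero integer vector \<open>m\<close> by
  some power into the open unit ball; but \<open>U\<close> is injective on integer vectors.
\<close>

lemma centre_stable_distance: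
  fixes T :: "int ^ 'd ^ 'd::finite"
  defines "Tc \<equiv> (*v) (map_matrix of_int T :: complex ^ 'd ^ 'd)"
  assumes inj: "\<And>v. Tc v = 0 \<Longrightarrow> v = 0"
    and no_unit: "\<And>v k. k > 0 \<Longrightarrow> (Tc ^^ k) v = v \<Longrightarrow> v = 0"
    and rs: "\<And>r. r \<in> set rs \<Longrightarrow> norm r \<le> 1"
  obtains c D where "c > 0" "D \<ge> 0"
    "\<And>m. m \<noteq> 0 \<Longrightarrow> c * int_norm m powr (- D) \<le> norm (lin_prod Tc rs (cvec m))"
proof -
  have T: "clinear_op Tc" unfolding Tc_def by (rule clinear_op_matrix)
  note Tp = clinear_op_funpow[OF T]
  obtain j k where jk: "k > 0" "\<And>r. r \<in> set rs \<Longrightarrow> norm (r ^ j * (r ^ k - 1)) < 1"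
    using simultaneous_contraction[of rs] rs by metis
  \<comment> \<open>\<open>f r\<close> is the value at \<open>r\<close> of the polynomial
    \<open>z^j (z^k - 1)\<close> that defines \<open>U\<close> from \<open>T\<close>; it has modulus
    below 1 for every \<open>r\<close> in \<open>rs\<close>.\<close>
  define f where "f r = r ^ j * (r ^ k - 1)" for r :: complex
  define U where "U v = (Tc ^^ j) ((Tc ^^ k) v - v)" for v
  have U: "clinear_op U"
    unfolding U_def by (rule clinear_op_compose[OF Tp clinear_op_minus[OF Tp clinear_op_id]])
  have comm: "Tc (U v) = U (Tc v)" for v
  proof -
    have "Tc (U v) = (Tc ^^ j) (Tc ((Tc ^^ k) v - v))" by (simp only: U_def funpow_swap1)
    also have "\<dots> = (Tc ^^ j) ((Tc ^^ k) (Tc v) - Tc v)" by (simp only: clinear_op_diff[OF T] funpow_swap1)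
    finally show ?thesis by (simp only: U_def)
  qed
  have "\<exists>W. clinear_op W \<and> (\<forall>v. W (U v) = U (W v)) \<and> (\<forall>v. U v - f r *s v = W (Tc v - r *s v))" for r
  proof -
    obtain W1 where W1: "bicommutant Tc W1" "\<forall>v. (Tc ^^ (j + k)) v - r ^ (j + k) *s v = W1 (Tc v - r *s v)"
      using funpow_diff_factor[OF T, of "j + k" r] by (elim exE conjE)
    obtain W2 where W2: "bicommutant Tc W2" "\<forall>v. (Tc ^^ j) v - r ^ j *s v = W2 (Tc v - r *s v)"
      using funpow_diff_factor[OF T, of j r] by (elim exE conjE)
    \<comment> \<open>Since \<open>T^j (T^k - 1) = T^(j + k) - T^j\<close>, subtracting the two
      quotients gives the one for \<open>U\<close>.\<close>
    have "U v - f r *s v = W1 (Tc v - r *s v) - W2 (Tc v - r *s v)" for v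
      by (simp add: W1(2)[rule_format, symmetric] W2(2)[rule_format, symmetric] U_def f_def funpow_add
          clinear_op_diff[OF Tp] power_add algebra_simps vector_sub_rdistrib)
    moreover have "W1 (U v) - W2 (U v) = U (W1 v - W2 v)" for v
      by (simp add: bicommutantD(2)[OF W1(1) U comm] bicommutantD(2)[OF W2(1) U comm] clinear_op_diff[OF U])
    ultimately show ?thesis
      using clinear_op_minus[OF bicommutantD(1)[OF W1(1)] bicommutantD(1)[OF W2(1)]]
      by (intro exI[of _ "\<lambda>v. W1 v - W2 v"]) simp
  qed
  then obtain C0 where C0: "C0 \<ge> 0" "\<And>v. norm (lin_prod U (map f rs) v) \<le> C0 * norm (lin_prod Tc rs v)"
    using lin_prod_transfer[of rs U f Tc] by blast
  obtain \<tau> where \<tau>: "0 < \<tau>" "\<tau> < 1" "\<And>x. x \<in> (\<lambda>r. norm (f r)) ` set rs \<Longrightarrow> x < \<tau>"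
    using finite_strict_upper_bound[of "(\<lambda>r. norm (f r)) ` set rs"] jk(2) by (auto simp: f_def)
  then have \<tau>f: "norm r < \<tau>" if "r \<in> set (map f rs)" for r
    using that by auto
  obtain K where K: "K \<ge> 1" "\<And>v. norm (U v) \<le> K * norm v" using clinear_op_bound[OF U] by blast
  obtain C1 where C1: "C1 \<ge> 0"
      "\<And>n v. norm ((U ^^ n) v) \<le> C1 * (\<tau> ^ n * norm v + K ^ n * norm (lin_prod U (map f rs) v))"
    using funpow_lin_prod_bound[OF U K(2) _ \<tau>f, of "map f rs"] \<tau> K(1) by (auto dest: less_le_trans)
  define C where "C = max 1 (max C1 (C1 * C0))"
  have C: "C \<ge> 1" "C1 \<le> C" "C1 * C0 \<le> C" by (auto simp: C_def)
  have main: "norm ((U ^^ n) v) \<le> C * \<tau> ^ n * norm v + C * K ^ n * norm (lin_prod Tc rs v)" for n v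
  proof -
    have "norm ((U ^^ n) v) \<le> C1 * (\<tau> ^ n * norm v) + C1 * (K ^ n * norm (lin_prod U (map f rs) v))"
      using C1(2)[of n v] by (simp add: algebra_simps)
    also have "C1 * (K ^ n * norm (lin_prod U (map f rs) v)) \<le> C1 * (K ^ n * (C0 * norm (lin_prod Tc rs v)))"
      using C1 K C0 by (intro mult_left_mono) auto
    also have "\<dots> = (C1 * C0) * (K ^ n * norm (lin_prod Tc rs v))" by simp
    also have "\<dots> \<le> C * (K ^ n * norm (lin_prod Tc rs v))"
      using C K by (intro mult_right_mono) auto
    also have "C1 * (\<tau> ^ n * norm v) \<le> C * (\<tau> ^ n * norm v)"
      using C \<tau> by (intro mult_right_mono) auto
    finally show ?thesis by (simp add: mult_ac)
  qed
  \<comment> \<open>Integer vectors stay integer under \<open>U\<close>, and no nonzero one is sent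
    to zero: that would produce a nonzero vector fixed by \<open>T^k\<close>.\<close>
  have U_int: "\<exists>m'. m' \<noteq> 0 \<and> (U ^^ n) (cvec m) = cvec m'" if "m \<noteq> 0" for n and m :: "int ^ 'd"
  proof (induction n)
    case 0
    show ?case using that by auto
  next
    case (Suc n)
    then obtain m' where m': "m' \<noteq> 0" "(U ^^ n) (cvec m) = cvec m'" by blast
    have pw: "(Tc ^^ i) (cvec w) = cvec ((((*v) T) ^^ i) w)" for i w
      by (induction i) (auto simp: Tc_def cvec_mult)
    have U': "(U ^^ Suc n) (cvec m) = cvec ((((*v) T) ^^ j) ((((*v) T) ^^ k) m' - m'))"
      by (simp add: m'(2) U_def pw flip: cvec_diff)
    have "U (cvec m') \<noteq> 0"
    proof
      assume *: "U (cvec m') = 0"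
      have "(Tc ^^ i) v = 0 \<Longrightarrow> v = 0" for i v by (induction i) (auto dest: inj)
      then have "(Tc ^^ k) (cvec m') = cvec m'" using * by (metis U_def eq_iff_diff_eq_0)
      from no_unit[OF jk(1) this] show False using m' by (simp add: cvec_eq_0)
    qed
    then show ?case using U' m'(2) by (metis cvec_0 funpow.simps(2) o_apply)
  qed
  \<comment> \<open>The number of iterations will be logarithmic in the length of \<open>m\<close>;
    this exponent turns the growth \<open>(2 * K) ^ n\<close> into a power of
    \<open>\<tau> ^ n\<close>, hence of the length.\<close>
  define D where "D = ln (2 * K) / - ln \<tau>"
  have D: "D \<ge> 0" unfolding D_def using K \<tau> by (intro divide_nonneg_pos) (auto simp: ln_ge_zero ln_less_zero)
  have KD: "(2 * K) ^ n = (\<tau> ^ n) powr (- D)" for n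
    using \<tau> K by (simp add: powr_def D_def ln_realpow exp_of_nat2_mult power_mult_distrib)
  define c where "c = (2 * C / \<tau>) powr (- D) / (2 * C)"
  show ?thesis
  proof (rule that[of c D])
    show "c > 0" using C \<tau> by (simp add: c_def)
    show "D \<ge> 0" by fact
    fix m :: "int ^ 'd" assume m: "m \<noteq> 0"
    have N1: "int_norm m \<ge> 1" by (rule int_norm_ge_1[OF m])
    have "\<exists>n. \<tau> ^ n < 1 / (2 * C * int_norm m)"
      using \<tau> C N1 by (intro real_arch_pow_inv) auto
    then have ex: "\<exists>n. C * \<tau> ^ n * int_norm m \<le> 1 / 2"
      using C N1 by (auto simp: field_simps intro!: less_imp_le)
    \<comment> \<open>After \<open>n\<close> steps the contracted part is at most 1/2 while the
      image has norm at least 1, so the defect term carries the rest. Minimality keeps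
      \<open>\<tau> ^ n\<close> bounded below in terms of the length.\<close>
    define n where "n = (LEAST n. C * \<tau> ^ n * int_norm m \<le> 1 / 2)"
    have n: "C * \<tau> ^ n * int_norm m \<le> 1 / 2" unfolding n_def by (rule LeastI_ex[OF ex])
    have "1 * 1 \<le> C * int_norm m" using C N1 by (intro mult_mono) auto
    then have "n \<noteq> 0" using n by (intro notI) auto
    then obtain n' where n': "n = Suc n'" by (cases n) auto
    have "\<not> C * \<tau> ^ n' * int_norm m \<le> 1 / 2"
      using not_less_Least[of n' "\<lambda>n. C * \<tau> ^ n * int_norm m \<le> 1 / 2"] n' by (auto simp: n_def)
    then have tn: "\<tau> / (2 * C * int_norm m) \<le> \<tau> ^ n"
      using n' \<tau> C N1 by (simp add: field_simps)
    have "1 \<le> norm ((U ^^ n) (cvec m))"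
      using U_int[OF m, of n] norm_cvec_ge by fastforce
    also have "\<dots> \<le> C * \<tau> ^ n * norm (cvec m) + C * K ^ n * norm (lin_prod Tc rs (cvec m))"
      by (rule main)
    also have "C * \<tau> ^ n * norm (cvec m) \<le> C * \<tau> ^ n * int_norm m"
      using C \<tau> by (intro mult_left_mono norm_cvec_le) auto
    also note n
    finally have "1 / 2 \<le> C * K ^ n * norm (lin_prod Tc rs (cvec m))" by simp
    also have "\<dots> \<le> C * (2 * K) ^ n * norm (lin_prod Tc rs (cvec m))"
      using C K by (intro mult_right_mono mult_left_mono power_mono) auto
    also have "\<dots> = C * (\<tau> ^ n) powr (- D) * norm (lin_prod Tc rs (cvec m))" by (simp only: KD)
    also have "\<dots> \<le> C * (\<tau> / (2 * C * int_norm m)) powr (- D) * norm (lin_prod Tc rs (cvec m))"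
      using C \<tau> N1 D tn by (intro mult_right_mono mult_left_mono powr_mono2') auto
    also have "\<tau> / (2 * C * int_norm m) = inverse ((2 * C / \<tau>) * int_norm m)"
      by (simp add: field_simps)
    also have "\<dots> powr (- D) = inverse ((2 * C / \<tau>) powr (- D) * int_norm m powr (- D))"
    proof -
      have "inverse (z * w) powr (- D) = inverse (z powr (- D) * w powr (- D))" if "0 < z" "0 < w" for z w
        using that by (subst inverse_powr) (simp_all only: powr_mult mult_nonneg_nonneg less_imp_le)
      moreover have "0 < 2 * C / \<tau>" "0 < int_norm m" using C \<tau> N1 by auto
      ultimately show ?thesis by blast
    qed
    finally have "(2 * C / \<tau>) powr (- D) * int_norm m powr (- D) * (1 / 2) \<le> C * norm (lin_prod Tc rs (cvec m))"
      using C \<tau> N1 by (simp add: field_simps)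
    then show "c * int_norm m powr (- D) \<le> norm (lin_prod Tc rs (cvec m))"
      using C by (simp add: c_def field_simps)
  qed
qed

text \<open>
  The sequence \<open>h a m\<close> is an adapted norm of the unstable component of \<open>T\<^sup>-\<^sup>a m\<close>; the
  factor \<open>\<kappa> ^ k\<close> under the supremum makes \<open>T\<close> expand it.
\<close>

locale expanding_family =
  fixes T :: "int ^ 'd ^ 'd::finite" and h :: "nat \<Rightarrow> int ^ 'd \<Rightarrow> real" and \<kappa> C c D :: real
  assumes \<kappa>: "\<kappa> > 1" and C0: "C \<ge> 0" and c0: "c > 0" and D0: "D \<ge> 0"
    and h_add: "h a (m + n) \<le> h a m + h a n"
    and h_minus: "h a (- m) = h a m"
    and h_Suc_T: "h (Suc a) (T *v m) = h a m"
    and h_Suc: "\<kappa> * h (Suc a) m \<le> h a m"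
    and h_upper: "h 0 m \<le> C * int_norm m"
    and h_lower: "m \<noteq> 0 \<Longrightarrow> c * int_norm m powr (- D) \<le> h 0 m"

text \<open>The product \<open>G\<close> over the centre-stable roots maps into the unstable space,
  on which the inverse \<open>S\<close> contracts. There the powers of \<open>\<kappa> S\<close> are
  bounded, so the suprema defining \<open>h\<close> are finite. The lower bound is the term
  \<open>k = 0\<close> combined with \<open>centre_stable_distance\<close>.\<close>

lemma expanding_family_exists:
  fixes T :: "int ^ 'd ^ 'd::finite"
  defines "Tc \<equiv> (*v) (map_matrix of_int T :: complex ^ 'd ^ 'd)"
  assumes inj: "\<And>v. Tc v = 0 \<Longrightarrow> v = 0"
    and no_unit: "\<And>v k. k > 0 \<Longrightarrow> (Tc ^^ k) v = v \<Longrightarrow> v = 0"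
  shows "\<exists>h \<kappa> C c D. expanding_family T h \<kappa> C c D"
proof -
  have T: "clinear_op Tc" unfolding Tc_def by (rule clinear_op_matrix)
  obtain Ti where Ti_inv: "Ti ** (map_matrix of_int T :: complex ^ 'd ^ 'd) = mat 1"
    using inj matrix_left_invertible_ker[of "map_matrix of_int T :: complex ^ 'd ^ 'd"]
    unfolding Tc_def by blast
  define S where "S = (*v) Ti"
  have S: "clinear_op S" unfolding S_def by (rule clinear_op_matrix)
  have ST: "S (Tc v) = v" for v by (simp add: S_def Tc_def matrix_vector_mul_assoc Ti_inv)
  have TS: "Tc (S v) = v" for v
    using Ti_inv[unfolded matrix_left_right_inverse[of Ti]] by (simp add: S_def Tc_def matrix_vector_mul_assoc)
  obtain rs where rs: "\<And>v. lin_prod Tc rs v = 0"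
    unfolding Tc_def using lin_prod_annihilator by metis
  define cs where "cs = filter (\<lambda>r. norm r \<le> 1) rs"
  define us where "us = filter (\<lambda>r. \<not> norm r \<le> 1) rs"
  define G where "G = lin_prod Tc cs"
  have G: "clinear_op G" unfolding G_def by (rule clinear_op_lin_prod[OF T])
  have GT: "G (Tc v) = Tc (G v)" for v
    unfolding G_def by (rule lin_prod_commute[of Tc Tc, symmetric, OF T refl])
  have usG: "lin_prod Tc us (G v) = 0" for v
    using lin_prod_filter[OF T, of rs v "\<lambda>r. norm r \<le> 1"] rs by (simp add: us_def cs_def G_def)
  obtain c D where cD: "c > 0" "D \<ge> 0"
      "\<And>m. m \<noteq> 0 \<Longrightarrow> c * int_norm m powr (- D) \<le> norm (G (cvec m))"
    using centre_stable_distance[of T cs] inj no_unit unfolding Tc_def G_def cs_def by (auto simp: cs_def)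
  obtain \<tau> where \<tau>: "0 < \<tau>" "\<tau> < 1" "\<And>x. x \<in> (\<lambda>r. inverse (norm r)) ` set us \<Longrightarrow> x < \<tau>"
  proof (rule finite_strict_upper_bound[of "(\<lambda>r. inverse (norm r)) ` set us"])
    show "x < 1" if "x \<in> (\<lambda>r. inverse (norm r)) ` set us" for x
      using that by (auto simp: us_def intro!: inverse_less_1_iff[THEN iffD2])
  qed auto
  \<comment> \<open>\<tau> exceeds the inverse of every unstable modulus, so the roots
    \<open>\<kappa> / r\<close> that belong to \<open>\<kappa> S\<close> lie strictly inside the
    unit disc.\<close>
  define \<kappa> where "\<kappa> = inverse \<tau>"
  have \<kappa>: "\<kappa> > 1" using \<tau> by (simp add: \<kappa>_def field_simps)
  define U where "U v = complex_of_real \<kappa> *s S v" for v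
  have U: "clinear_op U" unfolding U_def by (rule clinear_op_smult[OF S])
  define f where "f r = complex_of_real \<kappa> / r" for r
  have "\<exists>W. clinear_op W \<and> (\<forall>v. W (U v) = U (W v)) \<and> (\<forall>v. U v - f r *s v = W (Tc v - r *s v))"
    if "r \<in> set us" for r
  proof -
    have r: "r \<noteq> 0" using that by (auto simp: us_def)
    have "U v - f r *s v = (- f r) *s S (Tc v - r *s v)" for v
      using r by (simp add: U_def f_def clinear_op_diff[OF S] clinear_op_scale[OF S] ST
          vector_ssub_ldistrib vector_smult_assoc) 
    moreover have "(- f r) *s S (U v) = U ((- f r) *s S v)" for v
      by (simp add: U_def clinear_op_scale[OF S] clinear_op_uminus[OF S] vector_smult_assoc mult.commute)
    ultimately show ?thesis
      using clinear_op_smult[OF S, of "- f r"] by (intro exI[of _ "\<lambda>v. (- f r) *s S v"]) simp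
  qed
  then obtain C0 where C0: "C0 \<ge> 0" "\<And>v. norm (lin_prod U (map f us) v) \<le> C0 * norm (lin_prod Tc us v)"
    using lin_prod_transfer[of us U f Tc] by blast
  then have fG: "lin_prod U (map f us) (G v) = 0" for v
    using C0(2)[of "G v"] by (simp add: usG)
  have f1: "norm r < 1" if "r \<in> set (map f us)" for r
  proof -
    from that obtain x where x: "x \<in> set us" "r = f x" by auto
    then have "inverse (norm x) < \<tau>" using \<tau>(3) by blast
    then have "\<kappa> * inverse (norm x) < \<kappa> * \<tau>" using \<kappa> by (intro mult_strict_left_mono) auto
    also have "\<kappa> * \<tau> = 1" using \<tau>(1) by (simp add: \<kappa>_def)
    finally have "\<kappa> * inverse (norm x) < 1" .
    then show ?thesis using \<kappa> by (simp add: x f_def norm_divide) (simp add: divide_inverse)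
  qed
  obtain K where K: "K \<ge> 1" "\<And>v. norm (U v) \<le> K * norm v" using clinear_op_bound[OF U] by metis
  \<comment> \<open>Rate 1 in \<open>funpow_lin_prod_bound\<close> requires an operator bound
    strictly above 1.\<close>
  have K2: "norm (U v) \<le> (K + 1) * norm v" for v
    using K(2)[of v] norm_ge_zero[of v] unfolding distrib_right by linarith
  obtain C1 where C1: "C1 \<ge> 0"
      "\<forall>n v. norm ((U ^^ n) v) \<le> C1 * (1 ^ n * norm v + (K + 1) ^ n * norm (lin_prod U (map f us) v))"
    using funpow_lin_prod_bound[OF U K2 _ f1, of "map f us"] K(1) by auto
  have Un: "(U ^^ n) v = complex_of_real (\<kappa> ^ n) *s (S ^^ n) v" for n v
    by (induction n) (simp_all add: U_def clinear_op_scale[OF S] vector_smult_assoc)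
  have bd: "\<kappa> ^ k * norm ((S ^^ k) (G v)) \<le> C1 * norm (G v)" for k v
    using C1(2)[rule_format, of k "G v"] \<kappa> by (simp add: fG Un norm_smult norm_power)
  have SG: "(S ^^ a) (G v) = G ((S ^^ a) v)" for a v
  proof (induction a)
    case (Suc a)
    have "S (G w) = G (S w)" for w by (metis GT ST TS)
    then show ?case using Suc by simp
  qed simp
  define h where "h a m = (SUP k. \<kappa> ^ k * norm ((S ^^ (k + a)) (G (cvec m))))" for a m
  have bdd: "bdd_above (range (\<lambda>k. \<kappa> ^ k * norm ((S ^^ (k + a)) (G v))))" for a v
    by (intro bdd_aboveI2[where M = "C1 * norm (G ((S ^^ a) v))"]) (metis SG bd funpow_add o_apply)
  have up: "\<kappa> ^ k * norm ((S ^^ (k + a)) (G (cvec m))) \<le> h a m" for k a m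
    unfolding h_def by (intro cSUP_upper bdd) auto
  note Sp = clinear_op_funpow[OF S]
  obtain KG where KG: "KG \<ge> 1" "\<And>v. norm (G v) \<le> KG * norm v" using clinear_op_bound[OF G] by metis
  have "expanding_family T h \<kappa> (C1 * KG) c D"
  proof
    show "\<kappa> > 1" "c > 0" "D \<ge> 0" by fact+
    show "C1 * KG \<ge> 0" using C1 KG by auto
    show "h a (m + n) \<le> h a m + h a n" for a m n
    proof (subst h_def, rule cSUP_least)
      fix k :: nat
      have "\<kappa> ^ k * norm ((S ^^ (k + a)) (G (cvec (m + n))))
          \<le> \<kappa> ^ k * (norm ((S ^^ (k + a)) (G (cvec m))) + norm ((S ^^ (k + a)) (G (cvec n))))"
        using \<kappa> by (intro mult_left_mono)
          (auto simp: cvec_add clinear_op_add[OF G] clinear_op_add[OF Sp] norm_triangle_ineq)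
      also have "\<dots> \<le> h a m + h a n"
        using up[of k a m] up[of k a n] by (simp add: algebra_simps)
      finally show "\<kappa> ^ k * norm ((S ^^ (k + a)) (G (cvec (m + n)))) \<le> h a m + h a n" .
    qed simp
    show "h a (- m) = h a m" for a m
      by (simp add: h_def cvec_minus clinear_op_uminus[OF G] clinear_op_uminus[OF Sp])
    show "h (Suc a) (T *v m) = h a m" for a m
    proof -
      have "(S ^^ (k + Suc a)) (G (cvec (T *v m))) = (S ^^ (k + a)) (G (cvec m))" for k
      proof -
        have "cvec (T *v m) = Tc (cvec m)" by (simp add: Tc_def cvec_mult)
        then have "(S ^^ (k + Suc a)) (G (cvec (T *v m))) = (S ^^ (k + a)) (S (G (Tc (cvec m))))"
          by (simp add: funpow_swap1)
        then show ?thesis by (simp add: GT ST)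
      qed
      then show ?thesis by (simp add: h_def)
    qed
    \<comment> \<open>Term \<open>k\<close> of the supremum at index \<open>Suc a\<close> is term
      \<open>k + 1\<close> at index \<open>a\<close>, up to the factor \<kappa>.\<close>
    show "\<kappa> * h (Suc a) m \<le> h a m" for a m
    proof -
      have "h (Suc a) m \<le> h a m / \<kappa>"
        unfolding h_def[of "Suc a"]
      proof (rule cSUP_least)
        show "\<kappa> ^ k * norm ((S ^^ (k + Suc a)) (G (cvec m))) \<le> h a m / \<kappa>" for k
          using up[of "Suc k" a m] \<kappa> by (simp add: field_simps)
      qed simp
      then show ?thesis using \<kappa> by (simp add: field_simps)
    qed
    show "h 0 m \<le> C1 * KG * int_norm m" for m
      unfolding h_def
    proof (rule cSUP_least)
      fix k :: nat
      have "\<kappa> ^ k * norm ((S ^^ (k + 0)) (G (cvec m))) \<le> C1 * norm (G (cvec m))"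
        using bd[of k "cvec m"] by simp
      also have "\<dots> \<le> C1 * (KG * norm (cvec m))" using C1 KG by (intro mult_left_mono) auto
      also have "\<dots> \<le> C1 * (KG * int_norm m)" using C1 KG norm_cvec_le by (intro mult_left_mono) auto
      finally show "\<kappa> ^ k * norm ((S ^^ (k + 0)) (G (cvec m))) \<le> C1 * KG * int_norm m" by simp
    qed simp
    show "m \<noteq> 0 \<Longrightarrow> c * int_norm m powr (- D) \<le> h 0 m" for m
      using cD(3)[of m] up[of 0 0 m] by simp
  qed
  then show ?thesis by blast
qed

lemma vec_kernel_transpose:
  fixes M :: "'a::field ^ 'd ^ 'd::finite"
  assumes "M *v v = 0" "v \<noteq> 0"
  shows "\<exists>w. w \<noteq> 0 \<and> transpose M *v w = 0"
proof -
  have "\<not> invertible M"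
    using assms matrix_left_invertible_ker[of M] invertible_left_inverse[of M] by metis
  then have "\<not> invertible (transpose M)" by (simp add: invertible_det_nz det_transpose)
  then show ?thesis using matrix_left_invertible_ker[of "transpose M"] invertible_left_inverse[of "transpose M"] by metis
qed

lemma mat_scalar_vec: "mat r *v w = r *s (w :: 'a::comm_semiring_1 ^ 'd::finite)"
  by (simp add: vec_eq_iff matrix_vector_mult_def mat_def if_distrib if_distribR cong: if_cong)

text \<open>\<open>A\<close> acts on characters through its transpose, while the hypothesis concerns
  eigenvalues of \<open>A\<close>. A singular \<open>M - r\<close> has a singular transpose, so
  roots of unity are excluded for both.\<close>

lemma expanding_family_of_ergodic:
  fixes A :: "int ^ 'd ^ 'd::finite"
  assumes "det A = 1" "\<And>z. eigenvalue_of A z \<Longrightarrow> \<not> root_of_unity z"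
  shows "\<exists>h \<kappa> C c D. expanding_family (transpose A) h \<kappa> C c D"
proof (rule expanding_family_exists)
  let ?M = "map_matrix of_int (transpose A) :: complex ^ 'd ^ 'd"
  have tr: "transpose ?M = map_matrix of_int A" by (simp add: vec_eq_iff transpose_def)
  have "det ?M = of_int (det (transpose A))"
    unfolding det_def by simp
  then have "det ?M = 1" by (simp add: det_transpose assms)
  then have "invertible ?M" by (simp add: invertible_det_nz)
  then show "v = 0" if "?M *v v = 0" for v
    using that matrix_left_invertible_ker[of ?M] invertible_left_inverse[of ?M] by metis
  show "v = 0" if k: "k > 0" "(((*v) ?M) ^^ k) v = v" for v k
  proof (rule ccontr)
    assume "v \<noteq> 0"
    from funpow_fixed_eigenvector[of "(*v) ?M", OF clinear_op_matrix k(2) this k(1)]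
    obtain r w where r: "r ^ k = 1" "w \<noteq> 0" "?M *v w = r *s w" by (elim exE conjE)
    then have "(?M - mat r) *v w = 0"
      by (simp add: matrix_vector_mult_diff_rdistrib mat_scalar_vec)
    from vec_kernel_transpose[OF this r(2)] obtain w' where w': "w' \<noteq> 0" "transpose (?M - mat r) *v w' = 0"
      by blast
    have "transpose (?M - mat r) = map_matrix of_int A - mat r"
      by (auto simp: vec_eq_iff transpose_def mat_def)
    then have "map_matrix of_int A *v w' = r *s w'"
      using w'(2) by (simp add: matrix_vector_mult_diff_rdistrib mat_scalar_vec)
    then have "eigenvalue_of A r" using w' by (auto simp: eigenvalue_of_def)
    moreover have "root_of_unity r" using r(1) k by (auto simp: root_of_unity_def)
    ultimately show False using assms(2) by metis
  qed
qed

section \<open>Characters of the torus\<close>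

lift_definition tchar :: "int ^ 'd \<Rightarrow> 'd::finite torus \<Rightarrow> complex" is
  "\<lambda>m x. cis (2 * pi * (\<Sum>i\<in>UNIV. of_int (m $ i) * x $ i))"
proof -
  fix m :: "int ^ 'd" and x y :: "real ^ 'd"
  assume "x - y \<in> int_lattice"
  then have "(\<Sum>i\<in>UNIV. of_int (m $ i) * (x - y) $ i) \<in> \<int>"
    by (intro Ints_sum Ints_mult) (auto simp: int_lattice_def)
  then have "cis (2 * pi * (\<Sum>i\<in>UNIV. of_int (m $ i) * (x - y) $ i)) = 1"
    by (rule cis_multiple_2pi)
  moreover have "2 * pi * (\<Sum>i\<in>UNIV. of_int (m $ i) * x $ i)
      = 2 * pi * (\<Sum>i\<in>UNIV. of_int (m $ i) * (x - y) $ i) + 2 * pi * (\<Sum>i\<in>UNIV. of_int (m $ i) * y $ i)"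
    by (simp add: algebra_simps sum_subtractf)
  ultimately show "cis (2 * pi * (\<Sum>i\<in>UNIV. of_int (m $ i) * x $ i))
      = cis (2 * pi * (\<Sum>i\<in>UNIV. of_int (m $ i) * y $ i))"
    by (simp add: cis_mult[symmetric])
qed

lemma tchar_to_torus: "tchar m (to_torus x) = cis (2 * pi * (\<Sum>i\<in>UNIV. of_int (m $ i) * x $ i))"
  by (rule tchar.abs_eq)

lemma tchar_add_freq: "tchar (m + n) x = tchar m x * tchar n x"
  by transfer (simp add: cis_mult algebra_simps sum.distrib)

lemma tchar_plus: "tchar m (x + y) = tchar m x * tchar m y"
  by transfer (simp add: cis_mult algebra_simps sum.distrib)

lemma tchar_0 [simp]: "tchar 0 x = 1"
  by transfer simp

lemma norm_tchar [simp]: "norm (tchar m x) = 1"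
  by transfer simp

lemma tchar_minus_freq: "tchar (- m) x = cnj (tchar m x)"
  by transfer (simp add: cis_cnj sum_negf)

lemma tchar_minus: "tchar m (- x) = cnj (tchar m x)"
  by transfer (simp add: cis_cnj sum_negf)

lemma tchar_diff: "tchar m (x - y) = tchar m x * cnj (tchar m y)"
  using tchar_plus[of m x "- y"] by (simp add: tchar_minus)

lemma tchar_torus_mult: "tchar m (torus_mult M x) = tchar (transpose M *v m) x"
proof transfer
  fix m :: "int ^ 'd" and M :: "int ^ 'd ^ 'd" and x :: "real ^ 'd"
  have "(\<Sum>i\<in>UNIV. of_int (m $ i) * (map_matrix of_int M *v x) $ i)
      = (\<Sum>i\<in>UNIV. \<Sum>j\<in>UNIV. of_int (m $ i) * of_int (M $ i $ j) * x $ j)"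
    by (simp add: matrix_vector_mult_def sum_distrib_left mult.assoc)
  also have "\<dots> = (\<Sum>j\<in>UNIV. \<Sum>i\<in>UNIV. of_int (m $ i) * of_int (M $ i $ j) * x $ j)"
    by (rule sum.swap)
  also have "\<dots> = (\<Sum>j\<in>UNIV. of_int ((transpose M *v m) $ j) * x $ j)"
    by (simp add: matrix_vector_mult_def transpose_def sum_distrib_right sum_distrib_left mult_ac)
  finally show "cis (2 * pi * (\<Sum>i\<in>UNIV. of_int (m $ i) * (map_matrix of_int M *v x) $ i))
      = cis (2 * pi * (\<Sum>i\<in>UNIV. of_int ((transpose M *v m) $ i) * x $ i))"
    by simp
qed

lemma norm_cis_minus_1_le: "norm (cis x - 1) \<le> \<bar>x\<bar>"
  using iexp_approx1[of x 0] by (simp add: cis_conv_exp)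

text \<open>The bound holds for every representative of \<open>x\<close> modulo the lattice, and the
  infimum over these is the distance. A vanishing \<open>int_norm m\<close> is split off because the
  bound is divided by it before the infimum is taken.\<close>

lemma tchar_minus_1_le: "norm (tchar m x - 1) \<le> 2 * pi * int_norm m * dist x 0"
proof -
  show ?thesis
  proof transfer
    fix m :: "int ^ 'd" and x :: "real ^ 'd"
    let ?c = "cis (2 * pi * (\<Sum>i\<in>UNIV. of_int (m $ i) * x $ i))"
    have le: "norm (?c - 1) \<le> 2 * pi * int_norm m * dist (x - 0) a" if a: "a \<in> int_lattice" for a
    proof -
      have "to_torus x = to_torus (x - a)"
        using a by (simp add: torus.abs_eq_iff)
      then have "?c = cis (2 * pi * (\<Sum>i\<in>UNIV. of_int (m $ i) * (x - a) $ i))"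
        by (metis tchar_to_torus)
      also have "norm (\<dots> - 1) \<le> \<bar>2 * pi * (\<Sum>i\<in>UNIV. of_int (m $ i) * (x - a) $ i)\<bar>"
        by (rule norm_cis_minus_1_le)
      also have "\<dots> = 2 * pi * \<bar>\<Sum>i\<in>UNIV. of_int (m $ i) * (x - a) $ i\<bar>"
        by (simp only: abs_mult) simp
      also have "\<bar>\<Sum>i\<in>UNIV. of_int (m $ i) * (x - a) $ i\<bar> \<le> (\<Sum>i\<in>UNIV. \<bar>real_of_int (m $ i)\<bar> * norm (x - a))"
        by (rule order_trans[OF sum_abs])
           (intro sum_mono, simp only: abs_mult, intro mult_left_mono component_le_norm_cart, simp)
      also have "\<dots> = int_norm m * norm (x - a)" by (simp add: int_norm_def sum_distrib_right)
      finally show ?thesis by (simp add: dist_norm mult_ac)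
    qed
    show "norm (?c - 1) \<le> 2 * pi * int_norm m * infdist (x - 0) int_lattice"
    proof (cases "int_norm m = 0")
      case True
      then show ?thesis using le[OF int_lattice_zero] by simp
    next
      case False
      then have pos: "2 * pi * int_norm m > 0" using int_norm_nonneg[of m] by simp
      have "norm (?c - 1) / (2 * pi * int_norm m) \<le> infdist (x - 0) int_lattice"
      proof (subst infdist_notempty)
        show "norm (?c - 1) / (2 * pi * int_norm m) \<le> (INF a\<in>int_lattice. dist (x - 0) a)"
        proof (rule cINF_greatest)
          fix a :: "real ^ 'd" assume "a \<in> int_lattice"
          from le[OF this] show "norm (?c - 1) / (2 * pi * int_norm m) \<le> dist (x - 0) a"
            unfolding pos_divide_le_eq[OF pos] by (subst mult.commute)
        qed (use int_lattice_zero in auto)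
      qed (use int_lattice_zero in auto)
      then show ?thesis unfolding pos_divide_le_eq[OF pos] by (subst mult.commute)
    qed
  qed
qed

lemma dist_torus_diff: "dist x y = dist (x - y) (0 :: 'd::finite torus)"
  by transfer simp

lemma tchar_lipschitz: "norm (tchar m x - tchar m y) \<le> 2 * pi * int_norm m * dist x y"
proof -
  have "tchar m x - tchar m y = tchar m y * (tchar m (x - y) - 1)"
    using complex_norm_square[of "tchar m y"]
    by (simp add: tchar_diff algebra_simps)
  then have "norm (tchar m x - tchar m y) = norm (tchar m (x - y) - 1)" by (simp add: norm_mult)
  also have "\<dots> \<le> 2 * pi * int_norm m * dist x y"
    using tchar_minus_1_le[of m "x - y"] by (simp add: dist_torus_diff[of x y])
  finally show ?thesis .
qed

lemma continuous_tchar: "continuous_on UNIV (tchar m)"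
proof (rule continuous_onI)
  fix x :: "'a torus" and e :: real assume e: "e > 0"
  define L where "L = 2 * pi * int_norm m + 1"
  have L: "L > 0" using int_norm_nonneg[of m] by (simp add: L_def add_nonneg_pos)
  have "dist (tchar m y) (tchar m x) \<le> e" if "dist y x < e / L" for y
  proof -
    have "dist (tchar m y) (tchar m x) \<le> 2 * pi * int_norm m * dist y x"
      using tchar_lipschitz[of m y x] by (simp add: dist_norm)
    also have "\<dots> \<le> L * dist y x" by (intro mult_right_mono) (auto simp: L_def)
    also have "\<dots> \<le> e" using that L by (simp add: field_simps)
    finally show ?thesis .
  qed
  then show "\<exists>d>0. \<forall>x'\<in>UNIV. dist x' x < d \<longrightarrow> dist (tchar m x') (tchar m x) \<le> e"
    using e L by (intro exI[of _ "e / L"]) auto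
qed

lemma tchar_measurable [measurable]: "tchar m \<in> borel_measurable borel"
  by (rule borel_measurable_continuous_onI[OF continuous_tchar])

section \<open>Orthogonality of the characters\<close>

lemma integral_lborel_translate:
  fixes g :: "'a::euclidean_space \<Rightarrow> complex"
  assumes [measurable]: "g \<in> borel_measurable borel"
  shows "(\<integral>x. g (c + x) \<partial>lborel) = (\<integral>x. g x \<partial>lborel)"
proof -
  have "(\<integral>x. g x \<partial>lborel) = (\<integral>x. g x \<partial>distr lborel borel ((+) c))"
    by (simp add: lborel_distr_plus)
  also have "\<dots> = (\<integral>x. g (c + x) \<partial>lborel)"
    by (subst integral_distr) auto
  finally show ?thesis by simp
qed

text \<open>The translated cube is cut along the hyperplane \<open>y $ i = 1\<close>; the part
  beyond it is pushed back by a unit step, and periodicity leaves the integrand unchanged.\<close>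

lemma integral_unit_cube_translate:
  fixes g :: "real ^ 'd::finite \<Rightarrow> complex"
  assumes [measurable]: "g \<in> borel_measurable borel" and bound: "\<And>x. norm (g x) \<le> 1"
    and periodic: "\<And>x. g (axis i 1 + x) = g x" and s: "0 \<le> s" "s < 1"
  shows "(\<integral>x. indicator unit_cube x *\<^sub>R g (axis i s + x) \<partial>lborel) = (\<integral>x. indicator unit_cube x *\<^sub>R g x \<partial>lborel)"
proof -
  define C1 where "C1 = {x \<in> (unit_cube :: (real ^ 'd) set). s \<le> x $ i}"
  define C2 where "C2 = {x \<in> (unit_cube :: (real ^ 'd) set). x $ i < s}"
  have [measurable]: "C1 \<in> sets borel" "C2 \<in> sets borel"
    unfolding C1_def C2_def using unit_cube_borel by simp_all
  have int: "integrable lborel (\<lambda>x. indicator C x *\<^sub>R g (c + x))"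
    if [measurable]: "C \<in> sets borel" and "C \<subseteq> unit_cube" for C c
  proof (rule integrableI_bounded_set[of unit_cube])
    show "AE x\<in>unit_cube in lborel. norm (indicator C x *\<^sub>R g (c + x)) \<le> 1"
      using bound by (auto split: split_indicator)
    show "AE x in lborel. x \<notin> unit_cube \<longrightarrow> indicator C x *\<^sub>R g (c + x) = 0"
      using that by (auto split: split_indicator)
  qed (simp_all add: emeasure_unit_cube)
  have int2: "integrable lborel (\<lambda>x. indicator C (x - c) *\<^sub>R g x)"
    if [measurable]: "C \<in> sets borel" and "C \<subseteq> unit_cube" for C and c :: "real ^ 'd"
  proof -
    have "integrable (distr lborel borel ((+) c)) (\<lambda>x. indicator C (x - c) *\<^sub>R g x)"
      by (subst integrable_distr_eq) (use int[OF that, of c] in auto)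
    then show ?thesis by (simp add: lborel_distr_plus)
  qed
  have "(\<integral>x. indicator unit_cube x *\<^sub>R g (axis i s + x) \<partial>lborel)
      = (\<integral>x. (\<lambda>y. indicator unit_cube (y - axis i s) *\<^sub>R g y) (axis i s + x) \<partial>lborel)"
    by simp
  also have "\<dots> = (\<integral>y. indicator unit_cube (y - axis i s) *\<^sub>R g y \<partial>lborel)"
    by (rule integral_lborel_translate) measurable
  also have "\<dots> = (\<integral>y. indicator C1 y *\<^sub>R g (0 + y) + indicator C2 (y - axis i 1) *\<^sub>R g y \<partial>lborel)"
  proof (rule Bochner_Integration.integral_cong[OF refl])
    fix y :: "real ^ 'd"
    have *: "(indicator unit_cube (y - axis i s) :: real) = indicator C1 y + indicator C2 (y - axis i 1)"
    proof (cases "\<forall>j. j \<noteq> i \<longrightarrow> 0 \<le> y $ j \<and> y $ j < 1")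
      case True
      have uc: "z \<in> unit_cube \<longleftrightarrow> (\<forall>j. j \<noteq> i \<longrightarrow> 0 \<le> z $ j \<and> z $ j < 1) \<and> 0 \<le> z $ i \<and> z $ i < 1"
        for z :: "real ^ 'd"
      proof -
        have "(\<forall>j. P j) \<longleftrightarrow> (\<forall>j. j \<noteq> i \<longrightarrow> P j) \<and> P i" for P by metis
        then show ?thesis unfolding unit_cube_def mem_Collect_eq .
      qed
      have ax: "axis i r $ j = (if j = i then r else 0)" for r :: real and j
        by (simp add: axis_def)
      have "y - axis i s \<in> unit_cube \<longleftrightarrow> 0 \<le> y $ i - s \<and> y $ i - s < 1"
        using True by (simp add: uc ax)
      then have 1: "y - axis i s \<in> unit_cube \<longleftrightarrow> s \<le> y $ i \<and> y $ i < 1 + s" by linarith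
      have "y \<in> C1 \<longleftrightarrow> (0 \<le> y $ i \<and> y $ i < 1) \<and> s \<le> y $ i"
        using True by (simp add: C1_def uc)
      then have 2: "y \<in> C1 \<longleftrightarrow> s \<le> y $ i \<and> y $ i < 1"
        using s by linarith
      have "y - axis i 1 \<in> C2 \<longleftrightarrow> (0 \<le> y $ i - 1 \<and> y $ i - 1 < 1) \<and> y $ i - 1 < s"
        using True by (simp add: C2_def uc ax)
      then have 3: "y - axis i 1 \<in> C2 \<longleftrightarrow> 1 \<le> y $ i \<and> y $ i < 1 + s"
        using s by linarith
      show ?thesis using s by (auto simp: indicator_def 1 2 3)
    next
      case False
      then obtain j where "j \<noteq> i" "\<not> (0 \<le> y $ j \<and> y $ j < 1)" by blast
      then have "z \<notin> unit_cube" if "z $ j = y $ j" for z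
        using that by (auto simp: unit_cube_def intro!: exI[of _ j])
      moreover have "(y - axis i r) $ j = y $ j" for r using \<open>j \<noteq> i\<close> by (simp add: axis_def)
      ultimately have "y - axis i s \<notin> unit_cube" "y \<notin> C1" "y - axis i 1 \<notin> C2"
        by (auto simp only: C1_def C2_def mem_Collect_eq)
      then show ?thesis by simp
    qed
    show "indicator unit_cube (y - axis i s) *\<^sub>R g y = indicator C1 y *\<^sub>R g (0 + y) + indicator C2 (y - axis i 1) *\<^sub>R g y"
      by (simp only: * scaleR_add_left add_0)
  qed
  also have "\<dots> = (\<integral>y. indicator C1 y *\<^sub>R g (0 + y) \<partial>lborel) + (\<integral>y. indicator C2 (y - axis i 1) *\<^sub>R g y \<partial>lborel)"
    by (intro Bochner_Integration.integral_add int int2) (auto simp: C1_def C2_def)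
  also have "(\<integral>y. indicator C2 (y - axis i 1) *\<^sub>R g y \<partial>lborel)
      = (\<integral>x. (\<lambda>y. indicator C2 (y - axis i 1) *\<^sub>R g y) (axis i 1 + x) \<partial>lborel)"
    by (rule integral_lborel_translate[symmetric]) measurable
  also have "\<dots> = (\<integral>y. indicator C2 y *\<^sub>R g (0 + y) \<partial>lborel)" by (simp add: periodic)
  also have "(\<integral>y. indicator C1 y *\<^sub>R g (0 + y) \<partial>lborel) + (\<integral>y. indicator C2 y *\<^sub>R g (0 + y) \<partial>lborel)
      = (\<integral>y. indicator C1 y *\<^sub>R g (0 + y) + indicator C2 y *\<^sub>R g (0 + y) \<partial>lborel)"
    by (intro Bochner_Integration.integral_add[symmetric] int) (auto simp: C1_def C2_def)
  also have "\<dots> = (\<integral>x. indicator unit_cube x *\<^sub>R g x \<partial>lborel)"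
    by (intro Bochner_Integration.integral_cong refl) (auto simp: C1_def C2_def indicator_def)
  finally show ?thesis .
qed

lemma integral_torus_haar:
  fixes f :: "'d::finite torus \<Rightarrow> complex"
  assumes [measurable]: "f \<in> borel_measurable borel"
  shows "(\<integral>x. f x \<partial>torus_haar) = (\<integral>x. indicator unit_cube x *\<^sub>R f (to_torus x) \<partial>lborel)"
  unfolding torus_haar_def
  by (subst integral_distr, simp add: measurable_restrict_space1, simp,
      subst integral_restrict_space) auto

text \<open>A shift by half a period in a coordinate with \<open>m $ i \<noteq> 0\<close> changes
  the sign of the character, so the integral equals its own negative.\<close>

lemma integral_tchar: "(\<integral>x. tchar m x \<partial>torus_haar) = of_bool (m = 0)"
proof (cases "m = 0")
  case True
  interpret prob_space "torus_haar :: 'a torus measure" by (rule prob_space_torus_haar)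
  show ?thesis using True prob_space by simp
next
  case False
  then obtain i where i: "m $ i \<noteq> 0" by (auto simp: vec_eq_iff)
  define s where "s = 1 / (2 * \<bar>real_of_int (m $ i)\<bar>)"
  have "\<bar>real_of_int (m $ i)\<bar> \<ge> 1" using i by linarith
  then have s: "0 \<le> s" "s < 1" by (auto simp: s_def field_simps)
  define g where "g x = tchar m (to_torus x)" for x
  have [measurable]: "g \<in> borel_measurable borel" unfolding g_def by measurable
  have shift: "g (axis i r + x) = cis (2 * pi * (of_int (m $ i) * r)) * g x" for r x
  proof -
    have "(\<Sum>j\<in>UNIV. of_int (m $ j) * (axis i r + x) $ j)
        = (\<Sum>j\<in>UNIV. (if j = i then of_int (m $ i) * r else 0)) + (\<Sum>j\<in>UNIV. of_int (m $ j) * x $ j)"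
      unfolding sum.distrib[symmetric] by (intro sum.cong) (auto simp: axis_def algebra_simps)
    then show ?thesis by (simp add: g_def tchar_to_torus distrib_left cis_mult)
  qed
  have "2 * pi * (of_int (m $ i) * s) = pi \<or> 2 * pi * (of_int (m $ i) * s) = - pi"
    using i by (cases "m $ i > 0") (auto simp: s_def field_simps)
  then have "cis (2 * pi * (of_int (m $ i) * s)) = -1"
  proof (elim disjE)
    assume "2 * pi * (of_int (m $ i) * s) = - pi"
    then show ?thesis by (simp only:) (simp add: complex_eq_iff)
  qed (simp only: cis_pi)
  then have "(\<integral>x. indicator unit_cube x *\<^sub>R g x \<partial>lborel) = (\<integral>x. - (indicator unit_cube x *\<^sub>R g x) \<partial>lborel)"
    using integral_unit_cube_translate[of g i s] s shift[of 1] shift[of s]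
    by (simp add: g_def cis_multiple_2pi)
  then have "(\<integral>x. indicator unit_cube x *\<^sub>R g x \<partial>lborel) = 0" by simp
  then show ?thesis using False by (simp add: integral_torus_haar g_def)
qed

text \<open>With \<open>u = pi * x / 2\<close> the right-hand side is
  \<open>2 * (sin (2 * u))\<^sup>2\<close>, and for positive \<open>x\<close> one has
  \<open>sin (2 * u) = 2 * sin u * cos u \<ge> u\<close>, because \<open>cos u\<close> and the
  cosine produced by the mean value theorem are both at least \<open>sqrt 2 / 2\<close>.\<close>

lemma one_minus_cos_ge:
  assumes "\<bar>x\<bar> \<le> 1 / 2"
  shows "x\<^sup>2 \<le> 1 - cos (2 * pi * x)"
proof -
  have *: "y\<^sup>2 \<le> 1 - cos (2 * pi * y)" if y: "0 < y" "y \<le> 1 / 2" for y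
  proof -
    define u where "u = pi * y / 2"
    have u: "0 < u" "u \<le> pi / 4" using y by (auto simp: u_def field_simps)
    have cosge: "sqrt 2 / 2 \<le> cos v" if "0 \<le> v" "v \<le> pi / 4" for v
      using cos_monotone_0_pi_le[of v "pi / 4"] that by (simp add: cos_45)
    obtain z where z: "0 < z" "z < u" "sin u - sin 0 = (u - 0) * cos z"
      using MVT2[of 0 u sin cos] u by (auto intro: DERIV_sin)
    have "u * (sqrt 2 / 2) \<le> sin u" using z u cosge[of z] by simp
    moreover have "0 \<le> sin u" using u by (intro sin_ge_zero) auto
    ultimately have "(u * (sqrt 2 / 2)) * (sqrt 2 / 2) \<le> sin u * cos u"
      using cosge[of u] u by (intro mult_mono) auto
    moreover have "(u * (sqrt 2 / 2)) * (sqrt 2 / 2) = u / 2" by (simp add: mult.assoc)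
    ultimately have "u \<le> sin (2 * u)" unfolding sin_double by linarith
    then have "u\<^sup>2 \<le> (sin (2 * u))\<^sup>2" using u by (intro power_mono) auto
    moreover have "1 - cos (2 * pi * y) = 2 * (sin (2 * u))\<^sup>2"
      using cos_double_sin[of "2 * u"] by (simp add: u_def mult.assoc)
    moreover have "y\<^sup>2 \<le> 2 * u\<^sup>2"
    proof -
      have "3 * 3 \<le> pi * pi" using pi_gt3 by (intro mult_mono) auto
      then have "1 \<le> pi * pi / 2" by simp
      then have "y\<^sup>2 * 1 \<le> y\<^sup>2 * (pi * pi / 2)" by (rule mult_left_mono) simp
      moreover have "2 * u\<^sup>2 = y\<^sup>2 * (pi * pi / 2)"
        unfolding u_def by (simp add: power2_eq_square)
      ultimately show ?thesis by (simp only: mult_1_right)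
    qed
    ultimately show ?thesis by linarith
  qed
  consider "x = 0" | "x > 0" | "x < 0" by linarith
  then show ?thesis
  proof cases
    case 2
    then show ?thesis using *[of x] assms by simp
  next
    case 3
    then have "(- x)\<^sup>2 \<le> 1 - cos (2 * pi * (- x))" using assms by (intro *) auto
    then show ?thesis by simp
  qed simp
qed

text \<open>Rounding picks a lattice point at distance at most 1/2 in each coordinate. The
  right-hand side is a trigonometric polynomial, so its integral against the Fejer kernel can be
  computed exactly.\<close>

lemma dist_torus_sq_le:
  fixes x y :: "'d::finite torus"
  shows "(dist x y)\<^sup>2 \<le> (\<Sum>i\<in>UNIV. 1 - Re (tchar (axis i 1) (x - y)))"
proof -
  have "(dist z 0)\<^sup>2 \<le> (\<Sum>i\<in>UNIV. 1 - Re (tchar (axis i 1) z))" for z :: "'d torus"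
  proof transfer
    fix z :: "real ^ 'd"
    define a :: "real ^ 'd" where "a = (\<chi> i. of_int (round (z $ i)))"
    have a: "a \<in> int_lattice" by (simp add: a_def int_lattice_def)
    have "infdist (z - 0) int_lattice \<le> norm (z - a)"
      using infdist_le[OF a, of z] by (simp add: dist_norm)
    then have "(infdist (z - 0) int_lattice)\<^sup>2 \<le> (norm (z - a))\<^sup>2"
      by (intro power_mono infdist_nonneg)
    also have "\<dots> = (\<Sum>i\<in>UNIV. ((z - a) $ i)\<^sup>2)"
      by (simp add: norm_vec_def L2_set_def sum_nonneg)
    also have "\<dots> \<le> (\<Sum>i\<in>UNIV. 1 - cos (2 * pi * (z - a) $ i))"
      using of_int_round_abs_le
      by (intro sum_mono one_minus_cos_ge) (auto simp: a_def abs_minus_commute)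
    also have "\<dots> = (\<Sum>i\<in>UNIV. 1 - Re (cis (2 * pi * (\<Sum>j\<in>UNIV. of_int (axis i 1 $ j) * z $ j))))"
    proof (intro sum.cong refl)
      fix i
      have "(\<Sum>j\<in>UNIV. of_int (axis i 1 $ j) * z $ j) = (\<Sum>j\<in>UNIV. if j = i then z $ i else 0)"
        by (intro sum.cong) (auto simp: axis_def)
      also have "\<dots> = (z - a) $ i + of_int (round (z $ i))" by (simp add: a_def)
      finally show "1 - cos (2 * pi * (z - a) $ i)
          = 1 - Re (cis (2 * pi * (\<Sum>j\<in>UNIV. of_int (axis i 1 $ j) * z $ j)))"
        using cis_mult[of "2 * pi * (z - a) $ i" "2 * pi * of_int (round (z $ i))"]
        by (simp add: distrib_left cis_multiple_2pi) (metis cis.sel(1))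
    qed
    finally show "(infdist (z - 0) int_lattice)\<^sup>2
        \<le> (\<Sum>i\<in>UNIV. 1 - Re (cis (2 * pi * (\<Sum>j\<in>UNIV. of_int (axis i 1 $ j) * z $ j))))" .
  qed
  from this[of "x - y"] show ?thesis by (simp add: dist_torus_diff[of x y])
qed

section \<open>Trigonometric polynomials\<close>

interpretation torus: prob_space "torus_haar :: 'd::finite torus measure"
  by (rule prob_space_torus_haar)

lemma measure_torus_UNIV [simp]: "measure torus_haar (UNIV :: 'd::finite torus set) = 1"
  using torus.prob_space[where 'd = 'd] by simp

text \<open>\<open>W\<close> is any set containing the spectrum, possibly infinite. The inductive
  form turns closure under sums, products and endomorphisms into a computation of frequency sets,
  with no bookkeeping of coefficients.\<close>

inductive trig_on :: "(int ^ 'd) set \<Rightarrow> ('d::finite torus \<Rightarrow> complex) \<Rightarrow> bool" for W where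
  trig_zero: "trig_on W (\<lambda>x. 0)"
| trig_insert: "trig_on W f \<Longrightarrow> m \<in> W \<Longrightarrow> trig_on W (\<lambda>x. f x + c * tchar m x)"

lemma trig_char: "m \<in> W \<Longrightarrow> trig_on W (\<lambda>x. c * tchar m x)"
  using trig_insert[OF trig_zero, of m W c] by simp

lemma trig_tchar: "m \<in> W \<Longrightarrow> trig_on W (tchar m)"
  using trig_char[of m W 1] by simp

lemma trig_mono: "trig_on W f \<Longrightarrow> W \<subseteq> V \<Longrightarrow> trig_on V f"
  by (induction rule: trig_on.induct) (auto intro: trig_on.intros)

lemma trig_add: "trig_on W g \<Longrightarrow> trig_on W f \<Longrightarrow> trig_on W (\<lambda>x. f x + g x)"
proof (induction rule: trig_on.induct)
  case (trig_insert g m c)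
  then show ?case using trig_on.trig_insert[of W "\<lambda>x. f x + g x" m c] by (simp add: add.assoc)
qed simp

lemma trig_cmult: "trig_on W f \<Longrightarrow> trig_on W (\<lambda>x. c * f x)"
proof (induction rule: trig_on.induct)
  case trig_zero
  show ?case using trig_on.trig_zero by simp
next
  case (trig_insert f m c')
  then show ?case using trig_on.trig_insert[of W "\<lambda>x. c * f x" m "c * c'"] by (simp add: algebra_simps)
qed

lemma trig_sum: "(\<And>i. i \<in> I \<Longrightarrow> trig_on W (f i)) \<Longrightarrow> trig_on W (\<lambda>x. \<Sum>i\<in>I. f i x)"
proof (induction I rule: infinite_finite_induct)
  case (insert i I)
  then show ?case using trig_add[of W "\<lambda>x. \<Sum>i\<in>I. f i x" "f i"] by simp
qed (auto intro: trig_zero)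

lemma trig_mult_char:
  assumes "trig_on W f"
  shows "trig_on {u + n |u. u \<in> W} (\<lambda>x. f x * (c * tchar n x))"
  using assms
proof (induction rule: trig_on.induct)
  case (trig_insert f m c')
  have "trig_on {u + n |u. u \<in> W} (\<lambda>x. f x * (c * tchar n x) + (c' * c) * tchar (m + n) x)"
    using trig_insert by (intro trig_on.trig_insert) auto
  then show ?case by (simp add: algebra_simps tchar_add_freq)
qed (simp add: trig_zero)

lemma trig_mult:
  assumes "trig_on V g" "trig_on W f"
  shows "trig_on {u + v |u v. u \<in> W \<and> v \<in> V} (\<lambda>x. f x * g x)"
  using assms
proof (induction rule: trig_on.induct)
  case (trig_insert g m c)
  have "trig_on {u + v |u v. u \<in> W \<and> v \<in> V} (\<lambda>x. f x * (c * tchar m x))"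
    by (rule trig_mono[OF trig_mult_char[OF trig_insert.prems]]) (use trig_insert in auto)
  from trig_add[OF this trig_insert.IH[OF trig_insert.prems]] show ?case by (simp add: algebra_simps)
qed (simp add: trig_zero)

lemma trig_torus_mult:
  "trig_on W f \<Longrightarrow> trig_on ((*v) (transpose M) ` W) (\<lambda>x. f (torus_mult M x))"
proof (induction rule: trig_on.induct)
  case (trig_insert f m c)
  have "trig_on ((*v) (transpose M) ` W) (\<lambda>x. f (torus_mult M x) + c * tchar (transpose M *v m) x)"
    using trig_insert by (intro trig_on.trig_insert) auto
  then show ?case by (simp add: tchar_torus_mult)
qed (simp add: trig_zero)

lemma trig_measurable: "trig_on W f \<Longrightarrow> f \<in> borel_measurable borel"
  by (induction rule: trig_on.induct) auto

lemma trig_bounded: "trig_on W f \<Longrightarrow> \<exists>K. \<forall>x. norm (f x) \<le> K"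
proof (induction rule: trig_on.induct)
  case (trig_insert f m c)
  then obtain K where K: "\<And>x. norm (f x) \<le> K" by blast
  have "norm (f x + c * tchar m x) \<le> K + norm c" for x
    using norm_triangle_ineq[of "f x" "c * tchar m x"] K[of x] by (simp add: norm_mult)
  then show ?case by blast
qed auto

lemma integrable_torus_bounded:
  fixes f :: "'d::finite torus \<Rightarrow> 'b::{banach, second_countable_topology}"
  assumes "f \<in> borel_measurable borel" "\<And>x. norm (f x) \<le> K"
  shows "integrable torus_haar f"
  using assms by (intro torus.integrable_const_bound[of _ K]) (auto simp: measurable_cong_sets[OF sets_torus_haar refl])

lemma trig_integrable: "trig_on W f \<Longrightarrow> integrable torus_haar f"
  using trig_measurable trig_bounded integrable_torus_bounded by metis

lemma integrable_tchar: "integrable torus_haar (tchar m)"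
  by (rule trig_integrable[OF trig_tchar[of m UNIV]]) simp

lemma trig_integral_0:
  assumes "trig_on W f" "0 \<notin> W"
  shows "(\<integral>x. f x \<partial>torus_haar) = 0"
  using assms
proof (induction rule: trig_on.induct)
  case (trig_insert f m c)
  then show ?case
    using integrable_tchar trig_integrable[OF trig_insert(1)]
    by (subst Bochner_Integration.integral_add) (auto simp: integral_tchar)
qed simp

lemma trig_remove_0:
  assumes "trig_on W f"
  shows "\<exists>f' c. trig_on (W - {0}) f' \<and> (\<forall>x. f x = f' x + c)"
  using assms
proof (induction rule: trig_on.induct)
  case trig_zero
  show ?case by (intro exI[of _ "\<lambda>x. 0"] exI[of _ 0]) (auto intro: trig_on.trig_zero)
next
  case (trig_insert f m c')
  then obtain f' c where f': "trig_on (W - {0}) f'" "\<forall>x. f x = f' x + c" by blast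
  show ?case
  proof (cases "m = 0")
    case True
    then show ?thesis using f' by (intro exI[of _ f'] exI[of _ "c + c'"]) auto
  next
    case False
    then show ?thesis
      using f' trig_on.trig_insert[OF f'(1), of m c'] trig_insert(2)
      by (intro exI[of _ "\<lambda>x. f' x + c' * tchar m x"] exI[of _ c]) auto
  qed
qed

lemma trig_explicit:
  assumes "trig_on W f"
  shows "\<exists>M c. finite M \<and> M \<subseteq> W \<and> (\<forall>x. f x = (\<Sum>m\<in>M. c m * tchar m x))"
  using assms
proof (induction rule: trig_on.induct)
  case trig_zero
  show ?case by (intro exI[of _ "{}"]) simp
next
  case (trig_insert f m c')
  then obtain M c where M: "finite M" "M \<subseteq> W" "\<forall>x. f x = (\<Sum>m\<in>M. c m * tchar m x)" by blast
  show ?case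
  proof (cases "m \<in> M")
    case True
    have "f x + c' * tchar m x = (\<Sum>n\<in>M. (c(m := c m + c')) n * tchar n x)" for x
      using M True by (simp add: sum.remove[OF M(1) True] algebra_simps)
    then show ?thesis using M by blast
  next
    case False
    then have "f x + c' * tchar m x = (\<Sum>n\<in>insert m M. (c(m := c')) n * tchar n x)" for x
      using M by (simp add: add.commute) (intro sum.cong, auto)
    then show ?thesis using M trig_insert(2) by (intro exI[of _ "insert m M"] exI[of _ "c(m := c')"]) blast
  qed
qed

text \<open>Only the constant term of \<open>f\<close> can combine with \<open>g\<close> to
  frequency zero, so \<open>f\<close> may be replaced by its mean. This arithmetic factorisation
  takes the place of probabilistic independence.\<close>

lemma trig_independent:
  assumes "trig_on U g" "trig_on V f" "\<And>u v. u \<in> U \<Longrightarrow> v \<in> V \<Longrightarrow> v \<noteq> 0 \<Longrightarrow> u + v \<noteq> 0"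
  shows "(\<integral>x. g x * f x \<partial>torus_haar) = (\<integral>x. g x \<partial>torus_haar) * (\<integral>x. f x \<partial>torus_haar)"
proof -
  obtain f' c where f': "trig_on (V - {0}) f'" "\<forall>x. f x = f' x + c"
    using trig_remove_0[OF assms(2)] by blast
  have gf: "trig_on {u + v |u v. u \<in> U \<and> v \<in> V - {0}} (\<lambda>x. g x * f' x)"
    by (rule trig_mult[OF f'(1) assms(1)])
  have "(\<integral>x. g x * f x \<partial>torus_haar) = (\<integral>x. g x * f' x + g x * c \<partial>torus_haar)"
    using f'(2) by (simp add: algebra_simps)
  also have "\<dots> = (\<integral>x. g x * f' x \<partial>torus_haar) + (\<integral>x. g x * c \<partial>torus_haar)"
    using trig_integrable[OF gf] trig_integrable[OF assms(1)] by simp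
  also have "(\<integral>x. g x * f' x \<partial>torus_haar) = 0"
    using trig_integral_0[OF gf] assms(3) by fastforce
  also have "0 + (\<integral>x. g x * c \<partial>torus_haar) = (\<integral>x. g x \<partial>torus_haar) * c" by simp
  also have "c = (\<integral>x. f' x + c \<partial>torus_haar)"
    using trig_integrable[OF f'(1)] trig_integral_0[OF f'(1)] torus.prob_space
    by (simp add: Bochner_Integration.integral_add)
  finally show ?thesis using f'(2) by simp
qed

section \<open>The frequency box and its shifts\<close>

definition freq_box :: "nat \<Rightarrow> (int ^ 'd::finite) set" where
  "freq_box N = {m. \<forall>i. 0 \<le> m $ i \<and> m $ i < int N}"

lemma finite_int_norm_le: "finite {m :: int ^ 'd::finite. int_norm m \<le> R}"
proof -
  have "{m :: int ^ 'd. int_norm m \<le> R} \<subseteq> vec_lambda ` (PiE UNIV (\<lambda>_. {- \<lceil>R\<rceil>..\<lceil>R\<rceil>}))"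
  proof
    fix m :: "int ^ 'd" assume m: "m \<in> {m. int_norm m \<le> R}"
    have "\<bar>m $ i\<bar> \<le> \<lceil>R\<rceil>" for i
    proof -
      have "\<bar>real_of_int (m $ i)\<bar> \<le> int_norm m"
        unfolding int_norm_def by (rule member_le_sum) auto
      then have "real_of_int \<bar>m $ i\<bar> \<le> R" using m by simp
      then show ?thesis by (simp add: le_ceiling_iff)
    qed
    then have "(\<lambda>i. m $ i) \<in> PiE UNIV (\<lambda>_. {- \<lceil>R\<rceil>..\<lceil>R\<rceil>})" by (auto simp: abs_le_iff minus_le_iff)
    then show "m \<in> vec_lambda ` (PiE UNIV (\<lambda>_. {- \<lceil>R\<rceil>..\<lceil>R\<rceil>}))"
      by (intro image_eqI[of _ _ "\<lambda>i. m $ i"]) (simp_all add: vec_lambda_eta)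
  qed
  then show ?thesis by (rule finite_subset) (intro finite_imageI finite_PiE, auto)
qed

lemma freq_box_diff_norm:
  assumes "m \<in> freq_box N" "n \<in> freq_box N"
  shows "int_norm (m - n :: int ^ 'd::finite) \<le> real CARD('d) * real N"
proof -
  have "\<bar>real_of_int ((m - n) $ i)\<bar> \<le> real N" for i
  proof -
    have "0 \<le> m $ i \<and> m $ i < int N" "0 \<le> n $ i \<and> n $ i < int N"
      using assms by (auto simp: freq_box_def)
    then have "\<bar>(m - n) $ i\<bar> \<le> int N" unfolding vector_minus_component by linarith
    then show ?thesis by linarith
  qed
  then show ?thesis unfolding int_norm_def by (intro sum_bounded_above[of UNIV, simplified]) auto
qed

lemma finite_freq_box: "finite (freq_box N :: (int ^ 'd::finite) set)"
proof (cases "N = 0")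
  case False
  then have "0 \<in> (freq_box N :: (int ^ 'd) set)" by (auto simp: freq_box_def)
  then have "freq_box N \<subseteq> {m :: int ^ 'd. int_norm m \<le> real CARD('d) * real N}"
    using freq_box_diff_norm[of _ N 0] by auto
  then show ?thesis using finite_int_norm_le by (rule finite_subset)
next
  case True
  then have "freq_box N = ({} :: (int ^ 'd) set)" by (auto simp: freq_box_def not_less)
  then show ?thesis by simp
qed

lemma card_freq_box_pos: "N > 0 \<Longrightarrow> card (freq_box N :: (int ^ 'd::finite) set) > 0"
  by (simp add: card_gt_0_iff finite_freq_box) (auto simp: freq_box_def intro!: exI[of _ 0])

text \<open>The slices \<open>m $ i = t\<close> all have the same size, and a unit shift loses just
  the topmost one. The factor \<open>1 - 1 / real N\<close> is the corresponding Fourier coefficient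
  of the Fejer kernel.\<close>

lemma card_freq_box_shift:
  assumes N: "N > 0"
  shows "real (card {m \<in> freq_box N :: (int ^ 'd::finite) set. m + axis i 1 \<in> freq_box N})
    = real (card (freq_box N :: (int ^ 'd) set)) * (1 - 1 / real N)"
proof -
  define S where "S t = {m \<in> freq_box N :: (int ^ 'd) set. m $ i = t}" for t
  have fin: "finite (S t)" for t unfolding S_def using finite_freq_box by (rule rev_finite_subset) auto
  have S_iff: "m \<in> S t \<longleftrightarrow> (\<forall>j. j \<noteq> i \<longrightarrow> 0 \<le> m $ j \<and> m $ j < int N) \<and> m $ i = t"
    if "0 \<le> t" "t < int N" for t m
    using that unfolding S_def freq_box_def mem_Collect_eq by metis
  have ax: "axis i r $ j = (if j = i then r else 0)" for r :: int and j
    by (simp add: axis_def)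
  have card_S: "card (S t) = card (S 0)" if "t \<in> {0..<int N}" for t
  proof (rule bij_betw_same_card)
    have t: "0 \<le> t" "t < int N" using that by auto
    show "bij_betw (\<lambda>m. m - axis i t) (S t) (S 0)"
    proof (rule bij_betw_byWitness[where f' = "\<lambda>m. m + axis i t"])
      show "(\<lambda>m. m - axis i t) ` S t \<subseteq> S 0"
        using N by (simp add: S_iff[OF t] S_iff[of 0] ax image_subset_iff)
      show "(\<lambda>m. m + axis i t) ` S 0 \<subseteq> S t"
        using N by (simp add: S_iff[OF t] S_iff[of 0] ax image_subset_iff)
    qed simp_all
  qed
  have "card (freq_box N :: (int ^ 'd) set) = card (\<Union>t\<in>{0..<int N}. S t)"
    by (rule arg_cong[of _ _ card]) (auto simp: S_def freq_box_def)
  also have "\<dots> = (\<Sum>t\<in>{0..<int N}. card (S t))"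
    by (intro card_UN_disjoint) (auto simp: fin, auto simp: S_def)
  also have "\<dots> = (\<Sum>t\<in>{0..<int N}. card (S 0))" by (rule sum.cong[OF refl card_S])
  also have "\<dots> = N * card (S 0)" by simp
  finally have 1: "card (freq_box N :: (int ^ 'd) set) = N * card (S 0)" .
  have "{m \<in> freq_box N :: (int ^ 'd) set. m + axis i 1 \<in> freq_box N} = freq_box N - S (int N - 1)"
  proof (intro equalityI subsetI)
    fix m assume "m \<in> {m \<in> freq_box N :: (int ^ 'd) set. m + axis i 1 \<in> freq_box N}"
    then have m: "m \<in> freq_box N" "m + axis i 1 \<in> freq_box N" by auto
    have "(m + axis i 1) $ i < int N" using m(2) unfolding freq_box_def by blast
    then have "m $ i \<noteq> int N - 1" by (simp add: ax)
    then show "m \<in> freq_box N - S (int N - 1)" using m by (auto simp: S_def)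
  next
    fix m assume m: "m \<in> freq_box N - S (int N - 1)"
    have "0 \<le> (m + axis i 1) $ j \<and> (m + axis i 1) $ j < int N" for j
    proof -
      have "\<forall>j. 0 \<le> m $ j \<and> m $ j < int N" using m by (simp add: freq_box_def)
      then have "0 \<le> m $ j" "m $ j < int N" by blast+
      moreover have "m $ i \<noteq> int N - 1" using m by (auto simp: S_def)
      ultimately show ?thesis by (cases "j = i") (simp_all add: ax)
    qed
    then show "m \<in> {m \<in> freq_box N :: (int ^ 'd) set. m + axis i 1 \<in> freq_box N}"
      using m by (auto simp: freq_box_def)
  qed
  then have "card {m \<in> freq_box N :: (int ^ 'd) set. m + axis i 1 \<in> freq_box N}
      = card (freq_box N :: (int ^ 'd) set) - card (S (int N - 1))"
    using fin by (simp add: card_Diff_subset) (auto simp: S_def card_Diff_subset)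
  moreover have "card (S (int N - 1)) = card (S 0)" using N by (intro card_S) auto
  ultimately have "real (card {m \<in> freq_box N :: (int ^ 'd) set. m + axis i 1 \<in> freq_box N})
      = real N * real (card (S 0)) - real (card (S 0))"
    using 1 N by (simp add: of_nat_diff)
  moreover have "real N * real (card (S 0)) * (1 - 1 / real N) = real N * real (card (S 0)) - real (card (S 0))"
    using N by (simp add: right_diff_distrib)
  ultimately show ?thesis by (simp only: 1 of_nat_mult)
qed

section \<open>Fejer means\<close>

text \<open>The product of the one-dimensional Fejer kernels, written as a normalised squared
  Dirichlet sum: nonnegativity is visible, and the spectrum consists of differences of box
  points.\<close>

definition fejer :: "nat \<Rightarrow> 'd::finite torus \<Rightarrow> real" where
  "fejer N z = (norm (\<Sum>m\<in>freq_box N. tchar m z))\<^sup>2 / real (card (freq_box N :: (int ^ 'd) set))"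

lemma tchar_diff_freq: "tchar (m - n) x = tchar m x * cnj (tchar n x)"
  using tchar_add_freq[of m "- n" x] by (simp add: tchar_minus_freq)

lemma fejer_nonneg: "0 \<le> fejer N z"
  by (simp add: fejer_def)

lemma fejer_expand:
  "complex_of_real (fejer N (x - y)) = (1 / of_nat (card (freq_box N :: (int ^ 'd::finite) set))) *
     (\<Sum>m\<in>freq_box N. \<Sum>n\<in>freq_box N. tchar (m - n) x * tchar (n - m) (y :: 'd torus))"
proof -
  have "complex_of_real ((norm (\<Sum>m\<in>freq_box N. tchar m (x - y)))\<^sup>2)
      = (\<Sum>m\<in>freq_box N. tchar m (x - y)) * cnj (\<Sum>n\<in>freq_box N. tchar n (x - y))"
    by (simp only: complex_norm_square)
  also have "\<dots> = (\<Sum>m\<in>freq_box N. \<Sum>n\<in>freq_box N. tchar m (x - y) * cnj (tchar n (x - y)))"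
    by (simp add: sum_product)
  also have "\<dots> = (\<Sum>m\<in>freq_box N. \<Sum>n\<in>freq_box N. tchar (m - n) x * tchar (n - m) y)"
    by (intro sum.cong refl) (simp add: tchar_diff_freq tchar_diff mult_ac)
  finally show ?thesis by (simp add: fejer_def)
qed

lemma fejer_le:
  fixes z :: "'d::finite torus"
  shows "fejer N z \<le> real (card (freq_box N :: (int ^ 'd) set))"
proof -
  define b where "b = real (card (freq_box N :: (int ^ 'd) set))"
  have "norm (\<Sum>m\<in>freq_box N. tchar m z) \<le> b"
    unfolding b_def by (rule order_trans[OF norm_sum]) simp
  then have "(norm (\<Sum>m\<in>freq_box N. tchar m z))\<^sup>2 \<le> b\<^sup>2" by (intro power_mono) auto
  then have "fejer N z \<le> b\<^sup>2 / b" unfolding fejer_def b_def by (intro divide_right_mono) auto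
  also have "\<dots> = b" by (simp add: power2_eq_square)
  finally show ?thesis by (simp add: b_def)
qed

lemma fejer_measurable2:
  fixes f g :: "'a \<Rightarrow> 'd::finite torus"
  assumes [measurable]: "f \<in> borel_measurable M" "g \<in> borel_measurable M"
  shows "(\<lambda>z. fejer N (f z - g z)) \<in> borel_measurable M"
  unfolding fejer_def tchar_diff tchar_minus_freq[symmetric] by measurable

text \<open>Orthogonality leaves the pairs of box points that differ by \<open>w\<close>.\<close>

lemma fejer_char_integral:
  fixes x :: "'d::finite torus"
  assumes N: "N > 0"
  shows "(\<integral>y. complex_of_real (fejer N (x - y)) * tchar w (x - y) \<partial>torus_haar)
    = of_real (real (card {m \<in> freq_box N. m + w \<in> freq_box N}) / real (card (freq_box N :: (int ^ 'd) set)))"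
proof -
  define B where "B = (freq_box N :: (int ^ 'd) set)"
  have fin: "finite B" unfolding B_def by (rule finite_freq_box)
  have "complex_of_real (fejer N (x - y)) * tchar w (x - y)
      = (\<Sum>m\<in>B. \<Sum>n\<in>B. (1 / of_nat (card B) * tchar (m - n + w) x) * tchar (n - m - w) y)" for y
    unfolding fejer_expand B_def
    by (simp add: sum_distrib_left sum_distrib_right tchar_diff_freq tchar_add_freq tchar_diff mult_ac)
  then have "(\<integral>y. complex_of_real (fejer N (x - y)) * tchar w (x - y) \<partial>torus_haar)
      = (\<Sum>m\<in>B. \<Sum>n\<in>B. (1 / of_nat (card B) * tchar (m - n + w) x) * of_bool (n - m - w = 0))"
    by (simp add: integral_tchar integrable_tchar)
  also have "\<dots> = (\<Sum>m\<in>B. \<Sum>n\<in>B. if n = m + w then 1 / of_nat (card B) else 0)"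
    by (intro sum.cong refl) (auto simp: algebra_simps)
  also have "\<dots> = (\<Sum>m\<in>B. if m + w \<in> B then 1 / of_nat (card B) else 0)"
    using fin by (simp add: sum.delta)
  also have "\<dots> = (\<Sum>m\<in>{m \<in> B. m + w \<in> B}. 1 / of_nat (card B))"
    using fin by (simp only: sum.inter_filter)
  also have "\<dots> = of_real (real (card {m \<in> B. m + w \<in> B}) / real (card B))" by simp
  finally show ?thesis by (simp only: B_def)
qed

lemma fejer_integrable_mult:
  fixes f :: "'d::finite torus \<Rightarrow> 'b::{real_normed_field, banach, second_countable_topology}"
  assumes [measurable]: "f \<in> borel_measurable borel" and K: "\<And>y. norm (f y) \<le> K"
  shows "integrable torus_haar (\<lambda>y. of_real (fejer N (x - y)) * f y)"
proof (rule integrable_torus_bounded)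
  show "(\<lambda>y. of_real (fejer N (x - y)) * f y) \<in> borel_measurable borel"
    using fejer_measurable2[of "\<lambda>y. x" borel "\<lambda>y. y" N] by measurable
  show "norm (of_real (fejer N (x - y)) * f y) \<le> real (card (freq_box N :: (int ^ 'd) set)) * K" for y
    unfolding norm_mult norm_of_real abs_of_nonneg[OF fejer_nonneg]
    by (intro mult_mono fejer_le K) auto
qed

lemma fejer_integral:
  assumes "N > 0"
  shows "(\<integral>y. fejer N (x - y) \<partial>torus_haar) = 1"
proof -
  have "complex_of_real (\<integral>y. fejer N (x - y) \<partial>torus_haar) = (\<integral>y. complex_of_real (fejer N (x - y)) * tchar 0 (x - y) \<partial>torus_haar)"
    by simp
  also have "\<dots> = 1" using card_freq_box_pos[OF assms] by (subst fejer_char_integral[OF assms]) simp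
  finally show ?thesis by (simp only: of_real_eq_1_iff)
qed

lemma fejer_integrable: "integrable torus_haar (\<lambda>y. fejer N (x - y))"
  using fejer_integrable_mult[of "\<lambda>y. 1 :: real" 1 N x] by simp

lemma fejer_cos_integral:
  fixes x :: "'d::finite torus"
  assumes "N > 0"
  shows "(\<integral>y. fejer N (x - y) * (1 - Re (tchar (axis i 1) (x - y))) \<partial>torus_haar) = 1 / real N"
proof -
  have m: "(\<lambda>y. tchar (axis i 1) (x - y)) \<in> borel_measurable borel"
    unfolding tchar_diff tchar_minus_freq[symmetric] by measurable
  have int: "integrable torus_haar (\<lambda>y. complex_of_real (fejer N (x - y)) * tchar (axis i 1) (x - y))"
    using m by (rule fejer_integrable_mult[of _ 1]) simp
  have "(\<integral>y. fejer N (x - y) * (1 - Re (tchar (axis i 1) (x - y))) \<partial>torus_haar)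
      = (\<integral>y. fejer N (x - y) - Re (complex_of_real (fejer N (x - y)) * tchar (axis i 1) (x - y)) \<partial>torus_haar)"
    by (simp add: algebra_simps)
  also have "\<dots> = (\<integral>y. fejer N (x - y) \<partial>torus_haar)
      - (\<integral>y. Re (complex_of_real (fejer N (x - y)) * tchar (axis i 1) (x - y)) \<partial>torus_haar)"
    by (intro Bochner_Integration.integral_diff fejer_integrable integrable_Re int)
  also have "(\<integral>y. Re (complex_of_real (fejer N (x - y)) * tchar (axis i 1) (x - y)) \<partial>torus_haar)
      = Re (\<integral>y. complex_of_real (fejer N (x - y)) * tchar (axis i 1) (x - y) \<partial>torus_haar)"
    by (rule integral_Re[OF int])
  also have "\<dots> = 1 - 1 / real N"
    using card_freq_box_pos[OF assms, where 'd = 'd]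
    by (simp only: fejer_char_integral[OF assms] card_freq_box_shift[OF assms] Re_complex_of_real) simp
  finally show ?thesis by (simp add: fejer_integral[OF assms])
qed

lemma dist_torus_measurable [measurable]: "(\<lambda>y. dist x y) \<in> borel_measurable borel" for x :: "'d::finite torus"
  by (intro borel_measurable_continuous_onI continuous_intros)

lemma dist_torus_sq_bound:
  fixes x y :: "'d::finite torus"
  shows "(dist x y)\<^sup>2 \<le> 2 * real CARD('d)"
proof -
  have "1 - Re (tchar (axis i 1) (x - y)) \<le> 2" for i
    using abs_Re_le_cmod[of "tchar (axis i 1) (x - y)"] by (simp add: abs_le_iff)
  then have "(\<Sum>i\<in>(UNIV :: 'd set). 1 - Re (tchar (axis i 1) (x - y))) \<le> (\<Sum>i\<in>(UNIV :: 'd set). 2)"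
    by (rule sum_mono)
  then show ?thesis using dist_torus_sq_le[of x y] by simp
qed

lemma fejer_dist_sq:
  fixes x :: "'d::finite torus"
  assumes "N > 0"
  shows "(\<integral>y. fejer N (x - y) * (dist x y)\<^sup>2 \<partial>torus_haar) \<le> real CARD('d) / real N"
proof -
  have int: "integrable torus_haar (\<lambda>y. fejer N (x - y) * (1 - Re (tchar (axis i 1) (x - y))))" for i
  proof -
    have "(\<lambda>y. 1 - Re (tchar (axis i 1) (x - y))) \<in> borel_measurable borel"
      unfolding tchar_diff tchar_minus_freq[symmetric] by measurable
    moreover have "norm (1 - Re (tchar (axis i 1) (x - y))) \<le> 2" for y
      using abs_Re_le_cmod[of "tchar (axis i 1) (x - y)"] by (simp add: abs_le_iff)
    ultimately show ?thesis
      using fejer_integrable_mult[of "\<lambda>y. 1 - Re (tchar (axis i 1) (x - y))" 2 N x] by simp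
  qed
  have int2: "integrable torus_haar (\<lambda>y. fejer N (x - y) * (dist x y)\<^sup>2)"
    using fejer_integrable_mult[of "\<lambda>y. (dist x y)\<^sup>2" "2 * real CARD('d)" N x] dist_torus_sq_bound[of x]
    by simp
  have "(\<integral>y. fejer N (x - y) * (dist x y)\<^sup>2 \<partial>torus_haar)
      \<le> (\<integral>y. (\<Sum>i\<in>UNIV. fejer N (x - y) * (1 - Re (tchar (axis i 1) (x - y)))) \<partial>torus_haar)"
  proof (rule integral_mono)
    show "integrable torus_haar (\<lambda>y. \<Sum>i\<in>UNIV. fejer N (x - y) * (1 - Re (tchar (axis i 1) (x - y))))"
      by (intro Bochner_Integration.integrable_sum int)
    show "fejer N (x - y) * (dist x y)\<^sup>2 \<le> (\<Sum>i\<in>UNIV. fejer N (x - y) * (1 - Re (tchar (axis i 1) (x - y))))" for y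
      unfolding sum_distrib_left[symmetric] by (intro mult_left_mono dist_torus_sq_le fejer_nonneg)
  qed (rule int2)
  also have "\<dots> = (\<Sum>i\<in>(UNIV :: 'd set). 1 / real N)"
    by (subst Bochner_Integration.integral_sum) (auto simp: int fejer_cos_integral[OF assms])
  finally show ?thesis by simp
qed

text \<open>The second moment is already estimated; lower moments follow from
  \<open>q powr (\<alpha> / 2) \<le> 1 + q\<close> with
  \<open>q = real N * (dist x y)\<^sup>2\<close>. Any negative power of \<open>N\<close> is enough,
  since it becomes geometric along \<open>N = 2 ^ j\<close>.\<close>

lemma fejer_dist_powr:
  fixes x :: "'d::finite torus"
  assumes "N > 0" "0 < \<alpha>" "\<alpha> \<le> 1"
  shows "integrable torus_haar (\<lambda>y. fejer N (x - y) * dist x y powr \<alpha>)"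
    and "(\<integral>y. fejer N (x - y) * dist x y powr \<alpha> \<partial>torus_haar) \<le> (1 + real CARD('d)) * real N powr (- (\<alpha> / 2))"
proof -
  have bound: "dist x y powr \<alpha> \<le> real N powr (- (\<alpha> / 2)) * (1 + real N * (dist x y)\<^sup>2)" for y
  proof (cases "x = y")
    case False
    define q where "q = real N * (dist x y)\<^sup>2"
    have q: "q > 0" using False assms by (simp add: q_def)
    have "q powr (\<alpha> / 2) \<le> 1 + q"
    proof (cases "q \<le> 1")
      case True
      then have "q powr (\<alpha> / 2) \<le> 1 powr (\<alpha> / 2)" using q assms by (intro powr_mono2) auto
      then show ?thesis using q by simp
    next
      case False
      then have "q powr (\<alpha> / 2) \<le> q powr 1" using assms by (intro powr_mono) auto
      then show ?thesis using q by simp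
    qed
    moreover have "dist x y powr \<alpha> = real N powr (- (\<alpha> / 2)) * q powr (\<alpha> / 2)"
    proof -
      have "dist x y powr \<alpha> = ((dist x y) powr 2) powr (\<alpha> / 2)" by (simp only: powr_powr) simp
      also have "(dist x y) powr 2 = (dist x y)\<^sup>2" using False by simp
      finally show ?thesis
        using assms q False by (simp add: q_def powr_mult powr_add[symmetric] mult.assoc[symmetric])
    qed
    ultimately show ?thesis by (simp add: q_def mult_left_mono)
  qed simp
  have pb: "norm (dist x y powr \<alpha>) \<le> real N powr (- (\<alpha> / 2)) * (1 + real N * (2 * real CARD('d)))" for y
    using order_trans[OF bound[of y] mult_left_mono[OF add_left_mono[OF mult_left_mono[OF dist_torus_sq_bound[of x y]]]]]
    by simp
  have [measurable]: "(\<lambda>y. dist x y powr \<alpha>) \<in> borel_measurable borel" by measurable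
  show int: "integrable torus_haar (\<lambda>y. fejer N (x - y) * dist x y powr \<alpha>)"
    using fejer_integrable_mult[of "\<lambda>y. dist x y powr \<alpha>", OF _ pb, of N x] by simp
  have int2: "integrable torus_haar (\<lambda>y. fejer N (x - y) * (dist x y)\<^sup>2)"
    using fejer_integrable_mult[of "\<lambda>y. (dist x y)\<^sup>2" "2 * real CARD('d)" N x] dist_torus_sq_bound[of x]
    by simp
  have "(\<integral>y. fejer N (x - y) * dist x y powr \<alpha> \<partial>torus_haar)
      \<le> (\<integral>y. real N powr (- (\<alpha> / 2)) * (fejer N (x - y) + real N * (fejer N (x - y) * (dist x y)\<^sup>2)) \<partial>torus_haar)"
  proof (intro integral_mono int integrable_mult_right Bochner_Integration.integrable_add fejer_integrable int2)
    fix y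
    show "fejer N (x - y) * dist x y powr \<alpha>
        \<le> real N powr (- (\<alpha> / 2)) * (fejer N (x - y) + real N * (fejer N (x - y) * (dist x y)\<^sup>2))"
      using mult_left_mono[OF bound[of y] fejer_nonneg[of N "x - y"]] by (simp add: algebra_simps)
  qed
  also have "\<dots> = real N powr (- (\<alpha> / 2)) * (1 + real N * (\<integral>y. fejer N (x - y) * (dist x y)\<^sup>2 \<partial>torus_haar))"
    unfolding integral_mult_right_zero
    by (subst Bochner_Integration.integral_add[OF fejer_integrable integrable_mult_right[OF int2]])
       (simp add: fejer_integral[OF assms(1)])
  also have "\<dots> \<le> real N powr (- (\<alpha> / 2)) * (1 + real N * (real CARD('d) / real N))"
    by (rule mult_left_mono[OF add_left_mono[OF mult_left_mono[OF fejer_dist_sq[OF assms(1)]]]]) simp_all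
  also have "real N * (real CARD('d) / real N) = real CARD('d)" using assms(1) by simp
  finally show "(\<integral>y. fejer N (x - y) * dist x y powr \<alpha> \<partial>torus_haar) \<le> (1 + real CARD('d)) * real N powr (- (\<alpha> / 2))"
    by (subst mult.commute)
qed

definition fejer_mean :: "nat \<Rightarrow> ('d::finite torus \<Rightarrow> real) \<Rightarrow> 'd torus \<Rightarrow> real" where
  "fejer_mean N \<phi> x = (\<integral>y. fejer N (x - y) * \<phi> y \<partial>torus_haar)"

lemma fejer_mean_trig:
  fixes \<phi> :: "'d::finite torus \<Rightarrow> real"
  assumes [measurable]: "\<phi> \<in> borel_measurable borel" and K: "\<And>x. \<bar>\<phi> x\<bar> \<le> K"
    and mean: "(\<integral>x. \<phi> x \<partial>torus_haar) = 0"
  shows "trig_on {m. m \<noteq> 0 \<and> int_norm m \<le> real CARD('d) * real N} (\<lambda>x. complex_of_real (fejer_mean N \<phi> x))"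
proof -
  define B where "B = (freq_box N :: (int ^ 'd) set)"
  define c where "c m n = (1 / of_nat (card B)) * (\<integral>y. tchar (n - m) y * complex_of_real (\<phi> y) \<partial>torus_haar)" for m n
  have int: "integrable torus_haar (\<lambda>y. tchar k y * complex_of_real (\<phi> y))" for k
    by (rule integrable_torus_bounded[where K = K]) (use K in \<open>auto simp: norm_mult\<close>)
  have "complex_of_real (fejer_mean N \<phi> x) = (\<Sum>m\<in>B. \<Sum>n\<in>B. c m n * tchar (m - n) x)" for x
  proof -
    define a where "a m n = 1 / of_nat (card B) * tchar (m - n) x" for m n
    have "complex_of_real (fejer_mean N \<phi> x)
        = (\<integral>y. complex_of_real (fejer N (x - y)) * complex_of_real (\<phi> y) \<partial>torus_haar)"
      by (simp add: fejer_mean_def flip: of_real_mult)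
    also have "\<dots> = (\<integral>y. (\<Sum>m\<in>B. \<Sum>n\<in>B. (1 / of_nat (card B) * tchar (m - n) x) * (tchar (n - m) y * complex_of_real (\<phi> y))) \<partial>torus_haar)"
      unfolding fejer_expand B_def by (simp add: sum_distrib_left sum_distrib_right mult_ac)
    also have "\<dots> = (\<Sum>m\<in>B. \<Sum>n\<in>B. a m n * (\<integral>y. tchar (n - m) y * complex_of_real (\<phi> y) \<partial>torus_haar))"
      unfolding a_def[symmetric] by (simp add: int)
    also have "\<dots> = (\<Sum>m\<in>B. \<Sum>n\<in>B. c m n * tchar (m - n) x)"
      by (simp add: a_def c_def mult_ac)
    finally show ?thesis .
  qed
  moreover have "trig_on {m. m \<noteq> 0 \<and> int_norm m \<le> real CARD('d) * real N} (\<lambda>x. c m n * tchar (m - n) x)"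
    if "m \<in> B" "n \<in> B" for m n
  proof (cases "m = n")
    case True
    \<comment> \<open>The diagonal terms carry the mean of \<phi>, so frequency zero is
      absent.\<close>
    then have "c m n = 0" using mean by (simp add: c_def)
    then show ?thesis by (simp add: trig_zero)
  next
    case False
    then show ?thesis using freq_box_diff_norm[of m N n] that by (intro trig_char) (auto simp: B_def)
  qed
  ultimately show ?thesis by (simp add: trig_sum)
qed

lemma fejer_mean_approx:
  fixes \<phi> :: "'d::finite torus \<Rightarrow> real"
  assumes [measurable]: "\<phi> \<in> borel_measurable borel" and K: "\<And>x. \<bar>\<phi> x\<bar> \<le> K"
    and hoelder: "\<And>x y. \<bar>\<phi> x - \<phi> y\<bar> \<le> C * dist x y powr \<alpha>" "0 < \<alpha>" "\<alpha> \<le> 1" "0 \<le> C"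
    and N: "N > 0"
  shows "\<bar>\<phi> x - fejer_mean N \<phi> x\<bar> \<le> C * (1 + real CARD('d)) * real N powr (- (\<alpha> / 2))"
proof -
  have int1: "integrable torus_haar (\<lambda>y. fejer N (x - y) * \<phi> y)"
    using fejer_integrable_mult[of \<phi> K N x] K by simp
  have "\<phi> x - fejer_mean N \<phi> x = (\<integral>y. fejer N (x - y) * \<phi> x \<partial>torus_haar) - (\<integral>y. fejer N (x - y) * \<phi> y \<partial>torus_haar)"
    by (simp add: fejer_mean_def fejer_integral[OF N])
  also have "\<dots> = (\<integral>y. fejer N (x - y) * (\<phi> x - \<phi> y) \<partial>torus_haar)"
    using int1 fejer_integrable[of N x]
    by (subst Bochner_Integration.integral_diff[symmetric]) (auto simp: algebra_simps)
  also have "\<bar>\<dots>\<bar> \<le> (\<integral>y. \<bar>fejer N (x - y) * (\<phi> x - \<phi> y)\<bar> \<partial>torus_haar)"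
    by (rule integral_abs_bound)
  also have "\<dots> \<le> (\<integral>y. C * (fejer N (x - y) * dist x y powr \<alpha>) \<partial>torus_haar)"
  proof (intro integral_mono integrable_mult_right fejer_dist_powr(1) N hoelder)
    have "integrable torus_haar (\<lambda>y. fejer N (x - y) * \<phi> x - fejer N (x - y) * \<phi> y)"
      using int1 fejer_integrable[of N x] by auto
    then show "integrable torus_haar (\<lambda>y. \<bar>fejer N (x - y) * (\<phi> x - \<phi> y)\<bar>)"
      by (simp add: algebra_simps)
    show "\<bar>fejer N (x - y) * (\<phi> x - \<phi> y)\<bar> \<le> C * (fejer N (x - y) * dist x y powr \<alpha>)" for y
      using mult_left_mono[OF hoelder(1)[of x y] fejer_nonneg[of N "x - y"]]
      by (simp add: abs_mult fejer_nonneg mult_ac)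
  qed
  also have "\<dots> \<le> C * ((1 + real CARD('d)) * real N powr (- (\<alpha> / 2)))"
    using fejer_dist_powr[OF N hoelder(2,3), of x] hoelder(4) by (simp add: mult_left_mono)
  finally show ?thesis by (simp add: mult_ac)
qed

section \<open>Square norms along orbits\<close>

declare transpose_matrix_vector [simp del]

section \<open>Bounded measurable functions and the square norm\<close>

definition bounded_meas :: "('d::finite torus \<Rightarrow> real) \<Rightarrow> bool" where
  "bounded_meas f \<longleftrightarrow> f \<in> borel_measurable borel \<and> (\<exists>K. \<forall>x. \<bar>f x\<bar> \<le> K)"

lemma bounded_measI: "f \<in> borel_measurable borel \<Longrightarrow> (\<And>x. \<bar>f x\<bar> \<le> K) \<Longrightarrow> bounded_meas f"
  by (auto simp: bounded_meas_def)

lemma bounded_meas_measurable: "bounded_meas f \<Longrightarrow> f \<in> borel_measurable borel"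
  by (simp add: bounded_meas_def)

lemma bounded_meas_integrable: "bounded_meas f \<Longrightarrow> integrable torus_haar f"
  unfolding bounded_meas_def using integrable_torus_bounded[of f] by (metis real_norm_def)

lemma bounded_meas_const: "bounded_meas (\<lambda>x. c)"
  by (rule bounded_measI[of _ "\<bar>c\<bar>"]) auto

lemma bounded_meas_add:
  assumes "bounded_meas f" "bounded_meas g"
  shows "bounded_meas (\<lambda>x. f x + g x)"
proof -
  obtain K L where "\<forall>x. \<bar>f x\<bar> \<le> K" "\<forall>x. \<bar>g x\<bar> \<le> L" using assms by (auto simp: bounded_meas_def)
  then have "\<bar>f x + g x\<bar> \<le> K + L" for x
    by (intro order_trans[OF abs_triangle_ineq] add_mono) auto
  then show ?thesis using assms by (intro bounded_measI) (auto simp: bounded_meas_def)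
qed

lemma bounded_meas_mult:
  assumes "bounded_meas f" "bounded_meas g"
  shows "bounded_meas (\<lambda>x. f x * g x)"
proof -
  obtain K L where KL: "\<forall>x. \<bar>f x\<bar> \<le> K" "\<forall>x. \<bar>g x\<bar> \<le> L" using assms by (auto simp: bounded_meas_def)
  have "\<bar>f x * g x\<bar> \<le> K * L" for x
  proof -
    have "0 \<le> K" by (rule order_trans[OF abs_ge_zero KL(1)[rule_format, of x]])
    then show ?thesis unfolding abs_mult using KL by (intro mult_mono) auto
  qed
  then show ?thesis using assms by (intro bounded_measI) (auto simp: bounded_meas_def)
qed

lemma bounded_meas_cmult: "bounded_meas f \<Longrightarrow> bounded_meas (\<lambda>x. c * f x)"
  by (rule bounded_meas_mult[OF bounded_meas_const])

lemma bounded_meas_diff: "bounded_meas f \<Longrightarrow> bounded_meas g \<Longrightarrow> bounded_meas (\<lambda>x. f x - g x)"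
  using bounded_meas_add[of f "\<lambda>x. -1 * g x"] bounded_meas_cmult[of g "-1"] by simp

lemma bounded_meas_power2: "bounded_meas f \<Longrightarrow> bounded_meas (\<lambda>x. (f x)\<^sup>2)"
  using bounded_meas_mult[of f f] by (simp add: power2_eq_square)

lemma bounded_meas_sum: "(\<And>i. i \<in> I \<Longrightarrow> bounded_meas (f i)) \<Longrightarrow> bounded_meas (\<lambda>x. \<Sum>i\<in>I. f i x)"
proof (induction I rule: infinite_finite_induct)
  case (insert i I)
  then show ?case using bounded_meas_add[of "f i" "\<lambda>x. \<Sum>i\<in>I. f i x"] by simp
qed (simp_all add: bounded_meas_const)

lemma trig_real_bounded_meas:
  assumes "trig_on W (\<lambda>x. complex_of_real (f x))"
  shows "bounded_meas f"
proof -
  have "(\<lambda>x. Re (complex_of_real (f x))) \<in> borel_measurable borel"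
    using trig_measurable[OF assms] by measurable
  then show ?thesis using trig_bounded[OF assms] by (auto simp: bounded_meas_def)
qed

definition l2norm :: "('d::finite torus \<Rightarrow> real) \<Rightarrow> real" where
  "l2norm f = sqrt (\<integral>x. (f x)\<^sup>2 \<partial>torus_haar)"

lemma l2norm_nonneg: "0 \<le> l2norm f"
  by (simp add: l2norm_def)

lemma l2norm_sq: "(l2norm f)\<^sup>2 = (\<integral>x. (f x)\<^sup>2 \<partial>torus_haar)"
  by (simp add: l2norm_def)

lemma cauchy_schwarz_torus:
  assumes f: "bounded_meas f" and g: "bounded_meas g"
  shows "\<bar>\<integral>x. f x * g x \<partial>torus_haar\<bar> \<le> l2norm f * l2norm g"
proof -
  define a where "a = (\<integral>x. (f x)\<^sup>2 \<partial>torus_haar)"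
  define b where "b = (\<integral>x. (g x)\<^sup>2 \<partial>torus_haar)"
  define c where "c = (\<integral>x. f x * g x \<partial>torus_haar)"
  have ab: "0 \<le> a" "0 \<le> b" by (auto simp: a_def b_def)
  have quad: "0 \<le> s\<^sup>2 * a + 2 * s * t * c + t\<^sup>2 * b" for s t
  proof -
    have "0 \<le> (\<integral>x. (s * f x + t * g x)\<^sup>2 \<partial>torus_haar)" by (rule Bochner_Integration.integral_nonneg) simp
    also have "\<dots> = (\<integral>x. s\<^sup>2 * (f x)\<^sup>2 + (2 * s * t) * (f x * g x) + t\<^sup>2 * (g x)\<^sup>2 \<partial>torus_haar)"
      by (simp add: power2_eq_square algebra_simps)
    also have "\<dots> = s\<^sup>2 * a + 2 * s * t * c + t\<^sup>2 * b"
      using bounded_meas_integrable[OF bounded_meas_power2[OF f]] bounded_meas_integrable[OF bounded_meas_power2[OF g]]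
        bounded_meas_integrable[OF bounded_meas_mult[OF f g]]
      by (simp add: a_def b_def c_def)
    finally show ?thesis .
  qed
  have "c\<^sup>2 \<le> a * b"
  proof (cases "a = 0 \<and> b = 0")
    case True
    then have "c\<^sup>2 \<le> 0" using quad[of 1 "- c"] by (simp add: power2_eq_square)
    then show ?thesis using True by simp
  next
    case False
    \<comment> \<open>Two test vectors, since the discriminant appears multiplied by
      \<open>b\<close> or by \<open>a\<close>, and either of these may vanish.\<close>
    have "0 \<le> b * (a * b - c\<^sup>2)" using quad[of b "- c"] by (simp add: power2_eq_square algebra_simps)
    moreover have "0 \<le> a * (a * b - c\<^sup>2)" using quad[of "- c" a] by (simp add: power2_eq_square algebra_simps)
    moreover have "0 < a \<or> 0 < b" using False ab by auto
    ultimately show ?thesis by (auto simp: zero_le_mult_iff)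
  qed
  then have "\<bar>c\<bar> \<le> sqrt (a * b)" by (metis real_sqrt_abs real_sqrt_le_mono)
  then show ?thesis by (simp add: l2norm_def a_def b_def c_def real_sqrt_mult)
qed

lemma l2norm_triangle:
  assumes f: "bounded_meas f" and g: "bounded_meas g"
  shows "l2norm (\<lambda>x. f x + g x) \<le> l2norm f + l2norm g"
proof (rule power2_le_imp_le)
  have "(l2norm (\<lambda>x. f x + g x))\<^sup>2 = (\<integral>x. (f x)\<^sup>2 + 2 * (f x * g x) + (g x)\<^sup>2 \<partial>torus_haar)"
    unfolding l2norm_sq by (simp add: power2_eq_square algebra_simps)
  also have "\<dots> = (l2norm f)\<^sup>2 + 2 * (\<integral>x. f x * g x \<partial>torus_haar) + (l2norm g)\<^sup>2"
    using bounded_meas_integrable[OF bounded_meas_power2[OF f]] bounded_meas_integrable[OF bounded_meas_power2[OF g]]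
      bounded_meas_integrable[OF bounded_meas_mult[OF f g]]
    by (simp add: l2norm_sq)
  also have "\<dots> \<le> (l2norm f)\<^sup>2 + 2 * (l2norm f * l2norm g) + (l2norm g)\<^sup>2"
    using cauchy_schwarz_torus[OF f g] by linarith
  finally show "(l2norm (\<lambda>x. f x + g x))\<^sup>2 \<le> (l2norm f + l2norm g)\<^sup>2"
    by (simp add: power2_sum)
qed (simp add: l2norm_nonneg)

lemma l2norm_0 [simp]: "l2norm (\<lambda>x. 0) = 0"
  by (simp add: l2norm_def)

lemma l2norm_sum:
  assumes "\<And>i. i \<in> I \<Longrightarrow> bounded_meas (f i)"
  shows "l2norm (\<lambda>x. \<Sum>i\<in>I. f i x) \<le> (\<Sum>i\<in>I. l2norm (f i))"
  using assms
proof (induction I rule: infinite_finite_induct)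
  case (insert i I)
  then have "l2norm (\<lambda>x. f i x + (\<Sum>i\<in>I. f i x)) \<le> l2norm (f i) + l2norm (\<lambda>x. \<Sum>i\<in>I. f i x)"
    by (intro l2norm_triangle bounded_meas_sum) auto
  then show ?case using insert by force
qed simp_all

lemma l2norm_bound:
  assumes "bounded_meas f" "\<And>x. \<bar>f x\<bar> \<le> K"
  shows "l2norm f \<le> K"
proof -
  have K: "0 \<le> K" using assms(2)[of 0] by linarith
  have "(f x)\<^sup>2 \<le> K\<^sup>2" for x using assms(2)[of x] K by (metis abs_le_square_iff abs_of_nonneg)
  then have "(\<integral>x. (f x)\<^sup>2 \<partial>torus_haar) \<le> (\<integral>x. K\<^sup>2 \<partial>(torus_haar :: 'a torus measure))"
    using bounded_meas_integrable[OF bounded_meas_power2[OF assms(1)]] by (intro integral_mono) auto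
  then have "(l2norm f)\<^sup>2 \<le> K\<^sup>2" by (simp add: l2norm_sq)
  then show ?thesis using K by (rule power2_le_imp_le)
qed

lemma integral_abs_le_l2norm:
  assumes "bounded_meas f"
  shows "(\<integral>x. \<bar>f x\<bar> \<partial>torus_haar) \<le> l2norm f"
proof -
  have "bounded_meas (\<lambda>x. \<bar>f x\<bar>)" using assms by (auto simp: bounded_meas_def)
  from cauchy_schwarz_torus[OF this bounded_meas_const[of 1]] show ?thesis
    by (simp add: l2norm_def)
qed

lemma near_diagonal_sum_bound:
  fixes a :: "nat \<Rightarrow> nat \<Rightarrow> real"
  assumes I: "finite I" and bound: "\<And>k l. a k l \<le> S" "0 \<le> S"
    and far: "\<And>k l. k \<in> I \<Longrightarrow> l \<in> I \<Longrightarrow> k > l + L \<or> l > k + L \<Longrightarrow> a k l = 0"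
  shows "(\<Sum>k\<in>I. \<Sum>l\<in>I. a k l) \<le> real (card I) * (real (2 * L + 1) * S)"
proof -
  have "(\<Sum>l\<in>I. a k l) \<le> real (2 * L + 1) * S" if k: "k \<in> I" for k
  proof -
    have near: "k - L \<le> l \<and> l \<le> k + L" if "l \<in> I" "a k l \<noteq> 0" for l
    proof -
      have "\<not> (k > l + L \<or> l > k + L)" using far[OF k that(1)] that(2) by blast
      then show ?thesis by auto
    qed
    have "(\<Sum>l\<in>I. a k l) = (\<Sum>l\<in>I \<inter> {k - L..k + L}. a k l)"
    proof (rule sum.mono_neutral_right[OF I])
      show "\<forall>l\<in>I - I \<inter> {k - L..k + L}. a k l = 0"
      proof
        fix l assume l: "l \<in> I - I \<inter> {k - L..k + L}"
        show "a k l = 0"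
        proof (rule ccontr)
          assume "a k l \<noteq> 0"
          with near[of l] l show False by simp
        qed
      qed
    qed simp
    also have "\<dots> \<le> (\<Sum>l\<in>I \<inter> {k - L..k + L}. S)" by (intro sum_mono bound)
    also have "\<dots> = real (card (I \<inter> {k - L..k + L})) * S" by simp
    also have "card (I \<inter> {k - L..k + L}) \<le> card {k - L..k + L}" by (intro card_mono) auto
    then have "real (card (I \<inter> {k - L..k + L})) * S \<le> real (2 * L + 1) * S"
      using bound(2) by (intro mult_right_mono) auto
    finally show ?thesis .
  qed
  then have "(\<Sum>k\<in>I. \<Sum>l\<in>I. a k l) \<le> (\<Sum>k\<in>I. real (2 * L + 1) * S)" by (rule sum_mono)
  then show ?thesis by simp
qed

section \<open>Correlations along orbits\<close>

lemma transpose_matrix_power_vec: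
  "transpose (matrix_power A k) *v m = (((*v) (transpose A)) ^^ k) m" for A :: "int ^ 'd ^ 'd::finite"
proof (induction k arbitrary: m)
  case (Suc k)
  have "transpose (matrix_power A (Suc k)) *v m = transpose (matrix_power A k) *v (transpose A *v m)"
    by (simp add: matrix_transpose_mul matrix_vector_mul_assoc)
  then show ?case using Suc by (simp add: funpow_swap1)
qed simp

locale toral_automorphism = expanding_family "transpose A" h \<kappa> C c D
  for A :: "int ^ 'd ^ 'd::finite" and h \<kappa> C c D
begin

definition pow_freq :: "nat \<Rightarrow> int ^ 'd \<Rightarrow> int ^ 'd" where
  "pow_freq k m = (((*v) (transpose A)) ^^ k) m"

lemma pow_freq_0 [simp]: "pow_freq 0 m = m"
  by (simp add: pow_freq_def)

lemma pow_freq_add: "pow_freq (k + l) m = pow_freq k (pow_freq l m)"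
  by (simp add: pow_freq_def funpow_add)

lemma pow_freq_plus: "pow_freq k (m + n) = pow_freq k m + pow_freq k n"
  by (simp add: pow_freq_def transpose_matrix_power_vec[symmetric] matrix_vector_right_distrib)

lemma tchar_matrix_power: "tchar m (torus_mult (matrix_power A k) x) = tchar (pow_freq k m) x"
  by (simp add: tchar_torus_mult transpose_matrix_power_vec pow_freq_def)

lemma h_0: "h a 0 = 0"
  and h_nonneg: "0 \<le> h a m"
proof -
  have "0 \<le> h a m" for m
    using h_add[of a m "- m"] h_add[of a 0 0] by (simp add: h_minus)
  then show "0 \<le> h a m" .
  have "h 0 0 = 0" using h_upper[of 0] \<open>\<And>m. 0 \<le> h a m\<close> h_add[of 0 0 0] by (simp add: int_norm_def)
  moreover have "h a 0 \<le> h 0 0"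
  proof (induction a)
    case (Suc a)
    have "h (Suc a) 0 \<le> \<kappa> * h (Suc a) 0"
      using \<kappa> h_add[of "Suc a" 0 0] mult_right_mono[of 1 \<kappa> "h (Suc a) 0"] by simp
    then show ?case using h_Suc[of a 0] Suc by linarith
  qed simp
  ultimately show "h a 0 = 0" using h_add[of a 0 0] by simp
qed

lemma h_pow_freq: "h (a + k) (pow_freq k m) = h a m"
proof (induction k)
  case (Suc k)
  have "pow_freq (Suc k) m = transpose A *v pow_freq k m" by (simp add: pow_freq_def)
  then show ?case using Suc h_Suc_T[of "a + k"] by simp
qed simp

lemma h_power: "\<kappa> ^ k * h (a + k) m \<le> h a m"
proof (induction k)
  case (Suc k)
  have "\<kappa> ^ Suc k * h (a + Suc k) m = \<kappa> ^ k * (\<kappa> * h (Suc (a + k)) m)" by simp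
  also have "\<dots> \<le> \<kappa> ^ k * h (a + k) m" using \<kappa> by (intro mult_left_mono h_Suc) auto
  finally show ?case using Suc by simp
qed simp

text \<open>Two readings of an index shift: \<open>pow_freq k\<close> raises the index by
  \<open>k\<close> at no cost, and each lowering of the index by one gains a factor
  \<kappa>.\<close>

lemma h_pow_freq_ge: "\<kappa> ^ k * h a m \<le> h a (pow_freq k m)"
  using h_power[of k a "pow_freq k m"] by (simp add: h_pow_freq)

lemma h_pow_freq_ge': "h a m \<le> h a (pow_freq k m)"
proof -
  have "1 * h a m \<le> \<kappa> ^ k * h a m" using \<kappa> h_nonneg[of a m] by (intro mult_right_mono one_le_power) auto
  then show ?thesis using h_pow_freq_ge[of k a m] by linarith
qed

text \<open>Writing \<open>k = l + i\<close> gives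
  \<open>pow_freq l (pow_freq i m + m') = - (E *v (m + m'))\<close>. As \<open>h 0\<close> does not
  decrease under \<open>pow_freq l\<close>, the bracket has size O(2^j) however large
  \<open>l\<close> is; yet its first term has size at least \<open>\<kappa> ^ i\<close> times a
  negative power of \<open>2 ^ j\<close>. Hence \<open>i\<close> is at most of order
  \<open>j + 1\<close>.\<close>

lemma frequencies_far:
  fixes E :: "int ^ 'd ^ 'd" and R :: real
  assumes R: "R > 0"
  obtains L :: nat where "\<And>j k l m m'. m \<noteq> 0 \<Longrightarrow> m' \<noteq> 0 \<Longrightarrow> int_norm m \<le> R * 2 ^ j \<Longrightarrow> int_norm m' \<le> R * 2 ^ j \<Longrightarrow>
    (pow_freq k m + E *v m) + (pow_freq l m' + E *v m') = 0 \<Longrightarrow> k \<le> l + L * (j + 1)"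
proof -
  obtain K where K: "K \<ge> 0" "\<And>m. int_norm (E *v m) \<le> K * int_norm m"
    using int_norm_mult_bound[of E] by blast
  \<comment> \<open>The added 1 makes the logarithm nonnegative, so one multiple of
    \<open>j + 1\<close> can absorb both it and the term linear in \<open>j\<close>.\<close>
  define K1 where "K1 = (C * K * 2 * R + C * R) * R powr D / c + 1"
  have K1: "K1 \<ge> 1" using C0 c0 K R by (auto simp: K1_def intro!: divide_nonneg_pos add_nonneg_nonneg mult_nonneg_nonneg)
  define X where "X = ln K1 + (1 + D) * ln 2"
  have X: "X \<ge> 0" using K1 D0 by (simp add: X_def)
  define L where "L = nat \<lceil>X / ln \<kappa>\<rceil>"
  have L: "X / ln \<kappa> \<le> real L" by (simp add: L_def real_nat_ceiling_ge)
  have lk: "ln \<kappa> > 0" using \<kappa> by simp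
  show ?thesis
  proof (rule that[of L], rule ccontr)
    fix j k l m m'
    assume m: "m \<noteq> 0" "m' \<noteq> 0" "int_norm m \<le> R * 2 ^ j" "int_norm m' \<le> R * 2 ^ j"
      and eq: "(pow_freq k m + E *v m) + (pow_freq l m' + E *v m') = 0"
      and less: "\<not> k \<le> l + L * (j + 1)"
    define i where "i = k - l"
    have k: "k = l + i" using less by (simp add: i_def)
    define v where "v = pow_freq i m + m'"
    have "pow_freq l v = - (E *v (m + m'))"
      using eq by (simp add: v_def k pow_freq_add pow_freq_plus matrix_vector_right_distrib)
        (simp add: eq_neg_iff_add_eq_0 algebra_simps)
    then have "h 0 (pow_freq l v) = h 0 (E *v (m + m'))" by (simp add: h_minus)
    also have "\<dots> \<le> C * (K * (int_norm m + int_norm m'))"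
      using C0 K int_norm_add[of m m']
      by (intro order_trans[OF h_upper] mult_left_mono order_trans[OF K(2)]) auto
    also have "\<dots> \<le> C * (K * (R * 2 ^ j + R * 2 ^ j))"
      using C0 K m by (intro mult_left_mono add_mono) auto
    finally have v1: "h 0 v \<le> C * K * 2 * R * 2 ^ j"
      using h_pow_freq_ge'[of 0 v l] by (simp add: algebra_simps)
    have m'1: "h 0 m' \<le> C * R * 2 ^ j"
      using order_trans[OF h_upper[of m'] mult_left_mono[OF m(4) C0]] by simp
    have "\<kappa> ^ i * (c * (R * 2 ^ j) powr (- D)) \<le> \<kappa> ^ i * (c * int_norm m powr (- D))"
      using \<kappa> c0 D0 m R int_norm_ge_1[OF m(1)] by (intro mult_left_mono powr_mono2') auto
    also have "\<dots> \<le> \<kappa> ^ i * h 0 m" using \<kappa> h_lower[OF m(1)] by (intro mult_left_mono) auto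
    also have "\<dots> \<le> h 0 (v + (- m'))" using h_pow_freq_ge[of i 0 m] by (simp add: v_def)
    also have "\<dots> \<le> h 0 v + h 0 m'" using h_add[of 0 v "- m'"] by (simp add: h_minus)
    also have "\<dots> \<le> (C * K * 2 * R + C * R) * 2 ^ j" using v1 m'1 by (simp add: algebra_simps)
    finally have "\<kappa> ^ i \<le> (C * K * 2 * R + C * R) * 2 ^ j / (c * (R * 2 ^ j) powr (- D))"
      using c0 R by (subst pos_le_divide_eq) auto
    also have "\<dots> = (C * K * 2 * R + C * R) * R powr D / c * (2 ^ j * (2 ^ j) powr D)"
      using R c0 by (simp add: powr_minus powr_mult field_simps)
    also have "\<dots> \<le> K1 * (2 ^ j * (2 ^ j) powr D)"
      by (intro mult_right_mono) (auto simp: K1_def)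
    finally have "ln (\<kappa> ^ i) \<le> ln (K1 * (2 ^ j * (2 ^ j) powr D))"
      using \<kappa> K1 by (subst ln_le_cancel_iff) auto
    also have "\<dots> = ln K1 + real j * ((1 + D) * ln 2)"
      using K1 by (simp add: ln_mult ln_powr ln_realpow algebra_simps)
    also have "\<dots> \<le> real (j + 1) * X"
      using K1 D0 by (simp add: X_def algebra_simps)
    finally have "real i * ln \<kappa> \<le> real (j + 1) * X" using \<kappa> by (simp add: ln_realpow)
    then have "real i \<le> real (j + 1) * (X / ln \<kappa>)" using lk by (simp add: field_simps)
    also have "\<dots> \<le> real (j + 1) * real L" using L by (intro mult_left_mono) auto
    finally have "i \<le> L * (j + 1)" by (simp only: of_nat_mult[symmetric] of_nat_le_iff mult.commute)
    then show False using less k by simp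
  qed
qed

text \<open>
  Both \<open>A\<^sup>k x + y\<close> (with \<open>E = 0\<close>) and \<open>(A\<^sup>k - B) x\<close> (with \<open>E = - B\<close>, \<open>y = 0\<close>) are of this form.
\<close>

definition orbit_point :: "int ^ 'd ^ 'd \<Rightarrow> 'd torus \<Rightarrow> nat \<Rightarrow> 'd torus \<Rightarrow> 'd torus" where
  "orbit_point E y k x = torus_mult (matrix_power A k) x + torus_mult E x + y"

lemma tchar_orbit_point:
  "tchar m (orbit_point E y k x) = tchar m y * tchar (pow_freq k m + transpose E *v m) x"
  by (simp add: orbit_point_def tchar_plus tchar_matrix_power tchar_add_freq) (simp add: tchar_torus_mult mult_ac)

lemma trig_orbit_point:
  "trig_on W f \<Longrightarrow> trig_on ((\<lambda>m. pow_freq k m + transpose E *v m) ` W) (\<lambda>x. f (orbit_point E y k x))"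
proof (induction rule: trig_on.induct)
  case (trig_insert f m c)
  have "trig_on ((\<lambda>m. pow_freq k m + transpose E *v m) ` W)
      (\<lambda>x. f (orbit_point E y k x) + (c * tchar m y) * tchar (pow_freq k m + transpose E *v m) x)"
    using trig_insert by (intro trig_on.trig_insert) auto
  then show ?case by (simp add: tchar_orbit_point mult.assoc)
qed (simp add: trig_zero)

text \<open>\<open>Q\<close> is real, so a correlation is the integral of a plain product and
  vanishes unless two frequencies sum to zero; \<open>far\<close>, used in both orders, confines
  this to a strip around the diagonal.\<close>

lemma l2norm_orbit_sum_block:
  fixes Q :: "'d torus \<Rightarrow> real"
  assumes far: "\<And>k l m m'. m \<in> W \<Longrightarrow> m' \<in> W \<Longrightarrow>
      (pow_freq k m + transpose E *v m) + (pow_freq l m' + transpose E *v m') = 0 \<Longrightarrow> k \<le> l + L"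
    and Q: "trig_on W (\<lambda>x. complex_of_real (Q x))" and S: "\<And>x. \<bar>Q x\<bar> \<le> S" and I: "finite I"
  shows "l2norm (\<lambda>x. \<Sum>k\<in>I. Q (orbit_point E y k x)) \<le> sqrt (real (card I)) * (sqrt (real (2 * L + 1)) * S)"
proof -
  define q where "q k x = Q (orbit_point E y k x)" for k x
  have qt: "trig_on ((\<lambda>m. pow_freq k m + transpose E *v m) ` W) (\<lambda>x. complex_of_real (q k x))" for k
    unfolding q_def by (rule trig_orbit_point[OF Q])
  have qb: "bounded_meas (q k)" for k by (rule trig_real_bounded_meas[OF qt])
  have S0: "0 \<le> S" using S[of 0] by linarith
  have "(l2norm (\<lambda>x. \<Sum>k\<in>I. q k x))\<^sup>2 = (\<integral>x. (\<Sum>k\<in>I. \<Sum>l\<in>I. q k x * q l x) \<partial>torus_haar)"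
    unfolding l2norm_sq by (simp add: power2_eq_square sum_product)
  also have "\<dots> = (\<Sum>k\<in>I. \<Sum>l\<in>I. \<integral>x. q k x * q l x \<partial>torus_haar)"
    using bounded_meas_integrable[OF bounded_meas_mult[OF qb qb]] by simp
  also have "\<dots> \<le> real (card I) * (real (2 * L + 1) * S\<^sup>2)"
  proof (rule near_diagonal_sum_bound[OF I])
    show "(\<integral>x. q k x * q l x \<partial>torus_haar) \<le> S\<^sup>2" for k l
    proof -
      have "l2norm (q k) \<le> S" "l2norm (q l) \<le> S"
        using S by (auto intro!: l2norm_bound qb simp: q_def)
      then have "l2norm (q k) * l2norm (q l) \<le> S * S" using l2norm_nonneg S0 by (intro mult_mono) auto
      then show ?thesis using cauchy_schwarz_torus[OF qb[of k] qb[of l]] by (simp add: power2_eq_square)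
    qed
    fix k l assume *: "k > l + L \<or> l > k + L"
    have t: "trig_on {u + v |u v. u \<in> (\<lambda>m. pow_freq k m + transpose E *v m) ` W \<and>
        v \<in> (\<lambda>m. pow_freq l m + transpose E *v m) ` W} (\<lambda>x. complex_of_real (q k x) * complex_of_real (q l x))"
      by (rule trig_mult[OF qt qt])
    have "(\<integral>x. complex_of_real (q k x) * complex_of_real (q l x) \<partial>torus_haar) = 0"
    proof (rule trig_integral_0[OF t], rule notI)
      assume "0 \<in> {u + v |u v. u \<in> (\<lambda>m. pow_freq k m + transpose E *v m) ` W \<and>
          v \<in> (\<lambda>m. pow_freq l m + transpose E *v m) ` W}"
      then obtain m m' where m: "m \<in> W" "m' \<in> W"
          "(pow_freq k m + transpose E *v m) + (pow_freq l m' + transpose E *v m') = 0"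
        by auto
      then have "k \<le> l + L" "l \<le> k + L"
        using far[of m m' k l] far[of m' m l k] by (auto simp: add.commute)
      then show False using * by linarith
    qed
    then have "complex_of_real (\<integral>x. q k x * q l x \<partial>torus_haar) = 0"
      by (simp flip: of_real_mult)
    then show "(\<integral>x. q k x * q l x \<partial>torus_haar) = 0" by (simp only: of_real_eq_0_iff)
  qed simp
  also have "\<dots> = (sqrt (real (card I)) * (sqrt (real (2 * L + 1)) * S))\<^sup>2"
    by (simp add: power_mult_distrib)
  finally show ?thesis
    unfolding q_def by (rule power2_le_imp_le) (use S0 in simp)
qed

end

section \<open>Hoelder observables and their dyadic bands\<close>

lemma bounded_of_hoelder:
  fixes \<phi> :: "'d::finite torus \<Rightarrow> real"
  assumes "\<And>x y. \<bar>\<phi> x - \<phi> y\<bar> \<le> C * dist x y powr \<alpha>" "0 < \<alpha>" "0 \<le> C"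
  shows "\<bar>\<phi> x\<bar> \<le> \<bar>\<phi> 0\<bar> + C * sqrt (2 * real CARD('d)) powr \<alpha>"
proof -
  have "dist x 0 \<le> sqrt (2 * real CARD('d))"
    using dist_torus_sq_bound[of x 0] by (simp add: real_le_rsqrt)
  then have "dist x 0 powr \<alpha> \<le> sqrt (2 * real CARD('d)) powr \<alpha>"
    using assms by (intro powr_mono2) auto
  then have "C * dist x 0 powr \<alpha> \<le> C * sqrt (2 * real CARD('d)) powr \<alpha>"
    using assms by (intro mult_left_mono)
  then show ?thesis using assms(1)[of x 0] by linarith
qed

lemma continuous_of_hoelder:
  fixes \<phi> :: "'d::finite torus \<Rightarrow> real"
  assumes "\<And>x y. \<bar>\<phi> x - \<phi> y\<bar> \<le> C * dist x y powr \<alpha>" "0 < \<alpha>"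
  shows "continuous_on UNIV \<phi>"
  unfolding continuous_on_def
proof (intro ballI)
  fix x :: "'d torus"
  have "((\<lambda>y. dist y x) \<longlongrightarrow> 0) (at x)"
    using tendsto_dist[OF tendsto_ident_at[of x UNIV] tendsto_const[of x]] by simp
  then have "((\<lambda>y. C * dist y x powr \<alpha>) \<longlongrightarrow> C * 0) (at x)"
    using assms(2) by (intro tendsto_mult tendsto_const tendsto_zero_powrI[where b = \<alpha>]) auto
  then have "((\<lambda>y. \<phi> y - \<phi> x) \<longlongrightarrow> 0) (at x)"
    by (intro Lim_null_comparison[of "\<lambda>y. \<phi> y - \<phi> x" "\<lambda>y. C * dist y x powr \<alpha>"] always_eventually)
       (use assms in auto)
  then show "(\<phi> \<longlongrightarrow> \<phi> x) (at x within UNIV)" by (simp add: LIM_zero_iff)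
qed

locale toral_observable = toral_automorphism A h \<kappa> C c D
  for A :: "int ^ 'd ^ 'd::finite" and h \<kappa> C c D +
  fixes \<phi> :: "'d torus \<Rightarrow> real" and \<alpha> H :: real
  assumes hoelder: "\<And>x y. \<bar>\<phi> x - \<phi> y\<bar> \<le> H * dist x y powr \<alpha>" and \<alpha>: "0 < \<alpha>" "\<alpha> \<le> 1" and H: "0 \<le> H"
    and mean: "(\<integral>x. \<phi> x \<partial>torus_haar) = 0"
begin

lemma \<phi>_measurable: "\<phi> \<in> borel_measurable borel"
  by (rule borel_measurable_continuous_onI[OF continuous_of_hoelder[OF hoelder \<alpha>(1)]])

definition \<phi>_bound :: real where
  "\<phi>_bound = \<bar>\<phi> 0\<bar> + H * sqrt (2 * real CARD('d)) powr \<alpha>"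

lemma \<phi>_bounded: "\<bar>\<phi> x\<bar> \<le> \<phi>_bound"
  unfolding \<phi>_bound_def by (rule bounded_of_hoelder[OF hoelder \<alpha>(1) H])

definition approx :: "nat \<Rightarrow> 'd torus \<Rightarrow> real" where
  "approx j = fejer_mean (2 ^ j) \<phi>"

definition approx_freqs :: "nat \<Rightarrow> (int ^ 'd) set" where
  "approx_freqs j = {m. m \<noteq> 0 \<and> int_norm m \<le> real CARD('d) * 2 ^ j}"

lemma approx_trig: "trig_on (approx_freqs j) (\<lambda>x. complex_of_real (approx j x))"
  using fejer_mean_trig[OF \<phi>_measurable \<phi>_bounded mean, of "2 ^ j"]
  by (simp add: approx_def approx_freqs_def)

definition rate :: real where "rate = 2 powr (- (\<alpha> / 2))"

lemma rate: "0 < rate" "rate < 1"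
  using \<alpha> by (auto simp: rate_def powr_less_one)

definition approx_const :: real where "approx_const = H * (1 + real CARD('d))"

lemma approx_const: "0 \<le> approx_const"
  using H by (simp add: approx_const_def)

lemma approx_error: "\<bar>\<phi> x - approx j x\<bar> \<le> approx_const * rate ^ j"
proof -
  have "real (2 ^ j) powr (- (\<alpha> / 2)) = rate ^ j"
    by (simp add: rate_def powr_realpow[symmetric] powr_powr mult.commute)
  then show ?thesis
    using fejer_mean_approx[OF \<phi>_measurable \<phi>_bounded hoelder \<alpha> H, of "2 ^ j" x]
    by (simp add: approx_def approx_const_def)
qed

lemma approx_orbit_bounded_meas: "bounded_meas (\<lambda>x. approx j (orbit_point E y k x))"
  by (rule trig_real_bounded_meas[OF trig_orbit_point[OF approx_trig]])

text \<open>Composition with the orbit is handled on trigonometric polynomials, where it only moves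
  frequencies; convergence of the approximants transfers measurability to \<phi>.\<close>

lemma \<phi>_orbit_bounded_meas: "bounded_meas (\<lambda>x. \<phi> (orbit_point E y k x))"
proof (rule bounded_measI[OF _ \<phi>_bounded], rule borel_measurable_LIMSEQ_real)
  show "(\<lambda>x. approx j (orbit_point E y k x)) \<in> borel_measurable borel" for j
    by (rule bounded_meas_measurable[OF approx_orbit_bounded_meas])
  show "(\<lambda>j. approx j (orbit_point E y k x)) \<longlonglongrightarrow> \<phi> (orbit_point E y k x)" for x
  proof (rule LIM_zero_cancel, rule Lim_null_comparison)
    show "\<forall>\<^sub>F j in sequentially. norm (approx j (orbit_point E y k x) - \<phi> (orbit_point E y k x)) \<le> approx_const * rate ^ j"
      using approx_error by (intro always_eventually allI) (simp add: abs_minus_commute)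
    show "(\<lambda>j. approx_const * rate ^ j) \<longlonglongrightarrow> 0"
      using rate by (intro tendsto_mult_right_zero LIMSEQ_realpow_zero) auto
  qed
qed

definition band :: "nat \<Rightarrow> 'd torus \<Rightarrow> real" where
  "band j x = approx (Suc j) x - approx j x"

lemma band_trig: "trig_on (approx_freqs (Suc j)) (\<lambda>x. complex_of_real (band j x))"
proof -
  have "trig_on (approx_freqs (Suc j)) (\<lambda>x. complex_of_real (approx j x))"
    by (rule trig_mono[OF approx_trig]) (auto simp: approx_freqs_def intro: order_trans)
  from trig_add[OF trig_cmult[OF this, of "-1"] approx_trig[of "Suc j"]] show ?thesis
    by (simp add: band_def)
qed

lemma band_bound: "\<bar>band j x\<bar> \<le> 2 * approx_const * rate ^ j"
proof -
  have "approx_const * rate ^ Suc j \<le> approx_const * rate ^ j"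
    using approx_const rate by (intro mult_left_mono power_decreasing) auto
  then show ?thesis using approx_error[of x j] approx_error[of x "Suc j"] by (simp add: band_def)
qed

lemma approx_telescope: "J \<le> J' \<Longrightarrow> approx J' x = approx J x + (\<Sum>j\<in>{J..<J'}. band j x)"
  by (induction J' rule: dec_induct) (auto simp: band_def)

text \<open>
  The bands are estimated separately: the \<open>j\<close>-th one decorrelates along the orbit after
  \<open>O(j)\<close> steps, while its size is \<open>O(rate ^ j)\<close>.
\<close>

lemma l2norm_orbit_tail:
  obtains \<eta> :: "nat \<Rightarrow> real" where "\<eta> \<longlonglongrightarrow> 0"
    "\<And>J I y. finite I \<Longrightarrow> l2norm (\<lambda>x. \<Sum>k\<in>I. \<phi> (orbit_point E y k x) - approx J (orbit_point E y k x))
       \<le> \<eta> J * sqrt (real (card I))"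
proof -
  \<comment> \<open>Band \<open>j\<close> involves frequencies up to
    \<open>CARD('d) * 2 ^ Suc j\<close>; the factor 2 covers the step from \<open>j\<close> to
    \<open>Suc j\<close>.\<close>
  obtain L where L: "\<And>j k l m m'. m \<noteq> 0 \<Longrightarrow> m' \<noteq> 0 \<Longrightarrow> int_norm m \<le> (2 * real CARD('d)) * 2 ^ j \<Longrightarrow>
      int_norm m' \<le> (2 * real CARD('d)) * 2 ^ j \<Longrightarrow>
      (pow_freq k m + transpose E *v m) + (pow_freq l m' + transpose E *v m') = 0 \<Longrightarrow> k \<le> l + L * (j + 1)"
    using frequencies_far[of "2 * real CARD('d)" "transpose E"] by auto
  \<comment> \<open>The sup norm of band \<open>j\<close> decays like \<open>rate ^ j\<close>, while
    its decorrelation time is linear in \<open>j\<close>; the combination is summable.\<close>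
  define a where "a j = (2 * approx_const * real (2 * L + 1)) * (real (Suc j) * rate ^ j)" for j
  have "summable (\<lambda>j. real (Suc j) * rate ^ j)"
    using geometric_deriv_sums[of rate] rate by (auto simp: sums_iff)
  then have a_sum: "summable a" unfolding a_def by (rule summable_mult)
  have a0: "0 \<le> a j" for j using approx_const rate by (simp add: a_def)
  define \<eta> where "\<eta> J = (\<Sum>j. a (j + J))" for J
  have "\<eta> \<longlonglongrightarrow> 0" unfolding \<eta>_def by (rule suminf_exist_split2[OF a_sum])
  moreover have "l2norm (\<lambda>x. \<Sum>k\<in>I. \<phi> (orbit_point E y k x) - approx J (orbit_point E y k x))
      \<le> \<eta> J * sqrt (real (card I))" if I: "finite I" for J I y
  proof -
    have block: "l2norm (\<lambda>x. \<Sum>k\<in>I. band j (orbit_point E y k x)) \<le> sqrt (real (card I)) * a j" for j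
    proof -
      define M where "M = L * (j + 1)"
      have "l2norm (\<lambda>x. \<Sum>k\<in>I. band j (orbit_point E y k x))
          \<le> sqrt (real (card I)) * (sqrt (real (2 * M + 1)) * (2 * approx_const * rate ^ j))"
      proof (rule l2norm_orbit_sum_block[OF _ band_trig band_bound I])
        show "k \<le> l + M" if "m \<in> approx_freqs (Suc j)" "m' \<in> approx_freqs (Suc j)"
          "(pow_freq k m + transpose E *v m) + (pow_freq l m' + transpose E *v m') = 0" for k l m m'
          using L[of m m' j k l] that by (simp add: approx_freqs_def M_def mult_ac)
      qed
      also have "sqrt (real (2 * M + 1)) \<le> real (2 * L + 1) * real (Suc j)"
      proof (rule real_le_lsqrt)
        have "2 * M + 1 \<le> (2 * L + 1) * Suc j" by (simp add: M_def algebra_simps)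
        then have 1: "real (2 * M + 1) \<le> real (2 * L + 1) * real (Suc j)"
          by (simp only: of_nat_mult[symmetric] of_nat_le_iff)
        define z where "z = real (2 * L + 1) * real (Suc j)"
        have "1 * 1 \<le> z" unfolding z_def by (intro mult_mono) auto
        then have "z * 1 \<le> z * z" by (intro mult_left_mono) auto
        with 1 show "real (2 * M + 1) \<le> (real (2 * L + 1) * real (Suc j))\<^sup>2"
          unfolding z_def[symmetric] power2_eq_square by linarith
      qed auto
      also have "real (2 * L + 1) * real (Suc j) * (2 * approx_const * rate ^ j) = a j"
        by (simp add: a_def)
      finally show ?thesis using approx_const rate by (simp add: mult_left_mono mult_right_mono)
    qed
    \<comment> \<open>With \<open>I\<close> fixed, the remainder beyond level \<open>J + i\<close>
      is bounded trivially in the sup norm. It disappears as \<open>i\<close> tends to infinity,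
      which is why the estimate carries this extra parameter.\<close>
    have main: "l2norm (\<lambda>x. \<Sum>k\<in>I. \<phi> (orbit_point E y k x) - approx J (orbit_point E y k x))
        \<le> \<eta> J * sqrt (real (card I)) + real (card I) * (approx_const * rate ^ (J + i))" for i
    proof -
      define f where "f x = (\<Sum>j\<in>{J..<J + i}. \<Sum>k\<in>I. band j (orbit_point E y k x))" for x
      define g where "g x = (\<Sum>k\<in>I. \<phi> (orbit_point E y k x) - approx (J + i) (orbit_point E y k x))" for x
      have bband: "bounded_meas (\<lambda>x. \<Sum>k\<in>I. band j (orbit_point E y k x))" for j
        unfolding band_def by (intro bounded_meas_sum bounded_meas_diff approx_orbit_bounded_meas)
      have fb: "bounded_meas f" unfolding f_def by (intro bounded_meas_sum bband)
      have gb: "bounded_meas g" unfolding g_def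
        by (intro bounded_meas_sum bounded_meas_diff approx_orbit_bounded_meas \<phi>_orbit_bounded_meas)
      have "(\<Sum>k\<in>I. \<phi> (orbit_point E y k x) - approx J (orbit_point E y k x)) = f x + g x" for x
        unfolding f_def g_def
        by (subst sum.swap) (simp add: approx_telescope[of J "J + i"] sum_subtractf sum.distrib)
      then have "l2norm (\<lambda>x. \<Sum>k\<in>I. \<phi> (orbit_point E y k x) - approx J (orbit_point E y k x)) \<le> l2norm f + l2norm g"
        using l2norm_triangle[OF fb gb] by simp
      also have "l2norm f \<le> (\<Sum>j\<in>{J..<J + i}. l2norm (\<lambda>x. \<Sum>k\<in>I. band j (orbit_point E y k x)))"
        unfolding f_def by (rule l2norm_sum[OF bband])
      also have "\<dots> \<le> (\<Sum>j\<in>{J..<J + i}. sqrt (real (card I)) * a j)" by (intro sum_mono block)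
      also have "\<dots> = sqrt (real (card I)) * (\<Sum>j<i. a (j + J))"
        unfolding sum_distrib_left[symmetric]
        using sum.shift_bounds_nat_ivl[of a 0 J i] by (simp add: atLeast0LessThan add.commute)
      also have "\<dots> \<le> sqrt (real (card I)) * \<eta> J"
        unfolding \<eta>_def using a_sum a0
        by (intro mult_left_mono sum_le_suminf) (auto simp: summable_iff_shift)
      also have "l2norm g \<le> real (card I) * (approx_const * rate ^ (J + i))"
      proof (rule l2norm_bound[OF gb])
        show "\<bar>g x\<bar> \<le> real (card I) * (approx_const * rate ^ (J + i))" for x
          unfolding g_def
          by (rule order_trans[OF sum_abs sum_bounded_above]) (rule approx_error)
      qed
      finally show ?thesis by (simp add: mult.commute)
    qed
    have "(\<lambda>i. \<eta> J * sqrt (real (card I)) + real (card I) * (approx_const * rate ^ (J + i)))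
        \<longlonglongrightarrow> \<eta> J * sqrt (real (card I)) + real (card I) * (approx_const * (rate ^ J * 0))"
      unfolding power_add using rate by (intro tendsto_intros LIMSEQ_realpow_zero) auto
    then show ?thesis using main by (intro LIMSEQ_le_const[OF _ exI[of _ 0]]) auto
  qed
  ultimately show ?thesis by (rule that)
qed

end

section \<open>The central limit theorem for trigonometric polynomials\<close>

lemma torus_mult_torus_mult: "torus_mult (M ** N) x = torus_mult M (torus_mult N x)"
proof transfer
  fix M N :: "int ^ 'a ^ 'a" and x :: "real ^ 'a"
  have "map_matrix real_of_int (M ** N) = map_matrix of_int M ** map_matrix of_int N"
    by (simp add: vec_eq_iff matrix_matrix_mult_def)
  then show "map_matrix of_int (M ** N) *v x - map_matrix of_int M *v (map_matrix of_int N *v x) \<in> int_lattice"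
    by (simp add: matrix_vector_mul_assoc int_lattice_zero)
qed

lemma matrix_power_add: "matrix_power A (k + l) = matrix_power A k ** matrix_power A l"
  by (induction k) (simp_all add: matrix_mul_assoc)

lemma torus_mult_0: "torus_mult 0 x = 0"
proof transfer
  fix x :: "real ^ 'a"
  have "map_matrix real_of_int (0 :: int ^ 'a ^ 'a) = 0" by (simp add: vec_eq_iff)
  then show "map_matrix of_int (0 :: int ^ 'a ^ 'a) *v x - 0 \<in> int_lattice" by (simp add: int_lattice_zero)
qed

lemma (in toral_automorphism) h_0_pos: "m \<noteq> 0 \<Longrightarrow> 0 < h 0 m"
proof -
  assume m: "m \<noteq> 0"
  have "0 < c * int_norm m powr (- D)" using c0 int_norm_ge_1[OF m] by simp
  then show "0 < h 0 m" using h_lower[OF m] by linarith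
qed

lemma (in toral_automorphism) pow_freq_eq_0: "pow_freq k m = 0 \<longleftrightarrow> m = 0"
proof
  assume "pow_freq k m = 0"
  then have "h 0 m \<le> 0" using h_pow_freq_ge'[of 0 m k] by (simp add: h_0)
  then show "m = 0" using h_0_pos[of m] by linarith
qed (simp add: pow_freq_def transpose_matrix_power_vec[symmetric])

text \<open>Nonzero frequencies stay nonzero under the transpose, so both integrals are the constant
  coefficient.\<close>

lemma (in toral_automorphism) trig_integral_invariant:
  assumes "trig_on W f"
  shows "(\<integral>x. f (torus_mult (matrix_power A k) x) \<partial>torus_haar) = (\<integral>x. f x \<partial>torus_haar)"
  using assms
proof (induction rule: trig_on.induct)
  case (trig_insert f m c)
  have "integrable torus_haar (\<lambda>x. f (torus_mult (matrix_power A k) x))"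
    by (rule trig_integrable[OF trig_torus_mult[OF trig_insert(1)]])
  note i1 = this
  have i2: "integrable torus_haar (\<lambda>x. c * tchar n x)" for n
    by (intro integrable_mult_right integrable_tchar)
  show ?case
    unfolding tchar_matrix_power Bochner_Integration.integral_add[OF i1 i2]
      Bochner_Integration.integral_add[OF trig_integrable[OF trig_insert(1)] i2]
    using trig_insert(3) by (simp add: integral_tchar pow_freq_eq_0)
qed simp

lemma (in toral_automorphism) h_le_h_0: "h k m \<le> h 0 m"
proof -
  have "1 * h k m \<le> \<kappa> ^ k * h k m" using \<kappa> h_nonneg[of k m] by (intro mult_right_mono one_le_power) auto
  then show ?thesis using h_power[of k 0 m] by simp
qed

section \<open>Trigonometric observables at a fixed translate\<close>

locale trig_observable = toral_automorphism A h \<kappa> C c D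
  for A :: "int ^ 'd ^ 'd::finite" and h \<kappa> C c D +
  fixes p :: "'d torus \<Rightarrow> real" and W :: "(int ^ 'd) set" and y :: "'d torus"
  assumes W: "finite W" "0 \<notin> W" and p_trig: "trig_on W (\<lambda>x. complex_of_real (p x))"
begin

definition obs :: "nat \<Rightarrow> 'd torus \<Rightarrow> real" where
  "obs k x = p (orbit_point 0 y k x)"

lemma obs_trig: "trig_on (pow_freq k ` W) (\<lambda>x. complex_of_real (obs k x))"
proof -
  have "transpose (0 :: int ^ 'd ^ 'd) = 0" by (simp add: transpose_def vec_eq_iff)
  then have e: "(\<lambda>m. pow_freq k m + transpose 0 *v m) = pow_freq k" by auto
  show ?thesis using trig_orbit_point[OF p_trig, of k 0 y] unfolding e obs_def .
qed

lemma obs_bounded_meas: "bounded_meas (obs k)"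
  by (rule trig_real_bounded_meas[OF obs_trig])

definition M where "M = (SOME M. \<forall>x. \<bar>p x\<bar> \<le> M)"

lemma p_bound: "\<bar>p x\<bar> \<le> M"
proof -
  have "\<exists>M. \<forall>x. \<bar>p x\<bar> \<le> M" using trig_bounded[OF p_trig] by simp
  then have "\<forall>x. \<bar>p x\<bar> \<le> M" unfolding M_def by (rule someI_ex)
  then show ?thesis ..
qed

lemma obs_bound: "\<bar>obs k x\<bar> \<le> M"
  by (simp add: obs_def p_bound)

lemma M_nonneg: "0 \<le> M"
  using p_bound[of 0] by linarith

definition psum :: "nat set \<Rightarrow> 'd torus \<Rightarrow> real" where
  "psum I x = (\<Sum>k\<in>I. obs k x)"

lemma psum_bounded_meas: "bounded_meas (psum I)"
  unfolding psum_def by (intro bounded_meas_sum obs_bounded_meas)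

lemma psum_bound: "\<bar>psum I x\<bar> \<le> real (card I) * M"
  unfolding psum_def by (rule order_trans[OF sum_abs sum_bounded_above]) (rule obs_bound)

lemma psum_trig: "trig_on (\<Union>k\<in>I. pow_freq k ` W) (\<lambda>x. complex_of_real (psum I x))"
  unfolding psum_def of_real_sum
  by (intro trig_sum trig_mono[OF obs_trig]) auto

lemma psum_mean: "(\<integral>x. psum I x \<partial>torus_haar) = 0"
proof -
  have "(\<integral>x. complex_of_real (psum I x) \<partial>torus_haar) = 0"
    by (rule trig_integral_0[OF psum_trig]) (use W in \<open>auto simp: pow_freq_eq_0\<close>)
  then show ?thesis by simp
qed

lemma psum_sq_trig: "trig_on {u + v |u v. u \<in> (\<Union>k\<in>I. pow_freq k ` W) \<and> v \<in> (\<Union>k\<in>I. pow_freq k ` W)}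
    (\<lambda>x. complex_of_real ((psum I x)\<^sup>2))"
  using trig_mult[OF psum_trig psum_trig] by (simp add: power2_eq_square)

definition var :: "nat \<Rightarrow> real" where
  "var n = (\<integral>x. (psum {..<n} x)\<^sup>2 \<partial>torus_haar)"

lemma obs_shift: "obs (k + a) x = obs k (torus_mult (matrix_power A a) x)"
  by (simp add: obs_def orbit_point_def matrix_power_add torus_mult_torus_mult torus_mult_0)

lemma var_shift: "(\<integral>x. (psum {a..<a + n} x)\<^sup>2 \<partial>torus_haar) = var n"
proof -
  have "psum {a..<a + n} x = psum {..<n} (torus_mult (matrix_power A a) x)" for x
    unfolding psum_def using sum.shift_bounds_nat_ivl[of "\<lambda>k. obs k x" 0 a n]
    by (simp add: obs_shift atLeast0LessThan add.commute)
  moreover have "complex_of_real (\<integral>x. (psum {..<n} (torus_mult (matrix_power A a) x))\<^sup>2 \<partial>torus_haar)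
      = complex_of_real (var n)"
    using trig_integral_invariant[OF psum_sq_trig[of "{..<n}"], of a] unfolding var_def
    by (simp flip: of_real_power)
  ultimately show ?thesis by (simp only: of_real_eq_iff)
qed

text \<open>The case \<open>E = 0\<close>, \<open>j = 0\<close> of \<open>frequencies_far\<close>,
  with \<open>R\<close> bounding the whole finite spectrum.\<close>

lemma far:
  obtains L where "\<And>k l m m'. m \<in> W \<Longrightarrow> m' \<in> W \<Longrightarrow> pow_freq k m + pow_freq l m' = 0 \<Longrightarrow> k \<le> l + L"
proof -
  define R where "R = (\<Sum>m\<in>W. int_norm m) + 1"
  have R: "int_norm m \<le> R * 2 ^ 0" if "m \<in> W" for m
  proof -
    have "int_norm m \<le> (\<Sum>m\<in>W. int_norm m)"
      using that W int_norm_nonneg by (intro member_le_sum) auto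
    then show ?thesis by (simp add: R_def)
  qed
  have "R > 0" unfolding R_def by (intro add_nonneg_pos sum_nonneg int_norm_nonneg) auto
  from frequencies_far[OF this, of 0] obtain L where L: "\<And>j k l m m'. m \<noteq> 0 \<Longrightarrow> m' \<noteq> 0 \<Longrightarrow>
      int_norm m \<le> R * 2 ^ j \<Longrightarrow> int_norm m' \<le> R * 2 ^ j \<Longrightarrow>
      (pow_freq k m + 0 *v m) + (pow_freq l m' + 0 *v m') = 0 \<Longrightarrow> k \<le> l + L * (j + 1)" by metis
  show ?thesis
  proof (rule that[of L])
    fix k l m m' assume a: "m \<in> W" "m' \<in> W" "pow_freq k m + pow_freq l m' = 0"
    have "m \<noteq> 0" "m' \<noteq> 0" using a W by auto
    from L[OF this R[OF a(1)] R[OF a(2)], of k l] a(3) show "k \<le> l + L" by simp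
  qed
qed

text \<open>Controls the terms that fall into the gaps between blocks or after the last
  block.\<close>

lemma l2norm_psum:
  obtains K where "K \<ge> 0" "\<And>I. finite I \<Longrightarrow> l2norm (psum I) \<le> K * sqrt (real (card I))"
proof -
  obtain L where L: "\<And>k l m m'. m \<in> W \<Longrightarrow> m' \<in> W \<Longrightarrow> pow_freq k m + pow_freq l m' = 0 \<Longrightarrow> k \<le> l + L"
    using far by metis
  have tr: "transpose (0 :: int ^ 'd ^ 'd) = 0" by (simp add: transpose_def vec_eq_iff)
  show ?thesis
  proof (rule that[of "sqrt (real (2 * L + 1)) * M"])
    fix I :: "nat set" assume I: "finite I"
    have "l2norm (\<lambda>x. \<Sum>k\<in>I. p (orbit_point 0 y k x)) \<le> sqrt (real (card I)) * (sqrt (real (2 * L + 1)) * M)"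
      by (rule l2norm_orbit_sum_block[OF _ p_trig p_bound I]) (use L tr in auto)
    then show "l2norm (psum I) \<le> sqrt (real (2 * L + 1)) * M * sqrt (real (card I))"
      by (simp add: psum_def[abs_def] obs_def mult_ac)
  qed (use M_nonneg in auto)
qed

text \<open>Correlations vanish beyond lag \<open>L\<close>, so the increments of \<open>var\<close>
  become the constant \<open>s\<close>, a finite Green-Kubo sum, and \<open>var\<close> is affine
  from \<open>L\<close> on.\<close>

lemma var_limit_exists: "\<exists>v. (\<lambda>n. var n / real n) \<longlonglongrightarrow> v"
proof -
  obtain L where L: "\<And>k l m m'. m \<in> W \<Longrightarrow> m' \<in> W \<Longrightarrow> pow_freq k m + pow_freq l m' = 0 \<Longrightarrow> k \<le> l + L"
    using far by metis
  define r where "r k = (\<integral>x. obs k x * obs 0 x \<partial>torus_haar)" for k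
  have r_shift: "(\<integral>x. obs (k + a) x * obs a x \<partial>torus_haar) = r k" for k a
  proof -
    have "complex_of_real (\<integral>x. obs (k + a) x * obs a x \<partial>torus_haar) = complex_of_real (r k)"
      using trig_integral_invariant[OF trig_mult[OF obs_trig[of 0] obs_trig[of k]], of a] obs_shift[of k a] obs_shift[of 0 a]
      by (simp add: r_def flip: of_real_mult)
    then show ?thesis by (simp only: of_real_eq_iff)
  qed
  have r0: "r k = 0" if "k > L" for k
  proof -
    have "(\<integral>x. complex_of_real (obs k x) * complex_of_real (obs 0 x) \<partial>torus_haar) = 0"
    proof (rule trig_integral_0[OF trig_mult[OF obs_trig obs_trig]], rule notI)
      assume "0 \<in> {u + v |u v. u \<in> pow_freq k ` W \<and> v \<in> pow_freq 0 ` W}"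
      then obtain m m' where "m \<in> W" "m' \<in> W" "pow_freq k m + pow_freq 0 m' = 0" by auto
      from L[OF this] that show False by simp
    qed
    then show ?thesis by (simp add: r_def flip: of_real_mult)
  qed
  have step: "var (Suc n) = var n + (r 0 + 2 * (\<Sum>k\<in>{1..n}. r k))" for n
  proof -
    have int: "integrable torus_haar (\<lambda>x. obs k x * obs l x)" "integrable torus_haar (\<lambda>x. (psum I x)\<^sup>2)"
        "integrable torus_haar (\<lambda>x. obs k x * psum I x)" for k l I
      by (intro bounded_meas_integrable bounded_meas_mult bounded_meas_power2 obs_bounded_meas psum_bounded_meas)+
    have "var (Suc n) = (\<integral>x. (psum {..<n} x)\<^sup>2 + (obs n x * obs n x + 2 * (obs n x * psum {..<n} x)) \<partial>torus_haar)"
      unfolding var_def by (simp add: psum_def power2_eq_square algebra_simps)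
    also have "\<dots> = var n + ((\<integral>x. obs n x * obs n x \<partial>torus_haar) + 2 * (\<integral>x. obs n x * psum {..<n} x \<partial>torus_haar))"
      using int by (simp add: var_def)
    also have "(\<integral>x. obs n x * obs n x \<partial>torus_haar) = r 0" using r_shift[of 0 n] by simp
    also have "(\<integral>x. obs n x * psum {..<n} x \<partial>torus_haar) = (\<Sum>l<n. \<integral>x. obs n x * obs l x \<partial>torus_haar)"
      unfolding psum_def sum_distrib_left using int by simp
    also have "\<dots> = (\<Sum>l<n. r (n - l))"
    proof (intro sum.cong refl)
      fix l assume "l \<in> {..<n}"
      then show "(\<integral>x. obs n x * obs l x \<partial>torus_haar) = r (n - l)" using r_shift[of "n - l" l] by simp
    qed
    also have "\<dots> = (\<Sum>k\<in>{1..n}. r k)"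
      by (rule sum.reindex_bij_witness[where i = "\<lambda>k. n - k" and j = "\<lambda>l. n - l"]) auto
    finally show ?thesis .
  qed
  define s where "s = r 0 + 2 * (\<Sum>k\<in>{1..L}. r k)"
  have s: "r 0 + 2 * (\<Sum>k\<in>{1..n}. r k) = s" if "n \<ge> L" for n
    unfolding s_def using that r0
    by (simp, intro sum.mono_neutral_right) auto
  have lin: "var n = var L + real (n - L) * s" if "n \<ge> L" for n
    using that
  proof (induction n rule: dec_induct)
    case (step n)
    have "var (Suc n) = var n + s" using \<open>var (Suc n) = _\<close> s[of n] step by simp
    then show ?case using step by (simp add: algebra_simps Suc_diff_le)
  qed simp
  have "(\<lambda>n. (var L - real L * s) / real n + s) \<longlonglongrightarrow> 0 + s"
    by (intro tendsto_add tendsto_const lim_const_over_n)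
  moreover have "\<forall>\<^sub>F n in sequentially. (var L - real L * s) / real n + s = var n / real n"
    using eventually_ge_at_top[of "max L 1"]
  proof eventually_elim
    case (elim n)
    then have "real n > 0" "real (n - L) = real n - real L" by auto
    then show ?case using lin[of n] elim by (simp add: field_simps)
  qed
  ultimately have "(\<lambda>n. var n / real n) \<longlonglongrightarrow> 0 + s" by (rule Lim_transform_eventually)
  then show ?thesis by blast
qed

text \<open>The spectrum of a second-order Taylor polynomial in the block sum: constant, linear and
  quadratic terms.\<close>

definition block_freqs :: "nat \<Rightarrow> nat \<Rightarrow> (int ^ 'd) set" where
  "block_freqs a e = {0} \<union> (\<Union>k\<in>{a..<e}. pow_freq k ` W) \<union>
     {u + v |u v. u \<in> (\<Union>k\<in>{a..<e}. pow_freq k ` W) \<and> v \<in> (\<Union>k\<in>{a..<e}. pow_freq k ` W)}"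

lemma h_upper_W: obtains K where "K \<ge> 0" "\<And>m. m \<in> W \<Longrightarrow> h 0 m \<le> K"
proof (rule that[of "\<Sum>m\<in>W. h 0 m"])
  show "h 0 m \<le> (\<Sum>m\<in>W. h 0 m)" if "m \<in> W" for m
    using that W h_nonneg by (intro member_le_sum) auto
qed (simp add: sum_nonneg h_nonneg)

text \<open>Seen from the end \<open>e\<close>, a frequency created at time \<open>k < e\<close> has
  the \<open>h\<close>-value of its source at index \<open>e - k\<close>, which is at most the value
  at index 0. The bound therefore depends on neither the start nor the length of the block.\<close>

lemma block_freqs_upper:
  obtains K where "K \<ge> 0" "\<And>a e v. v \<in> block_freqs a e \<Longrightarrow> h e v \<le> K"
proof -
  obtain K where K: "K \<ge> 0" "\<And>m. m \<in> W \<Longrightarrow> h 0 m \<le> K" using h_upper_W by blast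
  have single: "h e (pow_freq k m) \<le> K" if "m \<in> W" "k < e" for k e m
  proof -
    have "h e (pow_freq k m) = h (e - k) m" using h_pow_freq[of "e - k" k m] that by simp
    then show ?thesis using h_le_h_0[of "e - k" m] K(2)[OF that(1)] by linarith
  qed
  show ?thesis
  proof (rule that[of "2 * K"])
    fix a e v assume "v \<in> block_freqs a e"
    then consider "v = 0" | k m where "m \<in> W" "k < e" "v = pow_freq k m"
      | k m l m' where "m \<in> W" "k < e" "m' \<in> W" "l < e" "v = pow_freq k m + pow_freq l m'"
      by (auto simp: block_freqs_def)
    then show "h e v \<le> 2 * K"
    proof cases
      case 1
      then show ?thesis using K by (simp add: h_0)
    next
      case 2
      then show ?thesis using single[of m k e] K by simp
    next
      case 3
      then show ?thesis using single[of m k e] single[of m' l e] h_add[of e "pow_freq k m" "pow_freq l m'"] by simp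
    qed
  qed (use K in simp)
qed

lemma finite_positive_lower_bound:
  assumes "finite F" "\<And>m. m \<in> F \<Longrightarrow> m \<noteq> (0 :: int ^ 'd)"
  shows "\<exists>e>0. \<forall>m\<in>F. e \<le> h 0 m"
  using assms
proof (induction F)
  case empty
  show ?case by (intro exI[of _ 1]) simp
next
  case (insert m F)
  then obtain e where e: "e > 0" "\<forall>m\<in>F. e \<le> h 0 m" by auto
  then show ?case using h_0_pos[of m] insert.prems by (intro exI[of _ "min e (h 0 m)"]) auto
qed

text \<open>Pulling out the smaller power writes a pair as \<open>pow_freq l w\<close>. If the
  exponents are close, \<open>w\<close> lies in a finite set of nonzero vectors; if they are far
  apart, the expansion of \<open>m\<close> overwhelms \<open>m'\<close>. The bound is uniform in the
  block length, which makes a constant gap possible.\<close>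

lemma block_freqs_lower:
  obtains e0 where "e0 > 0" "\<And>a e v. v \<in> block_freqs a e \<Longrightarrow> v \<noteq> 0 \<Longrightarrow> e0 \<le> h a v"
proof -
  obtain K where K: "K \<ge> 0" "\<And>m. m \<in> W \<Longrightarrow> h 0 m \<le> K" using h_upper_W by blast
  have "\<exists>e>0. \<forall>m\<in>W. e \<le> h 0 m"
    by (rule finite_positive_lower_bound[OF W(1)]) (use W(2) in metis)
  then obtain e1 where e1: "e1 > 0" "\<forall>m\<in>W. e1 \<le> h 0 m" by (elim exE conjE)
  \<comment> \<open>From lag \<open>T\<close> on, the expanded vector has size at least
    \<open>1 + K\<close>, leaving 1 after subtracting the bound \<open>K\<close> for
    \<open>m'\<close>; this is the 1 in \<open>min 1 e2\<close>.\<close>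
  obtain T where T: "(1 + K) / e1 < \<kappa> ^ T" using real_arch_pow[OF \<kappa>] by blast
  define F where "F = (\<lambda>(i, m, m'). pow_freq i m + m') ` ({..<T} \<times> W \<times> W) - {0}"
  have "finite F" using W(1) by (simp add: F_def)
  then have "\<exists>e>0. \<forall>m\<in>F. e \<le> h 0 m"
    by (rule finite_positive_lower_bound) (simp add: F_def)
  then obtain e2 where e2: "e2 > 0" "\<forall>m\<in>F. e2 \<le> h 0 m" by (elim exE conjE)
  have start: "h 0 w \<le> h a (pow_freq l w)" if "a \<le> l" for a l w
  proof -
    have "h a (pow_freq l w) = h 0 (pow_freq (l - a) w)"
      using h_pow_freq[of 0 a "pow_freq (l - a) w"] that by (simp flip: pow_freq_add)
    then show ?thesis using h_pow_freq_ge'[of 0 w "l - a"] by simp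
  qed
  have pair: "min 1 e2 \<le> h a (pow_freq k m + pow_freq l m')"
    if "m \<in> W" "m' \<in> W" "a \<le> l" "l \<le> k" "pow_freq k m + pow_freq l m' \<noteq> 0" for a k l m m'
  proof -
    define w where "w = pow_freq (k - l) m + m'"
    have w: "pow_freq k m + pow_freq l m' = pow_freq l w"
      using that by (simp add: w_def pow_freq_plus flip: pow_freq_add)
    have w0: "w \<noteq> 0" using that(5) unfolding w pow_freq_eq_0 .
    have "min 1 e2 \<le> h 0 w"
    proof (cases "k - l < T")
      case True
      then have "w \<in> F" using w0 that unfolding F_def w_def by (auto intro!: image_eqI[of _ _ "(k - l, m, m')"])
      then show ?thesis using e2 by auto
    next
      case False
      have "1 + K \<le> \<kappa> ^ T * e1" using T e1(1) by (simp add: field_simps)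
      also have "\<dots> \<le> \<kappa> ^ (k - l) * h 0 m"
        using False \<kappa> e1 that by (intro mult_mono power_increasing) auto
      also have "\<dots> \<le> h 0 (w + (- m'))" using h_pow_freq_ge[of "k - l" 0 m] by (simp add: w_def)
      also have "\<dots> \<le> h 0 w + h 0 m'" using h_add[of 0 w "- m'"] by (simp add: h_minus)
      finally show ?thesis using K(2)[OF that(2)] by simp
    qed
    then show ?thesis using start[OF that(3), of w] w by simp
  qed
  show ?thesis
  proof (rule that[of "min e1 (min 1 e2)"])
    fix a e v assume "v \<in> block_freqs a e" and v0: "v \<noteq> 0"
    then consider k m where "m \<in> W" "a \<le> k" "v = pow_freq k m"
      | k m l m' where "m \<in> W" "a \<le> k" "m' \<in> W" "a \<le> l" "v = pow_freq k m + pow_freq l m'"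
      by (auto simp: block_freqs_def)
    then show "min e1 (min 1 e2) \<le> h a v"
    proof cases
      case 1
      have "e1 \<le> h 0 m" using e1 1 by blast
      then show ?thesis using start[of a k m] 1 by simp
    next
      case 2
      show ?thesis
      proof (cases "l \<le> k")
        case True
        then show ?thesis using pair[of m m' a l k] 2 v0 by simp
      next
        case False
        then show ?thesis using pair[of m' m a k l] 2 v0 by (simp add: add.commute)
      qed
    qed
  qed (use e1 e2 in auto)
qed

text \<open>
  Products over the blocks have frequencies of bounded size seen from the end of the last block,
  hence cannot cancel a nonzero frequency of a later block, which is bounded below as seen from
  its start.
\<close>

lemma block_independence:
  obtains L0 where "\<And>L s J f. L0 \<le> L \<Longrightarrow> 0 < s \<Longrightarrow>
      (\<And>j. trig_on (block_freqs (j * s + L) (Suc j * s)) (f j)) \<Longrightarrow>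
      (\<integral>x. tchar w x * (\<Prod>j<J. f j x) \<partial>torus_haar) = of_bool (w = 0) * (\<Prod>j<J. \<integral>x. f j x \<partial>torus_haar)"
proof -
  obtain K where K: "K \<ge> 0" "\<And>a e v. v \<in> block_freqs a e \<Longrightarrow> h e v \<le> K"
    using block_freqs_upper by blast
  obtain e0 where e0: "e0 > 0" "\<And>a e v. v \<in> block_freqs a e \<Longrightarrow> v \<noteq> 0 \<Longrightarrow> e0 \<le> h a v"
    using block_freqs_lower by blast
  \<comment> \<open>\<open>B\<close> dominates the test frequency \<open>w\<close> and satisfies
    \<open>B / \<kappa> + K \<le> B\<close>: passing one block contracts the old frequencies by at
    least \<kappa> and adds at most \<open>K\<close>.\<close>
  define B where "B = max (h 0 w) (K / (1 - 1 / \<kappa>))"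
  have k1: "1 - 1 / \<kappa> > 0" using \<kappa> by simp
  have B: "h 0 w \<le> B" "K / (1 - 1 / \<kappa>) \<le> B" by (auto simp: B_def)
  have B0: "0 \<le> B" using B(1) h_nonneg[of 0 w] by linarith
  have BK: "B / \<kappa> + K \<le> B" using B(2) k1 \<kappa> by (simp add: field_simps)
  \<comment> \<open>After a gap of \<open>L0\<close> steps the old frequencies lie below the lower
    bound \<open>e0\<close> of any new nonzero one, so they cannot cancel it.\<close>
  obtain L0 where L0: "B / e0 < \<kappa> ^ L0" using real_arch_pow[OF \<kappa>] by blast
  show ?thesis
  proof (rule that[of L0])
    fix L s J f assume L: "L0 \<le> L" and s: "0 < (s :: nat)"
      and f: "\<And>j. trig_on (block_freqs (j * s + L) (Suc j * s)) (f j)"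
    have decay: "\<kappa> ^ i * h (J * s + i) u \<le> B" if "h (J * s) u \<le> B" for i u J
      using h_power[of i "J * s" u] that by linarith
    have trig: "trig_on {u. h (J * s) u \<le> B} (\<lambda>x. tchar w x * (\<Prod>j<J. f j x))" for J
    proof (induction J)
      case 0
      show ?case using B by (simp add: trig_tchar)
    next
      case (Suc J)
      have "trig_on {u. h (Suc J * s) u \<le> B} (\<lambda>x. (tchar w x * (\<Prod>j<J. f j x)) * f J x)"
      proof (rule trig_mono[OF trig_mult[OF f Suc]], safe)
        fix u v assume u: "h (J * s) u \<le> B" and v: "v \<in> block_freqs (J * s + L) (Suc J * s)"
        have "\<kappa> * h (J * s + s) u \<le> \<kappa> ^ s * h (J * s + s) u"
          using \<kappa> s h_nonneg power_increasing[of 1 s \<kappa>] by (intro mult_right_mono) auto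
        also have "\<dots> \<le> B" by (rule decay[OF u])
        finally have "h (J * s + s) u \<le> B / \<kappa>" using \<kappa> by (simp add: field_simps)
        then show "h (Suc J * s) (u + v) \<le> B"
          using h_add[of "Suc J * s" u v] K(2)[OF v] BK by (simp add: add.commute)
      qed
      then show ?case by (simp add: mult_ac)
    qed
    show "(\<integral>x. tchar w x * (\<Prod>j<J. f j x) \<partial>torus_haar) = of_bool (w = 0) * (\<Prod>j<J. \<integral>x. f j x \<partial>torus_haar)"
    proof (induction J)
      case 0
      show ?case by (simp add: integral_tchar)
    next
      case (Suc J)
      have "(\<integral>x. (tchar w x * (\<Prod>j<J. f j x)) * f J x \<partial>torus_haar)
          = (\<integral>x. tchar w x * (\<Prod>j<J. f j x) \<partial>torus_haar) * (\<integral>x. f J x \<partial>torus_haar)"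
      proof (rule trig_independent[OF trig f], rule notI)
        fix u v assume u: "u \<in> {u. h (J * s) u \<le> B}" and v: "v \<in> block_freqs (J * s + L) (Suc J * s)" "v \<noteq> 0"
          and "u + v = 0"
        then have "h (J * s + L) v = h (J * s + L) u" using h_minus[of "J * s + L" u] by (simp add: eq_neg_iff_add_eq_0 add.commute minus_unique)
        then have "e0 \<le> h (J * s + L) u" using e0(2)[OF v] by simp
        then have "\<kappa> ^ L0 * e0 \<le> \<kappa> ^ L * h (J * s + L) u"
          using \<kappa> L e0(1) by (intro mult_mono power_increasing) auto
        also have "\<dots> \<le> B" using u by (intro decay) simp
        finally show False using L0 e0(1) by (simp add: field_simps)
      qed
      then show ?case using Suc by (simp add: mult_ac)
    qed
  qed
qed

end

section \<open>Elementary estimates for characteristic functions\<close>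

lemma norm_iexp_diff_le: "norm (iexp a - iexp b) \<le> \<bar>a - b\<bar>"
proof -
  have "iexp a - iexp b = iexp b * (cis (a - b) - 1)"
    by (simp add: cis_conv_exp algebra_simps flip: exp_add)
  then have "norm (iexp a - iexp b) = norm (cis (a - b) - 1)" by (simp add: norm_mult)
  then show ?thesis using norm_cis_minus_1_le[of "a - b"] by simp
qed

lemma iexp_taylor2: "norm (iexp t - (1 + \<i> * of_real t - of_real (t\<^sup>2 / 2))) \<le> \<bar>t\<bar> ^ 3 / 6"
proof -
  have "(\<Sum>k\<le>2. (\<i> * of_real t) ^ k / fact k) = 1 + \<i> * of_real t - of_real (t\<^sup>2 / 2)"
    by (simp add: numeral_2_eq_2 power_mult_distrib)
  then show ?thesis using iexp_approx1[of t 2] by (simp add: fact_numeral numeral_3_eq_3)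
qed

text \<open>The approximating factors \<open>b j\<close> may slightly exceed 1 in modulus, as Taylor
  polynomials do, so the telescoped errors compound to \<open>(1 + e) ^ J - 1\<close>.\<close>

lemma norm_prod_diff_le:
  fixes a b :: "nat \<Rightarrow> complex"
  assumes "\<And>j. j < J \<Longrightarrow> norm (a j) \<le> 1" "\<And>j. j < J \<Longrightarrow> norm (a j - b j) \<le> e" "0 \<le> e"
  shows "norm ((\<Prod>j<J. a j) - (\<Prod>j<J. b j)) \<le> (1 + e) ^ J - 1"
  using assms(1,2)
proof (induction J)
  case (Suc J)
  have IH: "norm ((\<Prod>j<J. a j) - (\<Prod>j<J. b j)) \<le> (1 + e) ^ J - 1" using Suc by simp
  have "norm (b j) \<le> 1 + e" if "j < J" for j
    using norm_triangle_ineq4[of "a j" "a j - b j"] Suc.prems(1)[of j] Suc.prems(2)[of j] that by simp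
  then have "norm (\<Prod>j<J. b j) \<le> (\<Prod>j<J. 1 + e)"
    unfolding prod_norm[symmetric] by (intro prod_mono) auto
  then have B: "norm (\<Prod>j<J. b j) \<le> (1 + e) ^ J" by simp
  have "(\<Prod>j<Suc J. a j) - (\<Prod>j<Suc J. b j)
      = a J * ((\<Prod>j<J. a j) - (\<Prod>j<J. b j)) + (a J - b J) * (\<Prod>j<J. b j)"
    by (simp add: algebra_simps)
  then have "norm ((\<Prod>j<Suc J. a j) - (\<Prod>j<Suc J. b j))
      \<le> norm (a J) * norm ((\<Prod>j<J. a j) - (\<Prod>j<J. b j)) + norm (a J - b J) * norm (\<Prod>j<J. b j)"
    by (metis norm_mult norm_triangle_ineq)
  also have "\<dots> \<le> 1 * ((1 + e) ^ J - 1) + e * (1 + e) ^ J"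
    using Suc.prems IH B assms(3) by (intro add_mono mult_mono) auto
  finally show ?case by (simp add: algebra_simps)
qed simp

lemma div_ratio_tendsto:
  fixes s :: nat
  assumes "0 < s"
  shows "(\<lambda>n. real (n div s) / real n) \<longlonglongrightarrow> 1 / real s"
proof (rule real_tendsto_sandwich)
  show "\<forall>\<^sub>F n in sequentially. 1 / real s - 1 / real n \<le> real (n div s) / real n"
    using eventually_gt_at_top[of 0]
  proof eventually_elim
    case (elim n)
    have "n < s * (n div s) + s" by (metis assms mult_div_mod_eq mod_less_divisor add_strict_left_mono)
    then have "real n \<le> real s * real (n div s) + real s"
      by (metis less_imp_le of_nat_add of_nat_le_iff of_nat_mult)
    then have "(real n - real s) / (real s * real n) \<le> (real s * real (n div s)) / (real s * real n)"
      by (intro divide_right_mono) auto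
    moreover have "1 / real s - 1 / real n = (real n - real s) / (real s * real n)"
      using elim assms by (simp add: diff_divide_distrib)
    moreover have "(real s * real (n div s)) / (real s * real n) = real (n div s) / real n"
      using assms by simp
    ultimately show ?case by simp
  qed
  show "\<forall>\<^sub>F n in sequentially. real (n div s) / real n \<le> 1 / real s"
    using eventually_gt_at_top[of 0]
  proof eventually_elim
    case (elim n)
    have "real (n div s) \<le> real n / real s" by (rule of_nat_div_le_of_nat)
    then show ?case using elim assms by (simp add: field_simps)
  qed
  have "(\<lambda>n. 1 / real s - 1 / real n) \<longlonglongrightarrow> 1 / real s - 0"
    by (intro tendsto_diff tendsto_const lim_const_over_n)
  then show "(\<lambda>n. 1 / real s - 1 / real n) \<longlonglongrightarrow> 1 / real s" by simp
qed simp

text \<open>\<open>1 - t\<close> and \<open>exp (- t)\<close> agree up to \<open>t\<^sup>2\<close>,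
  and both lie in the unit interval, so taking powers multiplies the error by at most
  \<open>J\<close>.\<close>

lemma power_exp_diff_le:
  fixes t :: real
  assumes "0 \<le> t" "t \<le> 1"
  shows "\<bar>(1 - t) ^ J - exp (- (t * real J))\<bar> \<le> real J * t\<^sup>2"
proof -
  have "exp (- t) \<le> 1 / (1 + t)"
    using exp_ge_add_one_self[of t] assms by (simp add: exp_minus field_simps)
  also have "\<dots> \<le> 1 - t + t\<^sup>2"
    using assms by (simp add: field_simps power2_eq_square)
  finally have "\<bar>(1 - t) - exp (- t)\<bar> \<le> t\<^sup>2"
    using exp_ge_add_one_self[of "- t"] by (simp add: abs_le_iff)
  moreover have "\<bar>(1 - t) ^ J - exp (- t) ^ J\<bar> \<le> real J * \<bar>(1 - t) - exp (- t)\<bar>"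
    using norm_power_diff[of "1 - t" "exp (- t)" J] assms by simp
  moreover have "exp (- t) ^ J = exp (- (t * real J))"
    by (simp add: exp_of_nat_mult[symmetric] mult.commute)
  ultimately show ?thesis
    using mult_left_mono[of "\<bar>(1 - t) - exp (- t)\<bar>" "t\<^sup>2" "real J"] by simp
qed

text \<open>For each parameter \<open>b\<close> the error has a limit in \<open>n\<close>, and these
  limits tend to zero. The parameter will be a block length, a kernel order or an approximation
  level; the value 0 is excluded because the first two must be positive.\<close>

lemma tendsto_of_double_limit:
  fixes X :: "nat \<Rightarrow> complex" and E :: "nat \<Rightarrow> nat \<Rightarrow> real"
  assumes "\<And>b. b > 0 \<Longrightarrow> \<forall>\<^sub>F n in sequentially. norm (X n - x) \<le> E b n"
    and "\<And>b. b > 0 \<Longrightarrow> E b \<longlonglongrightarrow> e b" and "e \<longlonglongrightarrow> 0"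
  shows "X \<longlonglongrightarrow> x"
proof (rule tendstoI)
  fix r :: real assume "r > 0"
  then have "\<forall>\<^sub>F b in sequentially. e b < r" by (rule order_tendstoD(2)[OF assms(3)])
  then have "\<forall>\<^sub>F b in sequentially. e b < r \<and> b > 0" using eventually_gt_at_top by (rule eventually_conj)
  then obtain b where b: "e b < r" "b > 0" by (auto dest: eventually_happens)
  have "\<forall>\<^sub>F n in sequentially. E b n < r" by (rule order_tendstoD(2)[OF assms(2)[OF b(2)] b(1)])
  then show "\<forall>\<^sub>F n in sequentially. dist (X n) x < r"
    using assms(1)[OF b(2)] by eventually_elim (simp add: dist_norm)
qed

lemma integral_norm_diff_le:
  fixes f g :: "'d::finite torus \<Rightarrow> complex"
  assumes f: "integrable torus_haar f" and g: "integrable torus_haar g" and k: "integrable torus_haar k"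
    and le: "\<And>x. norm (f x - g x) \<le> k x"
  shows "norm ((\<integral>x. f x \<partial>torus_haar) - (\<integral>x. g x \<partial>torus_haar)) \<le> (\<integral>x. k x \<partial>torus_haar)"
proof -
  have "(\<integral>x. f x \<partial>torus_haar) - (\<integral>x. g x \<partial>torus_haar) = (\<integral>x. f x - g x \<partial>torus_haar)"
    by (simp add: f g)
  also have "norm \<dots> \<le> (\<integral>x. norm (f x - g x) \<partial>torus_haar)" by (rule integral_norm_bound)
  also have "\<dots> \<le> (\<integral>x. k x \<partial>torus_haar)"
    using f g k le by (intro integral_mono) auto
  finally show ?thesis .
qed

context trig_observable
begin

lemma integrable_tchar_iexp:
  assumes "bounded_meas f"
  shows "integrable torus_haar (\<lambda>x. tchar w x * iexp (f x))"
proof (rule integrable_torus_bounded)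
  have [measurable]: "f \<in> borel_measurable borel" by (rule bounded_meas_measurable[OF assms])
  show "(\<lambda>x. tchar w x * iexp (f x)) \<in> borel_measurable borel" by measurable
  show "norm (tchar w x * iexp (f x)) \<le> 1" for x by (simp add: norm_mult)
qed

text \<open>Unlike the exponential it is a trigonometric polynomial with explicitly bounded
  spectrum, which is what lets the block factors be exactly independent.\<close>

definition taylor_factor :: "real \<Rightarrow> nat set \<Rightarrow> 'd torus \<Rightarrow> complex" where
  "taylor_factor z I x = 1 + \<i> * of_real (z * psum I x) - of_real ((z * psum I x)\<^sup>2 / 2)"

lemma taylor_factor_trig: "trig_on (block_freqs a e) (taylor_factor z {a..<e})"
proof -
  have "tchar (0 :: int ^ 'd) = (\<lambda>x. 1)" by (simp add: fun_eq_iff)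
  then have 1: "trig_on (block_freqs a e) (\<lambda>x. 1)"
    using trig_tchar[of 0 "block_freqs a e"] by (simp add: block_freqs_def)
  have 2: "trig_on (block_freqs a e) (\<lambda>x. complex_of_real (psum {a..<e} x))"
    by (rule trig_mono[OF psum_trig]) (auto simp: block_freqs_def)
  have 3: "trig_on (block_freqs a e) (\<lambda>x. complex_of_real ((psum {a..<e} x)\<^sup>2))"
    by (rule trig_mono[OF psum_sq_trig]) (unfold block_freqs_def, blast)
  have eq: "taylor_factor z {a..<e} = (\<lambda>x. (1 + (\<i> * of_real z) * complex_of_real (psum {a..<e} x))
      + (- of_real (z\<^sup>2 / 2)) * complex_of_real ((psum {a..<e} x)\<^sup>2))"
    by (simp add: taylor_factor_def fun_eq_iff power_mult_distrib)
  show ?thesis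
    unfolding eq by (rule trig_add[OF trig_cmult[OF 3] trig_add[OF trig_cmult[OF 2] 1]])
qed

lemma taylor_factor_integral:
  "(\<integral>x. taylor_factor z {a..<a + n} x \<partial>torus_haar) = of_real (1 - z\<^sup>2 * var n / 2)"
proof -
  have int: "integrable torus_haar (\<lambda>x. psum {a..<a + n} x)" "integrable torus_haar (\<lambda>x. (psum {a..<a + n} x)\<^sup>2)"
    by (intro bounded_meas_integrable bounded_meas_power2 psum_bounded_meas)+
  have "(\<integral>x. taylor_factor z {a..<a + n} x \<partial>torus_haar)
      = (\<integral>x. (1 + (\<i> * of_real z) * complex_of_real (psum {a..<a + n} x))
        - of_real (z\<^sup>2 / 2) * complex_of_real ((psum {a..<a + n} x)\<^sup>2) \<partial>torus_haar)"
    by (simp add: taylor_factor_def power_mult_distrib mult.assoc)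
  also have "\<dots> = (1 + (\<i> * of_real z) * (\<integral>x. complex_of_real (psum {a..<a + n} x) \<partial>torus_haar))
        - of_real (z\<^sup>2 / 2) * (\<integral>x. complex_of_real ((psum {a..<a + n} x)\<^sup>2) \<partial>torus_haar)"
    using integrable_of_real[OF int(1), where 'a = complex] integrable_of_real[OF int(2), where 'a = complex]
    by (subst Bochner_Integration.integral_diff, simp, simp, subst Bochner_Integration.integral_add) auto
  also have "(\<integral>x. complex_of_real (psum {a..<a + n} x) \<partial>torus_haar) = 0"
    by (simp add: psum_mean)
  also have "(\<integral>x. complex_of_real ((psum {a..<a + n} x)\<^sup>2) \<partial>torus_haar) = of_real (var n)"
    using var_shift[of a n] by (simp del: of_real_power)
  finally show ?thesis by simp
qed

text \<open>
  Bernstein blocks of length \<open>b\<close> separated by gaps of constant length \<open>L\<close>: the second-order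
  Taylor polynomials of the block factors are exactly independent.
\<close>

lemma clt_trig:
  assumes v: "(\<lambda>n. var n / real n) \<longlonglongrightarrow> v"
  shows "(\<lambda>n. \<integral>x. tchar w x * iexp (u * psum {..<n} x / sqrt (real n)) \<partial>torus_haar)
    \<longlonglongrightarrow> of_bool (w = 0) * of_real (exp (- (u\<^sup>2 * v / 2)))"
proof -
  obtain L where L: "\<And>L' s J f. L \<le> L' \<Longrightarrow> 0 < s \<Longrightarrow>
      (\<And>j. trig_on (block_freqs (j * s + L') (Suc j * s)) (f j)) \<Longrightarrow>
      (\<integral>x. tchar w x * (\<Prod>j<J. f j x) \<partial>torus_haar) = of_bool (w = 0) * (\<Prod>j<J. \<integral>x. f j x \<partial>torus_haar)"
  proof (rule block_independence[of w])
    fix L assume *: "\<And>L' s J f. L \<le> L' \<Longrightarrow> 0 < s \<Longrightarrow>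
      (\<And>j. trig_on (block_freqs (j * s + L') (Suc j * s)) (f j)) \<Longrightarrow>
      (\<integral>x. tchar w x * (\<Prod>j<J. f j x) \<partial>torus_haar) = of_bool (w = 0) * (\<Prod>j<J. \<integral>x. f j x \<partial>torus_haar)"
    show thesis by (rule that[of L]) (rule *; assumption)
  qed
  obtain K where K: "K \<ge> 0" "\<And>I. finite I \<Longrightarrow> l2norm (psum I) \<le> K * sqrt (real (card I))"
    by (rule l2norm_psum) (rule that)
  define X where "X n = (\<integral>x. tchar w x * iexp (u * psum {..<n} x / sqrt (real n)) \<partial>torus_haar)" for n
  define G where "G = exp (- (u\<^sup>2 * v / 2))"
  define \<rho> where "\<rho> b n = real (n div (b + L)) / real n" for b n
  \<comment> \<open>The three lines are the sites outside the blocks, the Taylor error, and the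
    distance of the resulting power from the Gaussian value. \<open>e\<close> is the limit of
    \<open>E\<close> in \<open>n\<close>, written so that the limit rules match it
    literally.\<close>
  define E where "E b n = \<bar>u\<bar> * K * sqrt (1 - \<rho> b n * real b)
      + (exp (\<rho> b n * ((\<bar>u\<bar> * real b * M) ^ 3 / 6) * (1 / sqrt (real n))) - 1)
      + (\<rho> b n * (u\<^sup>2 * var b / 2)\<^sup>2 * (1 / real n) + \<bar>exp (- (u\<^sup>2 * var b / 2 * \<rho> b n)) - G\<bar>)" for b n
  define e where "e b = \<bar>u\<bar> * K * sqrt (1 - 1 / real (b + L) * real b)
      + (exp (1 / real (b + L) * ((\<bar>u\<bar> * real b * M) ^ 3 / 6) * 0) - 1)
      + (1 / real (b + L) * (u\<^sup>2 * var b / 2)\<^sup>2 * 0 + \<bar>exp (- (u\<^sup>2 * var b / 2 * (1 / real (b + L)))) - G\<bar>)" for b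
  have var_nonneg: "0 \<le> var b" for b by (simp add: var_def)
  have "X \<longlonglongrightarrow> of_bool (w = 0) * of_real G"
  proof (rule tendsto_of_double_limit)
    fix b :: nat assume b: "b > 0"
    define s where "s = b + L"
    have s: "s > 0" using b by (simp add: s_def)
    have rt: "\<rho> b \<longlonglongrightarrow> 1 / real (b + L)"
      unfolding \<rho>_def using div_ratio_tendsto[OF s] by (simp add: s_def)
    have n0: "(\<lambda>n. 1 / real n) \<longlonglongrightarrow> 0" by (rule lim_const_over_n)
    have sq0: "(\<lambda>n. 1 / sqrt (real n)) \<longlonglongrightarrow> 0"
      using tendsto_real_sqrt[OF n0] by (simp add: real_sqrt_divide)
    show "E b \<longlonglongrightarrow> e b" unfolding E_def e_def
      by (intro tendsto_intros rt n0 sq0)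
    have "\<forall>\<^sub>F n in sequentially. u\<^sup>2 * var b / 2 * (1 / real n) < 1"
      using tendsto_mult_right_zero[OF n0, of "u\<^sup>2 * var b / 2"] by (rule order_tendstoD) simp
    then show "\<forall>\<^sub>F n in sequentially. norm (X n - of_bool (w = 0) * of_real G) \<le> E b n"
      using eventually_gt_at_top[of 0]
    proof eventually_elim
      case (elim n)
      define z where "z = u / sqrt (real n)"
      define J where "J = n div s"
      have Jn: "J * s \<le> n" by (simp add: J_def)
      have r: "\<rho> b n = real J / real n" by (simp add: \<rho>_def J_def s_def)
      \<comment> \<open>The variance term of one block; it is at most 1 for large \<open>n\<close>,
        as \<open>power_exp_diff_le\<close> demands.\<close>
      define t where "t = z\<^sup>2 * var b / 2"
      have z2: "z\<^sup>2 = u\<^sup>2 / real n" by (simp add: z_def power_divide)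
      have t: "t = u\<^sup>2 * var b / 2 * (1 / real n)" "0 \<le> t" "t \<le> 1"
        using elim var_nonneg[of b] by (auto simp: t_def z2)
      define blk where "blk j = {j * s + L..<Suc j * s}" for j
      have blk_eq: "blk j = {j * s + L..<(j * s + L) + b}" for j
      proof -
        have "Suc j * s = j * s + s" by simp
        then have "Suc j * s = (j * s + L) + b" using s_def by linarith
        then show ?thesis unfolding blk_def by (simp only:)
      qed
      have cardblk: "card (blk j) = b" for j by (simp add: blk_eq)
      have disj: "disjoint_family blk"
        unfolding disjoint_family_on_def
      proof (intro ballI impI)
        have lt: "blk i \<inter> blk j = {}" if "i < j" for i j
        proof -
          have "Suc i * s \<le> j * s" using that by (intro mult_right_mono) auto
          then show ?thesis by (auto simp: blk_def)
        qed
        fix i j :: nat assume "i \<noteq> j"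
        then show "blk i \<inter> blk j = {}" using lt[of i j] lt[of j i] by (cases "i < j") auto
      qed
      define U where "U = (\<Union>j<J. blk j)"
      have Usub: "U \<subseteq> {..<n}"
      proof
        fix k assume "k \<in> U"
        then obtain j where j: "j < J" "k < Suc j * s" by (auto simp: U_def blk_def)
        have "Suc j * s \<le> J * s" using j by (intro mult_right_mono) auto
        then show "k \<in> {..<n}" using j Jn by simp
      qed
      have finU: "finite U" using Usub finite_subset by blast
      have cardU: "card U = J * b"
        unfolding U_def using disj by (subst card_UN_disjoint) (auto simp: disjoint_family_on_def cardblk, auto simp: blk_def)
      have psumU: "psum U x = (\<Sum>j<J. psum (blk j) x)" for x
        unfolding psum_def U_def using disj
        by (intro sum.UNION_disjoint) (auto simp: disjoint_family_on_def blk_def)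
      have split: "psum {..<n} x = psum ({..<n} - U) x + psum U x" for x
        unfolding psum_def by (rule sum.subset_diff[OF Usub]) simp
      have bm: "bounded_meas (\<lambda>x. z * psum I x)" for I by (intro bounded_meas_cmult psum_bounded_meas)
      \<comment> \<open>\<open>X1\<close> drops the gaps and the incomplete last block,
        \<open>X2\<close> replaces the block exponentials by their Taylor factors.\<close>
      define X1 where "X1 = (\<integral>x. tchar w x * iexp (z * psum U x) \<partial>torus_haar)"
      define X2 where "X2 = (\<integral>x. tchar w x * (\<Prod>j<J. taylor_factor z (blk j) x) \<partial>torus_haar)"
      have XX: "X n = (\<integral>x. tchar w x * iexp (z * psum {..<n} x) \<partial>torus_haar)"
        by (simp add: X_def z_def)
      have "norm (X n - X1) \<le> (\<integral>x. \<bar>z\<bar> * \<bar>psum ({..<n} - U) x\<bar> \<partial>torus_haar)"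
        unfolding XX X1_def
      proof (rule integral_norm_diff_le)
        show "integrable torus_haar (\<lambda>x. \<bar>z\<bar> * \<bar>psum ({..<n} - U) x\<bar>)"
          by (intro integrable_mult_right integrable_abs bounded_meas_integrable psum_bounded_meas)
        show "norm (tchar w x * iexp (z * psum {..<n} x) - tchar w x * iexp (z * psum U x))
            \<le> \<bar>z\<bar> * \<bar>psum ({..<n} - U) x\<bar>" for x
        proof -
          have "norm (tchar w x * iexp (z * psum {..<n} x) - tchar w x * iexp (z * psum U x))
              = norm (iexp (z * psum {..<n} x) - iexp (z * psum U x))"
            unfolding right_diff_distrib[symmetric] norm_mult by simp
          also have "\<dots> \<le> \<bar>z * psum {..<n} x - z * psum U x\<bar>" by (rule norm_iexp_diff_le)
          also have "\<dots> = \<bar>z\<bar> * \<bar>psum ({..<n} - U) x\<bar>"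
            unfolding split[of x] by (simp add: abs_mult distrib_left)
          finally show ?thesis .
        qed
      qed (rule integrable_tchar_iexp[OF bm])+
      also have "\<dots> = \<bar>z\<bar> * (\<integral>x. \<bar>psum ({..<n} - U) x\<bar> \<partial>torus_haar)" by simp
      also have "\<dots> \<le> \<bar>z\<bar> * (K * sqrt (real (card ({..<n} - U))))"
        using integral_abs_le_l2norm[OF psum_bounded_meas, of "{..<n} - U"] K(2)[of "{..<n} - U"]
        by (intro mult_left_mono) auto
      also have "card ({..<n} - U) = n - J * b"
        using Usub finU by (simp add: card_Diff_subset cardU)
      also have "\<bar>z\<bar> * (K * sqrt (real (n - J * b))) = \<bar>u\<bar> * K * sqrt (1 - \<rho> b n * real b)"
      proof -
        have "J * b \<le> n" using card_mono[OF _ Usub] cardU by simp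
        then have "1 - \<rho> b n * real b = real (n - J * b) / real n"
          using elim by (simp add: r of_nat_diff diff_divide_distrib)
        then show ?thesis by (simp add: z_def real_sqrt_divide)
      qed
      finally have A: "norm (X n - X1) \<le> \<bar>u\<bar> * K * sqrt (1 - \<rho> b n * real b)" .
      define \<epsilon> where "\<epsilon> = (\<bar>z\<bar> * (real b * M)) ^ 3 / 6"
      have \<epsilon>0: "0 \<le> \<epsilon>" using M_nonneg by (simp add: \<epsilon>_def)
      have tf: "trig_on (block_freqs (j * s + L) (Suc j * s)) (taylor_factor z (blk j))" for j
        unfolding blk_def by (rule taylor_factor_trig)
      have pt: "norm (tchar w x * iexp (z * psum U x) - tchar w x * (\<Prod>j<J. taylor_factor z (blk j) x)) \<le> (1 + \<epsilon>) ^ J - 1" for x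
      proof -
        have "iexp (z * psum U x) = (\<Prod>j<J. iexp (z * psum (blk j) x))"
          by (simp add: psumU sum_distrib_left exp_sum)
        then have "norm (tchar w x * iexp (z * psum U x) - tchar w x * (\<Prod>j<J. taylor_factor z (blk j) x))
            = norm ((\<Prod>j<J. iexp (z * psum (blk j) x)) - (\<Prod>j<J. taylor_factor z (blk j) x))"
          by (simp only: right_diff_distrib[symmetric] norm_mult norm_tchar mult_1)
        also have "\<dots> \<le> (1 + \<epsilon>) ^ J - 1"
        proof (rule norm_prod_diff_le[OF _ _ \<epsilon>0])
          fix j
          show "norm (iexp (z * psum (blk j) x)) \<le> 1" by simp
          have "norm (iexp (z * psum (blk j) x) - taylor_factor z (blk j) x) \<le> \<bar>z * psum (blk j) x\<bar> ^ 3 / 6"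
            unfolding taylor_factor_def by (rule iexp_taylor2)
          also have "\<dots> \<le> \<epsilon>" unfolding \<epsilon>_def abs_mult
            using psum_bound[of "blk j" x] by (intro divide_right_mono power_mono mult_left_mono) (auto simp: cardblk)
          finally show "norm (iexp (z * psum (blk j) x) - taylor_factor z (blk j) x) \<le> \<epsilon>" .
        qed
        finally show ?thesis .
      qed
      have tprod: "\<exists>V. trig_on V (\<lambda>x. tchar w x * (\<Prod>j<J'. taylor_factor z (blk j) x))" for J'
      proof (induction J')
        case 0
        show ?case using trig_tchar[of w UNIV] by auto
      next
        case (Suc J')
        then obtain V where "trig_on V (\<lambda>x. tchar w x * (\<Prod>j<J'. taylor_factor z (blk j) x))" ..
        from trig_mult[OF tf[of J'] this] show ?case by (auto simp: mult_ac)
      qed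
      have "norm (X1 - X2) \<le> (\<integral>x. (1 + \<epsilon>) ^ J - 1 \<partial>(torus_haar :: 'd torus measure))"
        unfolding X1_def X2_def
      proof (rule integral_norm_diff_le[OF integrable_tchar_iexp[OF bm] _ _ pt])
        show "integrable torus_haar (\<lambda>x. tchar w x * (\<Prod>j<J. taylor_factor z (blk j) x))"
          using tprod[of J] trig_integrable by (elim exE)
      qed simp
      also have "\<dots> = (1 + \<epsilon>) ^ J - 1" by simp
      also have "\<dots> \<le> exp (real J * \<epsilon>) - 1"
      proof -
        have "(1 + \<epsilon>) ^ J \<le> exp \<epsilon> ^ J" using \<epsilon>0 by (intro power_mono exp_ge_add_one_self) auto
        then show ?thesis by (simp add: exp_of_nat_mult)
      qed
      also have "real J * \<epsilon> = \<rho> b n * ((\<bar>u\<bar> * real b * M) ^ 3 / 6) * (1 / sqrt (real n))"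
      proof -
        have "sqrt (real n) ^ 3 = real n * sqrt (real n)"
          by (simp add: power3_eq_cube)
        moreover have "\<bar>z\<bar> = \<bar>u\<bar> / sqrt (real n)" by (simp add: z_def)
        ultimately show ?thesis by (simp add: \<epsilon>_def r power_mult_distrib power_divide)
      qed
      finally have B: "norm (X1 - X2) \<le> exp (\<rho> b n * ((\<bar>u\<bar> * real b * M) ^ 3 / 6) * (1 / sqrt (real n))) - 1" .
      have "X2 = of_bool (w = 0) * (\<Prod>j<J. \<integral>x. taylor_factor z (blk j) x \<partial>torus_haar)"
        unfolding X2_def by (rule L[OF order_refl s tf])
      also have "\<dots> = of_bool (w = 0) * of_real ((1 - t) ^ J)"
        by (simp add: blk_eq taylor_factor_integral t_def)
      finally have "X2 - of_bool (w = 0) * of_real G = of_bool (w = 0) * of_real ((1 - t) ^ J - G)"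
        by (simp add: algebra_simps)
      then have "norm (X2 - of_bool (w = 0) * of_real G) \<le> \<bar>(1 - t) ^ J - G\<bar>"
        by (simp only: norm_mult norm_of_real) auto
      also have "\<dots> \<le> \<bar>(1 - t) ^ J - exp (- (t * real J))\<bar> + \<bar>exp (- (t * real J)) - G\<bar>" by linarith
      also have "\<dots> \<le> real J * t\<^sup>2 + \<bar>exp (- (t * real J)) - G\<bar>"
        using power_exp_diff_le[OF t(2,3), of J] by linarith
      also have "real J * t\<^sup>2 = \<rho> b n * (u\<^sup>2 * var b / 2)\<^sup>2 * (1 / real n)"
        by (simp add: t(1) r power2_eq_square)
      also have "t * real J = u\<^sup>2 * var b / 2 * \<rho> b n"
        by (simp add: t(1) r)
      finally have C: "norm (X2 - of_bool (w = 0) * of_real G)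
          \<le> \<rho> b n * (u\<^sup>2 * var b / 2)\<^sup>2 * (1 / real n) + \<bar>exp (- (u\<^sup>2 * var b / 2 * \<rho> b n)) - G\<bar>" .
      have "norm (X n - of_bool (w = 0) * of_real G)
          \<le> norm (X n - X1) + norm (X1 - X2) + norm (X2 - of_bool (w = 0) * of_real G)"
        using norm_triangle_ineq[of "X n - X1" "X1 - X2"]
          norm_triangle_ineq[of "X n - X2" "X2 - of_bool (w = 0) * of_real G"] by simp
      then show ?case using A B C unfolding E_def by linarith
    qed
  next
    \<comment> \<open>As \<open>b\<close> grows with \<open>L\<close> fixed, the gaps take a
      vanishing share of the time, so the variance per step tends to \<open>v\<close>.\<close>
    have bs: "(\<lambda>b. real b / real (b + L)) \<longlonglongrightarrow> 1"
    proof -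
      have "(\<lambda>b. inverse (1 + real L / real b)) \<longlonglongrightarrow> inverse (1 + 0)"
        by (intro tendsto_intros lim_const_over_n) simp
      moreover have "\<forall>\<^sub>F b in sequentially. inverse (1 + real L / real b) = real b / real (b + L)"
        using eventually_gt_at_top[of 0] by eventually_elim (simp add: field_simps)
      ultimately show ?thesis by (simp add: Lim_transform_eventually)
    qed
    have vb: "(\<lambda>b. var b / real b * (real b / real (b + L))) \<longlonglongrightarrow> v * 1"
      by (intro tendsto_mult v bs)
    have "(\<lambda>b. \<bar>u\<bar> * K * sqrt (1 - real b / real (b + L))
        + \<bar>exp (- (u\<^sup>2 / 2 * (var b / real b * (real b / real (b + L))))) - G\<bar>)
        \<longlonglongrightarrow> \<bar>u\<bar> * K * sqrt (1 - 1) + \<bar>exp (- (u\<^sup>2 / 2 * (v * 1))) - G\<bar>"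
      by (intro tendsto_intros bs vb)
    moreover have "\<forall>\<^sub>F b in sequentially. \<bar>u\<bar> * K * sqrt (1 - real b / real (b + L))
        + \<bar>exp (- (u\<^sup>2 / 2 * (var b / real b * (real b / real (b + L))))) - G\<bar> = e b"
      using eventually_gt_at_top[of 0] by eventually_elim (simp add: e_def)
    ultimately have "e \<longlonglongrightarrow> \<bar>u\<bar> * K * sqrt (1 - 1) + \<bar>exp (- (u\<^sup>2 / 2 * (v * 1))) - G\<bar>"
      by (rule Lim_transform_eventually)
    then show "e \<longlonglongrightarrow> 0" by (simp add: G_def)
  qed
  then show ?thesis by (simp only: X_def[abs_def] G_def)
qed

end

section \<open>Restriction to the graph of an endomorphism\<close>

text \<open>An integer matrix maps lattice points to lattice points, so a lattice point near
  \<open>x' - x\<close> gives one near its image. The hypotheses are object-level implications so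
  that \<open>transfer\<close> acts on the whole claim.\<close>

lemma torus_mult_lipschitz:
  "0 < K \<longrightarrow> (\<forall>v. norm (map_matrix real_of_int M *v v) \<le> norm v * K) \<longrightarrow>
    dist (torus_mult M x') (torus_mult M x) \<le> K * dist x' x"
proof (transfer, intro impI)
  fix K :: real and M :: "int ^ 'd ^ 'd" and x' x :: "real ^ 'd"
  assume K: "0 < K" "\<forall>v. norm (map_matrix real_of_int M *v v) \<le> norm v * K"
  have "infdist (map_matrix real_of_int M *v x' - map_matrix real_of_int M *v x) int_lattice / K
      \<le> (INF a\<in>int_lattice. dist (x' - x) a)"
  proof (rule cINF_greatest)
    fix a :: "real ^ 'd" assume a: "a \<in> int_lattice"
    have "infdist (map_matrix real_of_int M *v x' - map_matrix real_of_int M *v x) int_lattice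
        \<le> dist (map_matrix real_of_int M *v x' - map_matrix real_of_int M *v x) (map_matrix of_int M *v a)"
      by (rule infdist_le[OF int_matrix_int_lattice[OF a]])
    also have "\<dots> = norm (map_matrix real_of_int M *v (x' - x - a))"
      by (simp add: dist_norm matrix_vector_mult_diff_distrib)
    also have "\<dots> \<le> norm (x' - x - a) * K" using K(2) by blast
    finally show "infdist (map_matrix real_of_int M *v x' - map_matrix real_of_int M *v x) int_lattice / K \<le> dist (x' - x) a"
      using K(1) by (simp add: dist_norm pos_divide_le_eq)
  qed (use int_lattice_zero in auto)
  also have "\<dots> = infdist (x' - x) int_lattice"
    using int_lattice_zero by (subst infdist_notempty) auto
  finally show "infdist (map_matrix real_of_int M *v x' - map_matrix real_of_int M *v x) int_lattice
      \<le> K * infdist (x' - x) int_lattice"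
    using K(1) by (simp add: pos_divide_le_eq mult.commute)
qed

lemma continuous_torus_mult: "continuous_on UNIV (torus_mult M :: 'd::finite torus \<Rightarrow> 'd torus)"
proof (rule continuous_onI)
  fix x :: "'d torus" and e :: real assume e: "e > 0"
  have bl: "bounded_linear (\<lambda>v. map_matrix real_of_int M *v v)" by (rule matrix_vector_mul_bounded_linear)
  obtain K where K: "K > 0" "\<forall>v. norm (map_matrix real_of_int M *v v) \<le> norm v * K"
    using bounded_linear.pos_bounded[OF bl] by (elim exE conjE)
  have le: "dist (torus_mult M x') (torus_mult M x) \<le> K * dist x' x" for x'
    using torus_mult_lipschitz K by blast
  show "\<exists>d>0. \<forall>x'\<in>UNIV. dist x' x < d \<longrightarrow> dist (torus_mult M x') (torus_mult M x) \<le> e"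
  proof (intro exI[of _ "e / K"] conjI ballI impI)
    fix x' :: "'d torus" assume "dist x' x < e / K"
    then have "K * dist x' x \<le> e" using K(1) by (simp add: field_simps)
    then show "dist (torus_mult M x') (torus_mult M x) \<le> e" using le[of x'] by linarith
  qed (use e K in auto)
qed

lemma torus_mult_measurable: "torus_mult M \<in> borel_measurable borel"
  by (rule borel_measurable_continuous_onI[OF continuous_torus_mult])

context toral_automorphism
begin

text \<open>A repetition would make \<open>h 0\<close> return to an earlier value along the orbit,
  against strict expansion.\<close>

lemma pow_freq_inj:
  assumes "pow_freq k m = pow_freq l m" "m \<noteq> 0"
  shows "k = l"
proof -
  have less: False if "pow_freq k m = pow_freq l m" "l < k" for k l
  proof -
    have "pow_freq k m = pow_freq l (pow_freq (k - l) m)" using that by (simp flip: pow_freq_add)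
    then have "h l (pow_freq l (pow_freq (k - l) m)) = h l (pow_freq l m)" using that by simp
    then have "h 0 (pow_freq (k - l) m) = h 0 m"
      using h_pow_freq[of 0 l "pow_freq (k - l) m"] h_pow_freq[of 0 l m] by simp
    then have "\<kappa> ^ (k - l) * h 0 m \<le> 1 * h 0 m" using h_pow_freq_ge[of "k - l" 0 m] by simp
    then have "\<kappa> ^ (k - l) \<le> 1" using h_0_pos[OF assms(2)] by simp
    then show False using one_less_power[OF \<kappa>, of "k - l"] that by simp
  qed
  show ?thesis using less[OF assms(1)] less[OF assms(1)[symmetric]] by (meson linorder_neqE_nat)
qed

definition exp_sum :: "int ^ 'd \<Rightarrow> nat \<Rightarrow> 'd torus \<Rightarrow> complex" where
  "exp_sum m n x = (\<Sum>k<n. tchar (pow_freq k m) x)"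

lemma exp_sum_bounded_meas: "bounded_meas (\<lambda>x. norm (exp_sum m n x))"
proof (rule bounded_measI)
  show "(\<lambda>x. norm (exp_sum m n x)) \<in> borel_measurable borel" unfolding exp_sum_def by measurable
  show "\<bar>norm (exp_sum m n x)\<bar> \<le> real n" for x
    unfolding exp_sum_def abs_norm_cancel by (rule order_trans[OF norm_sum]) simp
qed

text \<open>The frequencies are distinct by \<open>pow_freq_inj\<close>, so the square norm is
  exactly \<open>sqrt (real n)\<close>, and it dominates the mean of the modulus.\<close>

lemma integral_norm_exp_sum:
  assumes "m \<noteq> 0"
  shows "(\<integral>x. norm (exp_sum m n x) \<partial>torus_haar) \<le> sqrt (real n)"
proof -
  have "complex_of_real (\<integral>x. (norm (exp_sum m n x))\<^sup>2 \<partial>torus_haar)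
      = (\<integral>x. complex_of_real ((norm (exp_sum m n x))\<^sup>2) \<partial>torus_haar)"
    by (simp del: of_real_power)
  also have "\<dots> = (\<integral>x. (\<Sum>k<n. \<Sum>l<n. tchar (pow_freq k m - pow_freq l m) x) \<partial>torus_haar)"
    unfolding complex_norm_square exp_sum_def
    by (simp add: sum_product tchar_diff_freq)
  also have "\<dots> = (\<Sum>k<n. \<Sum>l<n. of_bool (pow_freq k m - pow_freq l m = 0))"
    by (simp add: integral_tchar integrable_tchar)
  also have "\<dots> = (\<Sum>k<n. \<Sum>l<n. if l = k then 1 else 0)"
    using pow_freq_inj[OF _ assms] by (intro sum.cong refl) auto
  also have "\<dots> = of_real (real n)" by simp
  finally have "(\<integral>x. (norm (exp_sum m n x))\<^sup>2 \<partial>torus_haar) = real n" by (simp only: of_real_eq_iff)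
  then show ?thesis
    using integral_abs_le_l2norm[OF exp_sum_bounded_meas[of m n]] by (simp add: l2norm_def)
qed

definition orbit_sum :: "('d torus \<Rightarrow> real) \<Rightarrow> nat \<Rightarrow> 'd torus \<Rightarrow> 'd torus \<Rightarrow> real" where
  "orbit_sum f n x y = (\<Sum>k<n. f (orbit_point 0 y k x))"

lemma orbit_point_twist: "orbit_point E 0 k x = orbit_point 0 (torus_mult E x) k x"
  by (simp add: orbit_point_def torus_mult_0)

lemma tchar_orbit_point_0: "tchar m (orbit_point 0 y k x) = tchar m y * tchar (pow_freq k m) x"
proof -
  have "transpose (0 :: int ^ 'd ^ 'd) = 0" by (simp add: transpose_def vec_eq_iff)
  then show ?thesis by (simp add: tchar_orbit_point)
qed

lemma orbit_sum_trig:
  assumes "\<forall>x. complex_of_real (p x) = (\<Sum>m\<in>F. a m * tchar m x)"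
  shows "complex_of_real (orbit_sum p n x y) = (\<Sum>m\<in>F. a m * tchar m y * exp_sum m n x)"
proof -
  have "complex_of_real (orbit_sum p n x y) = (\<Sum>k<n. \<Sum>m\<in>F. a m * (tchar m y * tchar (pow_freq k m) x))"
    by (simp add: orbit_sum_def assms tchar_orbit_point_0)
  also have "\<dots> = (\<Sum>m\<in>F. \<Sum>k<n. a m * (tchar m y * tchar (pow_freq k m) x))" by (rule sum.swap)
  finally show ?thesis by (simp add: exp_sum_def sum_distrib_left mult.assoc)
qed

text \<open>
  Smoothing in \<open>y\<close> with a Fejer kernel turns the restriction of the two-variable function to
  the graph \<open>y = E x\<close> into finitely many integrals of \<open>tchar w x\<close> against it with \<open>y\<close> fixed, and
  only the frequency \<open>w = 0\<close> survives in the limit.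
\<close>

lemma twisted_clt_trig:
  fixes p :: "'d torus \<Rightarrow> real" and E :: "int ^ 'd ^ 'd"
  assumes W: "finite W" "0 \<notin> W" and p: "trig_on W (\<lambda>x. complex_of_real (p x))"
    and E: "\<And>m. transpose E *v m = 0 \<Longrightarrow> m = 0"
    and v: "\<And>y. (\<lambda>n. (\<integral>x. (orbit_sum p n x y)\<^sup>2 \<partial>torus_haar) / real n) \<longlonglongrightarrow> v y"
  shows "(\<lambda>n. \<integral>x. iexp (u * orbit_sum p n x (torus_mult E x) / sqrt (real n)) \<partial>torus_haar)
    \<longlonglongrightarrow> (\<integral>y. complex_of_real (exp (- (u\<^sup>2 * v y / 2))) \<partial>torus_haar)"
proof -
  obtain F a where F: "finite F" "F \<subseteq> W" "\<forall>x. complex_of_real (p x) = (\<Sum>m\<in>F. a m * tchar m x)"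
    using trig_explicit[OF p] by (elim exE conjE)
  note osum = orbit_sum_trig[OF F(3)]
  define \<beta> where "\<beta> = (\<lambda>x. torus_mult E x)"
  define Fn where "Fn n x y = iexp (u * orbit_sum p n x y / sqrt (real n))" for n x y
  have Re_osum: "orbit_sum p n x y = Re (\<Sum>m\<in>F. a m * tchar m y * exp_sum m n x)" for n x y
    unfolding osum[symmetric] by simp
  have Fn_meas: "(\<lambda>z. Fn n (fst z) (snd z)) \<in> borel_measurable (torus_haar \<Otimes>\<^sub>M torus_haar)" for n
    unfolding Fn_def Re_osum exp_sum_def by measurable
  have Fn_norm: "norm (Fn n x y) = 1" for n x y by (simp add: Fn_def)
  have Fn_y [measurable]: "Fn n x \<in> borel_measurable borel" for n x
    unfolding Fn_def Re_osum by measurable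
  have Fn_x [measurable]: "(\<lambda>x. Fn n x y) \<in> borel_measurable borel" for n y
    unfolding Fn_def Re_osum exp_sum_def by measurable
  have tchar_\<beta>: "tchar m (\<beta> x) = tchar (transpose E *v m) x" for m x
    by (simp add: \<beta>_def tchar_torus_mult)
  have Fn_diag [measurable]: "(\<lambda>x. Fn n x (\<beta> x)) \<in> borel_measurable borel" for n
    unfolding Fn_def Re_osum exp_sum_def tchar_\<beta> by measurable
  define g where "g y = complex_of_real (exp (- (u\<^sup>2 * v y / 2)))" for y
  \<comment> \<open>The central limit theorem \<open>clt_trig\<close> at fixed \<open>y\<close>,
    tested against the character \<open>w\<close>.\<close>
  have inner: "(\<lambda>n. \<integral>x. tchar w x * Fn n x y \<partial>torus_haar) \<longlonglongrightarrow> of_bool (w = 0) * g y" for w y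
  proof -
    interpret trig_observable A h \<kappa> C c D p W y
      by unfold_locales (use W p in auto)
    have ps: "psum {..<n} x = orbit_sum p n x y" for n x
      by (simp add: psum_def obs_def orbit_sum_def)
    have "(\<lambda>n. var n / real n) \<longlonglongrightarrow> v y" using v[of y] by (simp add: var_def ps)
    from clt_trig[OF this, of w u] show ?thesis by (simp add: Fn_def g_def ps)
  qed
  \<comment> \<open>\<open>v\<close> is given pointwise in \<open>y\<close>; measurability of
    \<open>g\<close> comes from its being a limit of measurable integrals.\<close>
  have g_meas [measurable]: "g \<in> borel_measurable borel"
  proof (rule borel_measurable_LIMSEQ_metric)
    show "(\<lambda>y. \<integral>x. Fn n x y \<partial>torus_haar) \<in> borel_measurable borel" for n
    proof -
      have "(\<lambda>y. \<integral>x. Fn n x y \<partial>torus_haar) \<in> borel_measurable (torus_haar :: 'd torus measure)"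
        using torus.borel_measurable_lebesgue_integral[of "\<lambda>y x. Fn n x y" torus_haar]
          measurable_compose[OF measurable_pair_swap' Fn_meas[of n]]
        by (simp add: case_prod_beta)
      then show ?thesis by (simp add: measurable_cong_sets[OF sets_torus_haar refl])
    qed
    show "(\<lambda>n. \<integral>x. Fn n x y \<partial>torus_haar) \<longlonglongrightarrow> g y" for y using inner[of 0 y] by simp
  qed
  interpret P: pair_prob_space "torus_haar :: 'd torus measure" "torus_haar :: 'd torus measure" ..
  have swap: "(\<integral>x. tchar w x * (\<integral>y. tchar w' y * Fn n x y \<partial>torus_haar) \<partial>torus_haar)
      = (\<integral>y. tchar w' y * (\<integral>x. tchar w x * Fn n x y \<partial>torus_haar) \<partial>torus_haar)" for w w' n
  proof -
    have int: "integrable (torus_haar \<Otimes>\<^sub>M torus_haar) (\<lambda>(x, y). tchar w x * (tchar w' y * Fn n x y))"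
    proof (rule P.integrable_const_bound[of _ 1])
      show "(\<lambda>(x, y). tchar w x * (tchar w' y * Fn n x y)) \<in> borel_measurable (torus_haar \<Otimes>\<^sub>M torus_haar)"
        unfolding case_prod_beta using Fn_meas[of n] by measurable
    qed (auto simp: norm_mult Fn_norm)
    have "(\<integral>x. tchar w x * (\<integral>y. tchar w' y * Fn n x y \<partial>torus_haar) \<partial>torus_haar)
        = (\<integral>x. (\<integral>y. tchar w x * (tchar w' y * Fn n x y) \<partial>torus_haar) \<partial>torus_haar)"
      by simp
    also have "\<dots> = (\<integral>y. (\<integral>x. tchar w x * (tchar w' y * Fn n x y) \<partial>torus_haar) \<partial>torus_haar)"
      by (rule P.Fubini_integral[OF int, symmetric])
    also have "\<dots> = (\<integral>y. (\<integral>x. tchar w' y * (tchar w x * Fn n x y) \<partial>torus_haar) \<partial>torus_haar)"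
      by (simp add: mult_ac)
    finally show ?thesis by simp
  qed
  have in_y: "(\<lambda>y. \<integral>x. tchar w x * Fn n x y \<partial>torus_haar) \<in> borel_measurable borel" for w n
  proof -
    have "(\<lambda>z. tchar w (snd z) * Fn n (snd z) (fst z)) \<in> borel_measurable (torus_haar \<Otimes>\<^sub>M torus_haar)"
      using measurable_compose[OF measurable_pair_swap' Fn_meas[of n]] by (simp add: case_prod_beta)
    then have "(\<lambda>y. \<integral>x. tchar w x * Fn n x y \<partial>torus_haar) \<in> borel_measurable (torus_haar :: 'd torus measure)"
      using torus.borel_measurable_lebesgue_integral[of "\<lambda>y x. tchar w x * Fn n x y" torus_haar]
      by (simp add: case_prod_beta)
    then show ?thesis by (simp add: measurable_cong_sets[OF sets_torus_haar refl])
  qed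
  \<comment> \<open>Dominated convergence in \<open>y\<close>, in the order of integration that
    \<open>swap\<close> provides.\<close>
  have dom: "(\<lambda>n. \<integral>y. tchar w' y * (\<integral>x. tchar w x * Fn n x y \<partial>torus_haar) \<partial>torus_haar)
      \<longlonglongrightarrow> (\<integral>y. tchar w' y * (of_bool (w = 0) * g y) \<partial>torus_haar)" for w w'
  proof (rule integral_dominated_convergence[where w = "\<lambda>y. 1"])
    show "(\<lambda>y. tchar w' y * (of_bool (w = 0) * g y)) \<in> borel_measurable torus_haar" by measurable
    show "(\<lambda>y. tchar w' y * (\<integral>x. tchar w x * Fn n x y \<partial>torus_haar)) \<in> borel_measurable torus_haar" for n
      using in_y[of w n] by measurable
    show "AE y in torus_haar. (\<lambda>n. tchar w' y * (\<integral>x. tchar w x * Fn n x y \<partial>torus_haar))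
        \<longlonglongrightarrow> tchar w' y * (of_bool (w = 0) * g y)"
      by (intro AE_I2 tendsto_mult tendsto_const inner)
    show "AE y in torus_haar. norm (tchar w' y * (\<integral>x. tchar w x * Fn n x y \<partial>torus_haar)) \<le> 1" for n
    proof (intro AE_I2)
      fix y :: "'d torus"
      have "norm (\<integral>x. tchar w x * Fn n x y \<partial>torus_haar) \<le> (\<integral>x. norm (tchar w x * Fn n x y) \<partial>torus_haar)"
        by (rule integral_norm_bound)
      then show "norm (tchar w' y * (\<integral>x. tchar w x * Fn n x y \<partial>torus_haar)) \<le> 1"
        by (simp add: norm_mult Fn_norm)
    qed
  qed simp
  define T where "T N n = (\<integral>x. (\<integral>y. complex_of_real (fejer N (\<beta> x - y)) * Fn n x y \<partial>torus_haar) \<partial>torus_haar)" for N n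
  have T_eq: "(\<integral>y. complex_of_real (fejer N (\<beta> x - y)) * Fn n x y \<partial>torus_haar)
      = (\<Sum>k\<in>freq_box N. \<Sum>l\<in>freq_box N. (1 / of_nat (card (freq_box N :: (int ^ 'd) set))) *
          (tchar (transpose E *v (k - l)) x * (\<integral>y. tchar (l - k) y * Fn n x y \<partial>torus_haar)))" for N n x
  proof -
    have int: "integrable torus_haar (\<lambda>y. tchar k y * Fn n x y)" for k
      by (rule integrable_torus_bounded[where K = 1]) (auto simp: norm_mult Fn_norm)
    have "complex_of_real (fejer N (\<beta> x - y)) * Fn n x y
        = (\<Sum>k\<in>freq_box N. \<Sum>l\<in>freq_box N. ((1 / of_nat (card (freq_box N :: (int ^ 'd) set))) *
          tchar (transpose E *v (k - l)) x) * (tchar (l - k) y * Fn n x y))" for y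
      unfolding fejer_expand tchar_\<beta> by (simp add: sum_distrib_left sum_distrib_right mult_ac)
    then show ?thesis using int by (simp add: mult.assoc)
  qed
  have T_sum: "T N n = (\<Sum>k\<in>freq_box N. \<Sum>l\<in>freq_box N. (1 / of_nat (card (freq_box N :: (int ^ 'd) set))) *
          (\<integral>y. tchar (l - k) y * (\<integral>x. tchar (transpose E *v (k - l)) x * Fn n x y \<partial>torus_haar) \<partial>torus_haar))" for N n
  proof -
    have int: "integrable torus_haar (\<lambda>x. tchar w x * (\<integral>y. tchar w' y * Fn n x y \<partial>torus_haar))" for w w'
    proof (rule integrable_torus_bounded[where K = 1])
      have "(\<lambda>z. tchar w' (snd z) * Fn n (fst z) (snd z)) \<in> borel_measurable (torus_haar \<Otimes>\<^sub>M torus_haar)"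
        using Fn_meas[of n] by measurable
      then have "(\<lambda>x. \<integral>y. tchar w' y * Fn n x y \<partial>torus_haar) \<in> borel_measurable (torus_haar :: 'd torus measure)"
        using torus.borel_measurable_lebesgue_integral[of "\<lambda>x y. tchar w' y * Fn n x y" torus_haar]
        by (simp add: case_prod_beta)
      then have [measurable]: "(\<lambda>x. \<integral>y. tchar w' y * Fn n x y \<partial>torus_haar) \<in> borel_measurable borel"
        by (simp add: measurable_cong_sets[OF sets_torus_haar refl])
      show "(\<lambda>x. tchar w x * (\<integral>y. tchar w' y * Fn n x y \<partial>torus_haar)) \<in> borel_measurable borel" by measurable
      show "norm (tchar w x * (\<integral>y. tchar w' y * Fn n x y \<partial>torus_haar)) \<le> 1" for x
      proof -
        have "norm (\<integral>y. tchar w' y * Fn n x y \<partial>torus_haar) \<le> (\<integral>y. norm (tchar w' y * Fn n x y) \<partial>torus_haar)"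
          by (rule integral_norm_bound)
        then show ?thesis by (simp add: norm_mult Fn_norm)
      qed
    qed
    show ?thesis unfolding T_def T_eq using int by (simp add: swap)
  qed
  \<comment> \<open>By injectivity of the transpose of \<open>E\<close> the frequency
    \<open>transpose E *v (k - l)\<close> vanishes on the diagonal alone, and the diagonal has as
    many terms as the normalising factor.\<close>
  have T_lim: "T N \<longlonglongrightarrow> (\<integral>y. g y \<partial>torus_haar)" if N: "N > 0" for N
  proof -
    define b where "b = (of_nat (card (freq_box N :: (int ^ 'd) set)) :: complex)"
    have b: "b \<noteq> 0" using card_freq_box_pos[OF N, where 'd = 'd] by (simp add: b_def)
    have "T N \<longlonglongrightarrow> (\<Sum>k\<in>freq_box N. \<Sum>l\<in>freq_box N. (1 / b) *
          (\<integral>y. tchar (l - k) y * (of_bool (transpose E *v (k - l) = 0) * g y) \<partial>torus_haar))"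
      unfolding T_sum b_def by (intro tendsto_sum tendsto_mult tendsto_const dom)
    also have "(\<Sum>k\<in>freq_box N. \<Sum>l\<in>freq_box N. (1 / b) *
          (\<integral>y. tchar (l - k) y * (of_bool (transpose E *v (k - l) = 0) * g y) \<partial>torus_haar))
        = (\<Sum>k\<in>(freq_box N :: (int ^ 'd) set). \<Sum>l\<in>freq_box N. if k = l then (1 / b) * (\<integral>y. g y \<partial>torus_haar) else 0)"
    proof (intro sum.cong refl)
      fix k l :: "int ^ 'd"
      show "(1 / b) * (\<integral>y. tchar (l - k) y * (of_bool (transpose E *v (k - l) = 0) * g y) \<partial>torus_haar)
          = (if k = l then (1 / b) * (\<integral>y. g y \<partial>torus_haar) else 0)"
        using E[of "k - l"] by auto
    qed
    also have "\<dots> = (\<integral>y. g y \<partial>torus_haar)"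
      using b by (simp add: finite_freq_box b_def)
    finally show ?thesis .
  qed
  define Q where "Q = \<bar>u\<bar> * (\<Sum>m\<in>F. norm (a m) * (2 * pi * int_norm m)) * (1 + real CARD('d))"
  \<comment> \<open>The Lipschitz constant in \<open>y\<close> depends on \<open>x\<close> through
    exponential sums divided by \<open>sqrt (real n)\<close>; its mean over \<open>x\<close> is
    bounded, so the smoothing error is uniform in \<open>n\<close>.\<close>
  have lip: "norm (Fn n x y - Fn n x y')
      \<le> \<bar>u\<bar> / sqrt (real n) * (\<Sum>m\<in>F. norm (a m) * (2 * pi * int_norm m) * norm (exp_sum m n x)) * dist y y'" for n x y y'
  proof -
    have "\<bar>orbit_sum p n x y - orbit_sum p n x y'\<bar> = norm (complex_of_real (orbit_sum p n x y) - complex_of_real (orbit_sum p n x y'))"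
      by (metis norm_of_real of_real_diff)
    also have "\<dots> = norm (\<Sum>m\<in>F. a m * (tchar m y - tchar m y') * exp_sum m n x)"
      unfolding osum sum_subtractf[symmetric] by (simp add: algebra_simps)
    also have "\<dots> \<le> (\<Sum>m\<in>F. norm (a m) * (2 * pi * int_norm m * dist y y') * norm (exp_sum m n x))"
      by (rule order_trans[OF norm_sum])
         (unfold norm_mult, intro sum_mono mult_right_mono mult_left_mono tchar_lipschitz norm_ge_zero)
    finally have *: "\<bar>orbit_sum p n x y - orbit_sum p n x y'\<bar>
        \<le> (\<Sum>m\<in>F. norm (a m) * (2 * pi * int_norm m) * norm (exp_sum m n x)) * dist y y'"
      by (simp add: sum_distrib_left sum_distrib_right mult_ac)
    have "norm (Fn n x y - Fn n x y') \<le> \<bar>u * orbit_sum p n x y / sqrt (real n) - u * orbit_sum p n x y' / sqrt (real n)\<bar>"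
      unfolding Fn_def by (rule norm_iexp_diff_le)
    also have "\<dots> = \<bar>u\<bar> / sqrt (real n) * \<bar>orbit_sum p n x y - orbit_sum p n x y'\<bar>"
      by (simp add: abs_mult flip: diff_divide_distrib right_diff_distrib)
    also have "\<dots> \<le> \<bar>u\<bar> / sqrt (real n) * ((\<Sum>m\<in>F. norm (a m) * (2 * pi * int_norm m) * norm (exp_sum m n x)) * dist y y')"
      by (intro mult_left_mono *) auto
    finally show ?thesis by (simp add: mult.assoc)
  qed
  have smooth: "norm ((\<integral>x. Fn n x (\<beta> x) \<partial>torus_haar) - T N n) \<le> Q * real N powr (- (1 / 2))"
    if N: "N > 0" and n: "n > 0" for N n
  proof -
    define S where "S x = \<bar>u\<bar> / sqrt (real n) * (\<Sum>m\<in>F. norm (a m) * (2 * pi * int_norm m) * norm (exp_sum m n x))" for x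
    have S0: "0 \<le> S x" for x unfolding S_def by (intro mult_nonneg_nonneg sum_nonneg) (auto simp: int_norm_nonneg)
    have Sb: "bounded_meas S"
      unfolding S_def by (intro bounded_meas_cmult bounded_meas_sum exp_sum_bounded_meas)
    have pt: "norm (Fn n x (\<beta> x) - (\<integral>y. complex_of_real (fejer N (\<beta> x - y)) * Fn n x y \<partial>torus_haar))
        \<le> S x * ((1 + real CARD('d)) * real N powr (- (1 / 2)))" for x
    proof -
      have int: "integrable torus_haar (\<lambda>y. complex_of_real (fejer N (\<beta> x - y)) * Fn n x y)"
        by (rule fejer_integrable_mult[where K = 1]) (auto simp: Fn_norm)
      have int1: "integrable torus_haar (\<lambda>y. complex_of_real (fejer N (\<beta> x - y)) * Fn n x (\<beta> x))"
        by (rule fejer_integrable_mult[where K = 1]) (auto simp: Fn_norm)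
      have intd: "integrable torus_haar (\<lambda>y. fejer N (\<beta> x - y) * dist (\<beta> x) y)"
        using fejer_dist_powr(1)[OF N, of 1 "\<beta> x"] by simp
      have "Fn n x (\<beta> x) = (\<integral>y. complex_of_real (fejer N (\<beta> x - y)) * Fn n x (\<beta> x) \<partial>torus_haar)"
        using fejer_integral[OF N, of "\<beta> x"] by simp
      then have "norm (Fn n x (\<beta> x) - (\<integral>y. complex_of_real (fejer N (\<beta> x - y)) * Fn n x y \<partial>torus_haar))
          = norm ((\<integral>y. complex_of_real (fejer N (\<beta> x - y)) * Fn n x (\<beta> x) \<partial>torus_haar)
            - (\<integral>y. complex_of_real (fejer N (\<beta> x - y)) * Fn n x y \<partial>torus_haar))"
        by (rule arg_cong[of _ _ "\<lambda>z. norm (z - _)"])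
      also have "\<dots> \<le> (\<integral>y. S x * (fejer N (\<beta> x - y) * dist (\<beta> x) y) \<partial>torus_haar)"
      proof (rule integral_norm_diff_le[OF int1 int integrable_mult_right[OF intd]])
        fix y
        have "norm (complex_of_real (fejer N (\<beta> x - y)) * Fn n x (\<beta> x) - complex_of_real (fejer N (\<beta> x - y)) * Fn n x y)
            = fejer N (\<beta> x - y) * norm (Fn n x (\<beta> x) - Fn n x y)"
          by (simp add: norm_mult fejer_nonneg flip: right_diff_distrib)
        also have "\<dots> \<le> fejer N (\<beta> x - y) * (S x * dist (\<beta> x) y)"
          unfolding S_def by (intro mult_left_mono lip fejer_nonneg)
        finally show "norm (complex_of_real (fejer N (\<beta> x - y)) * Fn n x (\<beta> x) - complex_of_real (fejer N (\<beta> x - y)) * Fn n x y)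
            \<le> S x * (fejer N (\<beta> x - y) * dist (\<beta> x) y)"
          by (simp add: mult_ac)
      qed
      also have "\<dots> = S x * (\<integral>y. fejer N (\<beta> x - y) * dist (\<beta> x) y powr 1 \<partial>torus_haar)" by simp
      also have "\<dots> \<le> S x * ((1 + real CARD('d)) * real N powr (- (1 / 2)))"
        using fejer_dist_powr(2)[OF N, of 1 "\<beta> x"] by (intro mult_left_mono S0) auto
      finally show ?thesis .
    qed
    have intT: "integrable torus_haar (\<lambda>x. \<integral>y. complex_of_real (fejer N (\<beta> x - y)) * Fn n x y \<partial>torus_haar)"
    proof (rule integrable_torus_bounded[where K = 1])
      have [measurable]: "\<beta> \<in> borel_measurable borel"
        unfolding \<beta>_def by (rule torus_mult_measurable)
      have "(\<lambda>z. complex_of_real (fejer N (\<beta> (fst z) - snd z)) * Fn n (fst z) (snd z)) \<in> borel_measurable (torus_haar \<Otimes>\<^sub>M torus_haar)"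
        using Fn_meas[of n] fejer_measurable2[of "\<lambda>z. \<beta> (fst z)" "torus_haar \<Otimes>\<^sub>M torus_haar" snd N] by measurable
      then have "(\<lambda>x. \<integral>y. complex_of_real (fejer N (\<beta> x - y)) * Fn n x y \<partial>torus_haar) \<in> borel_measurable (torus_haar :: 'd torus measure)"
        using torus.borel_measurable_lebesgue_integral[of "\<lambda>x y. complex_of_real (fejer N (\<beta> x - y)) * Fn n x y" torus_haar]
        by (simp add: case_prod_beta)
      then show "(\<lambda>x. \<integral>y. complex_of_real (fejer N (\<beta> x - y)) * Fn n x y \<partial>torus_haar) \<in> borel_measurable borel"
        by (simp add: measurable_cong_sets[OF sets_torus_haar refl])
      show "norm (\<integral>y. complex_of_real (fejer N (\<beta> x - y)) * Fn n x y \<partial>torus_haar) \<le> 1" for x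
      proof -
        have "norm (\<integral>y. complex_of_real (fejer N (\<beta> x - y)) * Fn n x y \<partial>torus_haar)
            \<le> (\<integral>y. norm (complex_of_real (fejer N (\<beta> x - y)) * Fn n x y) \<partial>torus_haar)" by (rule integral_norm_bound)
        also have "\<dots> = 1" by (simp add: norm_mult Fn_norm fejer_nonneg fejer_integral[OF N])
        finally show ?thesis .
      qed
    qed
    have "norm ((\<integral>x. Fn n x (\<beta> x) \<partial>torus_haar) - T N n)
        \<le> (\<integral>x. S x * ((1 + real CARD('d)) * real N powr (- (1 / 2))) \<partial>torus_haar)"
      unfolding T_def
      by (rule integral_norm_diff_le[OF _ intT _ pt])
         (auto intro!: integrable_torus_bounded[where K = 1] integrable_mult_left bounded_meas_integrable[OF Sb] simp: Fn_norm)
    also have "\<dots> = (\<integral>x. S x \<partial>torus_haar) * ((1 + real CARD('d)) * real N powr (- (1 / 2)))" by simp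
    also have "(\<integral>x. S x \<partial>torus_haar) = \<bar>u\<bar> / sqrt (real n) * (\<Sum>m\<in>F. norm (a m) * (2 * pi * int_norm m) * (\<integral>x. norm (exp_sum m n x) \<partial>torus_haar))"
      unfolding S_def using bounded_meas_integrable[OF exp_sum_bounded_meas] by simp
    also have "\<dots> \<le> \<bar>u\<bar> / sqrt (real n) * (\<Sum>m\<in>F. norm (a m) * (2 * pi * int_norm m) * sqrt (real n))"
      using F W by (intro mult_left_mono sum_mono integral_norm_exp_sum) (auto simp: int_norm_nonneg)
    also have "\<dots> = \<bar>u\<bar> * (\<Sum>m\<in>F. norm (a m) * (2 * pi * int_norm m))"
      using n by (simp flip: sum_distrib_right)
    finally show ?thesis by (simp add: Q_def mult.assoc mult_right_mono)
  qed
  have "(\<lambda>n. \<integral>x. Fn n x (\<beta> x) \<partial>torus_haar) \<longlonglongrightarrow> (\<integral>y. g y \<partial>torus_haar)"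
  proof (rule tendsto_of_double_limit)
    fix N :: nat assume N: "N > 0"
    show "\<forall>\<^sub>F n in sequentially. norm ((\<integral>x. Fn n x (\<beta> x) \<partial>torus_haar) - (\<integral>y. g y \<partial>torus_haar))
        \<le> Q * real N powr (- (1 / 2)) + norm (T N n - (\<integral>y. g y \<partial>torus_haar))"
      using eventually_gt_at_top[of 0]
    proof eventually_elim
      case (elim n)
      have "norm ((\<integral>x. Fn n x (\<beta> x) \<partial>torus_haar) - (\<integral>y. g y \<partial>torus_haar))
          \<le> norm ((\<integral>x. Fn n x (\<beta> x) \<partial>torus_haar) - T N n) + norm (T N n - (\<integral>y. g y \<partial>torus_haar))"
        using norm_triangle_ineq[of "(\<integral>x. Fn n x (\<beta> x) \<partial>torus_haar) - T N n" "T N n - (\<integral>y. g y \<partial>torus_haar)"] by simp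
      then show ?case using smooth[OF N elim] by linarith
    qed
    have "(\<lambda>n. norm (T N n - (\<integral>y. g y \<partial>torus_haar))) \<longlonglongrightarrow> 0"
      using T_lim[OF N] by (intro tendsto_norm_zero LIM_zero)
    from tendsto_add[OF tendsto_const this]
    show "(\<lambda>n. Q * real N powr (- (1 / 2)) + norm (T N n - (\<integral>y. g y \<partial>torus_haar))) \<longlonglongrightarrow> Q * real N powr (- (1 / 2)) + 0" .
  next
    have "(\<lambda>N. real N powr (- (1 / 2))) \<longlonglongrightarrow> 0"
      by (intro tendsto_neg_powr filterlim_real_sequentially) auto
    from tendsto_mult_right_zero[OF this, of Q]
    show "(\<lambda>N. Q * real N powr (- (1 / 2)) + 0) \<longlonglongrightarrow> 0" by simp
  qed
  then show ?thesis by (simp only: Fn_def g_def \<beta>_def)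
qed

end

section \<open>The limit theorem for Hoelder functions\<close>

lemma (in toral_automorphism) integral_orbit_sum_sq_measurable:
  assumes p: "trig_on W (\<lambda>x. complex_of_real (p x))"
  shows "(\<lambda>y. \<integral>x. (orbit_sum p n x y)\<^sup>2 \<partial>torus_haar) \<in> borel_measurable borel"
proof -
  obtain F a where F: "\<forall>x. complex_of_real (p x) = (\<Sum>m\<in>F. a m * tchar m x)"
    using trig_explicit[OF p] by (elim exE conjE)
  have Re_osum: "orbit_sum p n x y = Re (\<Sum>m\<in>F. a m * tchar m y * exp_sum m n x)" for x y
    unfolding orbit_sum_trig[OF F, symmetric] by simp
  have "(\<lambda>z. (orbit_sum p n (snd z) (fst z))\<^sup>2) \<in> borel_measurable (torus_haar \<Otimes>\<^sub>M torus_haar)"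
    unfolding Re_osum exp_sum_def by measurable
  then have "(\<lambda>y. \<integral>x. (orbit_sum p n x y)\<^sup>2 \<partial>torus_haar) \<in> borel_measurable (torus_haar :: 'd torus measure)"
    using torus.borel_measurable_lebesgue_integral[of "\<lambda>y x. (orbit_sum p n x y)\<^sup>2" torus_haar]
    by (simp add: case_prod_beta)
  then show ?thesis by (simp add: measurable_cong_sets[OF sets_torus_haar refl])
qed

context toral_observable
begin

lemma approx_freqs: "finite (approx_freqs j)" "0 \<notin> approx_freqs j"
proof -
  show "finite (approx_freqs j)"
    by (rule finite_subset[OF _ finite_int_norm_le]) (auto simp: approx_freqs_def)
qed (simp add: approx_freqs_def)

definition mean_var :: "('d torus \<Rightarrow> real) \<Rightarrow> nat \<Rightarrow> 'd torus \<Rightarrow> real" where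
  "mean_var f n y = (\<integral>x. (orbit_sum f n x y)\<^sup>2 \<partial>torus_haar) / real n"

definition approx_var :: "nat \<Rightarrow> 'd torus \<Rightarrow> real" where
  "approx_var j y = lim (\<lambda>n. mean_var (approx j) n y)"

lemma approx_var_limit: "(\<lambda>n. mean_var (approx j) n y) \<longlonglongrightarrow> approx_var j y"
proof -
  interpret trig_observable A h \<kappa> C c D "approx j" "approx_freqs j" y
    by unfold_locales (use approx_freqs approx_trig in auto)
  have "mean_var (approx j) n y = var n / real n" for n
    by (simp add: mean_var_def orbit_sum_def var_def psum_def obs_def)
  then have "convergent (\<lambda>n. mean_var (approx j) n y)"
    using var_limit_exists by (simp add: convergent_def)
  then show ?thesis unfolding approx_var_def by (simp add: convergent_LIMSEQ_iff)
qed

lemma approx_var_measurable: "approx_var j \<in> borel_measurable borel"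
proof (rule borel_measurable_LIMSEQ_real[OF approx_var_limit])
  show "mean_var (approx j) n \<in> borel_measurable borel" for n
    unfolding mean_var_def[abs_def] using integral_orbit_sum_sq_measurable[OF approx_trig, of j n] by measurable
qed

lemma sqrt_mean_var: "sqrt (mean_var f n y) = l2norm (\<lambda>x. orbit_sum f n x y) / sqrt (real n)"
  by (simp add: mean_var_def l2norm_def real_sqrt_divide)

lemma orbit_sum_bounded_meas:
  "bounded_meas (\<lambda>x. orbit_sum \<phi> n x y)" "bounded_meas (\<lambda>x. orbit_sum (approx j) n x y)"
  unfolding orbit_sum_def by (intro bounded_meas_sum \<phi>_orbit_bounded_meas approx_orbit_bounded_meas)+

lemma abs_l2norm_diff_le:
  assumes f: "bounded_meas f" and g: "bounded_meas g"
  shows "\<bar>l2norm f - l2norm g\<bar> \<le> l2norm (\<lambda>x. f x - g x)"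
proof -
  have "l2norm (\<lambda>x. g x + (f x - g x)) \<le> l2norm g + l2norm (\<lambda>x. f x - g x)"
    by (rule l2norm_triangle[OF g bounded_meas_diff[OF f g]])
  moreover have "l2norm (\<lambda>x. f x + (g x - f x)) \<le> l2norm f + l2norm (\<lambda>x. g x - f x)"
    by (rule l2norm_triangle[OF f bounded_meas_diff[OF g f]])
  moreover have "l2norm (\<lambda>x. g x - f x) = l2norm (\<lambda>x. f x - g x)"
    by (simp add: l2norm_def power2_commute)
  ultimately show ?thesis by simp
qed

text \<open>The error is uniform in \<open>n\<close> and in \<open>y\<close>; this permits the
  exchange of limits that makes the variance of \<phi> exist.\<close>

lemma mean_var_approx:
  obtains \<eta> where "\<eta> \<longlonglongrightarrow> 0"
    "\<And>j n y. \<bar>sqrt (mean_var \<phi> n y) - sqrt (mean_var (approx j) n y)\<bar> \<le> \<eta> j"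
proof -
  obtain \<eta> where \<eta>: "\<eta> \<longlonglongrightarrow> 0" "\<And>J I y. finite I \<Longrightarrow>
      l2norm (\<lambda>x. \<Sum>k\<in>I. \<phi> (orbit_point 0 y k x) - approx J (orbit_point 0 y k x)) \<le> \<eta> J * sqrt (real (card I))"
    by (rule l2norm_orbit_tail[of 0]) (rule that)
  show ?thesis
  proof (rule that[of "\<lambda>j. \<bar>\<eta> j\<bar>"])
    show "(\<lambda>j. \<bar>\<eta> j\<bar>) \<longlonglongrightarrow> 0" using tendsto_rabs[OF \<eta>(1)] by simp
    fix j n y
    show "\<bar>sqrt (mean_var \<phi> n y) - sqrt (mean_var (approx j) n y)\<bar> \<le> \<bar>\<eta> j\<bar>"
    proof (cases "n = 0")
      case False
      then have n: "0 < sqrt (real n)" by simp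
      have "\<bar>l2norm (\<lambda>x. orbit_sum \<phi> n x y) - l2norm (\<lambda>x. orbit_sum (approx j) n x y)\<bar>
          \<le> l2norm (\<lambda>x. orbit_sum \<phi> n x y - orbit_sum (approx j) n x y)"
        by (rule abs_l2norm_diff_le[OF orbit_sum_bounded_meas])
      also have "\<dots> \<le> \<eta> j * sqrt (real n)"
        using \<eta>(2)[of "{..<n}" y j] by (simp add: orbit_sum_def sum_subtractf)
      also have "\<dots> \<le> \<bar>\<eta> j\<bar> * sqrt (real n)" using n by (intro mult_right_mono) auto
      finally show ?thesis
        unfolding sqrt_mean_var using n by (simp add: pos_divide_le_eq flip: diff_divide_distrib)
    qed (simp add: mean_var_def)
  qed
qed

definition sd :: "'d torus \<Rightarrow> real" where
  "sd y = lim (\<lambda>n. sqrt (mean_var \<phi> n y))"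

text \<open>A sequence uniformly close to convergent ones is Cauchy, so the \<open>lim\<close> in
  \<open>sd\<close> is a true limit; the second claim expresses it through measurable
  approximants.\<close>

lemma sd_limit:
  shows "(\<lambda>n. sqrt (mean_var \<phi> n y)) \<longlonglongrightarrow> sd y"
    and "(\<lambda>j. sqrt (approx_var j y)) \<longlonglongrightarrow> sd y"
proof -
  obtain \<eta> where \<eta>: "\<eta> \<longlonglongrightarrow> 0"
    "\<And>j n y. \<bar>sqrt (mean_var \<phi> n y) - sqrt (mean_var (approx j) n y)\<bar> \<le> \<eta> j"
    by (rule mean_var_approx) (rule that)
  have app: "(\<lambda>n. sqrt (mean_var (approx j) n y)) \<longlonglongrightarrow> sqrt (approx_var j y)" for j
    by (intro tendsto_real_sqrt approx_var_limit)
  have "Cauchy (\<lambda>n. sqrt (mean_var \<phi> n y))"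
  proof (rule metric_CauchyI)
    fix e :: real assume e: "0 < e"
    have "\<forall>\<^sub>F j in sequentially. \<eta> j < e / 3" using \<eta>(1) e by (intro order_tendstoD) auto
    then obtain j where j: "\<eta> j < e / 3" using eventually_happens'[OF sequentially_bot] by blast
    obtain n0 where n0: "\<And>m n. m \<ge> n0 \<Longrightarrow> n \<ge> n0 \<Longrightarrow>
        dist (sqrt (mean_var (approx j) m y)) (sqrt (mean_var (approx j) n y)) < e / 3"
      using metric_CauchyD[OF LIMSEQ_imp_Cauchy[OF app[of j]], of "e / 3"] e by auto
    have "dist (sqrt (mean_var \<phi> m y)) (sqrt (mean_var \<phi> n y)) < e" if "m \<ge> n0" "n \<ge> n0" for m n
      using n0[OF that] \<eta>(2)[of m y j] \<eta>(2)[of n y j] j unfolding dist_real_def by linarith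
    then show "\<exists>M. \<forall>m\<ge>M. \<forall>n\<ge>M. dist (sqrt (mean_var \<phi> m y)) (sqrt (mean_var \<phi> n y)) < e" by blast
  qed
  then show lim: "(\<lambda>n. sqrt (mean_var \<phi> n y)) \<longlonglongrightarrow> sd y"
    unfolding sd_def by (simp add: Cauchy_convergent_iff convergent_LIMSEQ_iff)
  have err: "norm (sqrt (approx_var j y) - sd y) \<le> \<eta> j" for j
  proof (rule LIMSEQ_le_const2)
    show "(\<lambda>n. norm (sqrt (mean_var (approx j) n y) - sqrt (mean_var \<phi> n y))) \<longlonglongrightarrow> norm (sqrt (approx_var j y) - sd y)"
      by (intro tendsto_norm tendsto_diff app lim)
    show "\<exists>N. \<forall>n\<ge>N. norm (sqrt (mean_var (approx j) n y) - sqrt (mean_var \<phi> n y)) \<le> \<eta> j"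
      using \<eta>(2) by (simp add: abs_minus_commute)
  qed
  show "(\<lambda>j. sqrt (approx_var j y)) \<longlonglongrightarrow> sd y"
  proof (rule LIM_zero_cancel, rule Lim_null_comparison[OF _ \<eta>(1)])
    show "\<forall>\<^sub>F j in sequentially. norm (sqrt (approx_var j y) - sd y) \<le> \<eta> j"
      using err by (intro always_eventually allI)
  qed
qed

lemma sd_measurable: "sd \<in> borel_measurable borel"
proof (rule borel_measurable_LIMSEQ_real[OF sd_limit(2)])
  show "(\<lambda>y. sqrt (approx_var j y)) \<in> borel_measurable borel" for j
    using approx_var_measurable[of j] by measurable
qed

lemma sd_nonneg: "0 \<le> sd y"
proof (rule LIMSEQ_le_const[OF sd_limit(1)])
  show "\<exists>N. \<forall>n\<ge>N. 0 \<le> sqrt (mean_var \<phi> n y)" by (simp add: mean_var_def)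
qed

text \<open>With convergence established, the \<open>lim\<close> inside
  \<open>asymptotic_variance\<close> has its intended value; squaring returns from standard
  deviations to variances.\<close>

lemma asymptotic_sd_eq: "asymptotic_sd A \<phi> y = sd y"
proof -
  have "(\<lambda>n. (sqrt (mean_var \<phi> n y))\<^sup>2) \<longlonglongrightarrow> (sd y)\<^sup>2"
    by (intro tendsto_power sd_limit)
  moreover have "(sqrt (mean_var \<phi> n y))\<^sup>2 = 1 / real n *
      (\<integral>x. (\<Sum>k<n. \<phi> (torus_mult (matrix_power A k) x + y))\<^sup>2 \<partial>torus_haar)" for n
    by (simp add: mean_var_def orbit_sum_def orbit_point_def torus_mult_0)
  ultimately have "asymptotic_variance A (\<lambda>x. \<phi> (x + y)) = (sd y)\<^sup>2"
    unfolding asymptotic_variance_def by (simp add: limI)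
  then show ?thesis using sd_nonneg by (simp add: asymptotic_sd_def)
qed

text \<open>The square-norm tail bound along twisted orbits makes the characteristic functions of
  \<phi> and of \<open>approx j\<close> close uniformly in \<open>n\<close>, so \<open>n\<close> can
  go to infinity at fixed \<open>j\<close>, and \<open>j\<close> afterwards.\<close>

lemma twisted_char_limit:
  assumes E: "\<And>m. transpose E *v m = 0 \<Longrightarrow> m = 0"
  shows "(\<lambda>n. \<integral>x. iexp (u * (\<Sum>k<n. \<phi> (orbit_point E 0 k x)) / sqrt (real n)) \<partial>torus_haar)
    \<longlonglongrightarrow> (\<integral>y. complex_of_real (exp (- (u\<^sup>2 * (sd y)\<^sup>2 / 2))) \<partial>torus_haar)"
proof -
  obtain \<eta> where \<eta>: "\<eta> \<longlonglongrightarrow> 0" "\<And>J I y. finite I \<Longrightarrow>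
      l2norm (\<lambda>x. \<Sum>k\<in>I. \<phi> (orbit_point E y k x) - approx J (orbit_point E y k x)) \<le> \<eta> J * sqrt (real (card I))"
    by (rule l2norm_orbit_tail[of E]) (rule that)
  define X where "X n = (\<integral>x. iexp (u * (\<Sum>k<n. \<phi> (orbit_point E 0 k x)) / sqrt (real n)) \<partial>torus_haar)" for n
  define Y where "Y j n = (\<integral>x. iexp (u * orbit_sum (approx j) n x (torus_mult E x) / sqrt (real n)) \<partial>torus_haar)" for j n
  define g where "g j = (\<integral>y. complex_of_real (exp (- (u\<^sup>2 * approx_var j y / 2))) \<partial>torus_haar)" for j
  define g0 where "g0 = (\<integral>y. complex_of_real (exp (- (u\<^sup>2 * (sd y)\<^sup>2 / 2))) \<partial>torus_haar)"
  have Yg: "Y j \<longlonglongrightarrow> g j" for j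
    unfolding Y_def g_def
  proof (rule twisted_clt_trig[OF approx_freqs approx_trig])
    show "m = 0" if "transpose E *v m = 0" for m by (rule E[OF that])
    show "(\<lambda>n. (\<integral>x. (orbit_sum (approx j) n x y)\<^sup>2 \<partial>torus_haar) / real n) \<longlonglongrightarrow> approx_var j y" for y
      using approx_var_limit[of j y] unfolding mean_var_def .
  qed
  have approx_var_nonneg: "0 \<le> approx_var j y" for j y
    by (rule LIMSEQ_le_const[OF approx_var_limit]) (auto simp: mean_var_def)
  \<comment> \<open>The Gaussian characteristic functions are bounded by 1, so convergence of the
    variances passes to the mixtures.\<close>
  have gg: "g \<longlonglongrightarrow> g0"
    unfolding g_def g0_def
  proof (rule integral_dominated_convergence[where w = "\<lambda>y. 1"])
    show "(\<lambda>y. complex_of_real (exp (- (u\<^sup>2 * (sd y)\<^sup>2 / 2)))) \<in> borel_measurable torus_haar"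
      using sd_measurable by measurable
    show "(\<lambda>y. complex_of_real (exp (- (u\<^sup>2 * approx_var j y / 2)))) \<in> borel_measurable torus_haar" for j
      using approx_var_measurable[of j] by measurable
    show "AE y in torus_haar. (\<lambda>j. complex_of_real (exp (- (u\<^sup>2 * approx_var j y / 2))))
        \<longlonglongrightarrow> complex_of_real (exp (- (u\<^sup>2 * (sd y)\<^sup>2 / 2)))"
    proof (intro AE_I2 tendsto_of_real tendsto_exp tendsto_minus tendsto_divide tendsto_mult tendsto_const)
      fix y
      have "(\<lambda>j. (sqrt (approx_var j y))\<^sup>2) \<longlonglongrightarrow> (sd y)\<^sup>2" by (intro tendsto_power sd_limit)
      then show "(\<lambda>j. approx_var j y) \<longlonglongrightarrow> (sd y)\<^sup>2" using approx_var_nonneg by simp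
    qed simp
    show "AE y in torus_haar. norm (complex_of_real (exp (- (u\<^sup>2 * approx_var j y / 2)))) \<le> 1" for j
      using approx_var_nonneg by (intro AE_I2) simp
  qed simp
  have XY: "norm (X n - Y j n) \<le> \<bar>u\<bar> * \<bar>\<eta> j\<bar>" if n: "n > 0" for n j
  proof -
    define f where "f x = (\<Sum>k<n. \<phi> (orbit_point E 0 k x))" for x
    define p where "p x = (\<Sum>k<n. approx j (orbit_point E 0 k x))" for x
    have fb: "bounded_meas f" unfolding f_def by (intro bounded_meas_sum \<phi>_orbit_bounded_meas)
    have pb: "bounded_meas p" unfolding p_def by (intro bounded_meas_sum approx_orbit_bounded_meas)
    note [measurable] = bounded_meas_measurable[OF fb] bounded_meas_measurable[OF pb]
    have p_eq: "orbit_sum (approx j) n x (torus_mult E x) = p x" for x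
      unfolding orbit_sum_def p_def by (simp only: orbit_point_twist[symmetric])
    have int: "integrable torus_haar (\<lambda>x. iexp (u * q x / sqrt (real n)))" if "q \<in> borel_measurable borel" for q
      using that by (intro integrable_torus_bounded[where K = 1]) auto
    have "norm (X n - Y j n) \<le> (\<integral>x. \<bar>u\<bar> / sqrt (real n) * \<bar>f x - p x\<bar> \<partial>torus_haar)"
      unfolding X_def Y_def p_eq f_def[symmetric]
    proof (rule integral_norm_diff_le)
      show "integrable torus_haar (\<lambda>x. \<bar>u\<bar> / sqrt (real n) * \<bar>f x - p x\<bar>)"
        by (intro integrable_mult_right integrable_abs bounded_meas_integrable bounded_meas_diff fb pb)
      fix x
      have "norm (iexp (u * f x / sqrt (real n)) - iexp (u * p x / sqrt (real n)))
          \<le> \<bar>u * f x / sqrt (real n) - u * p x / sqrt (real n)\<bar>" by (rule norm_iexp_diff_le)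
      also have "\<dots> = \<bar>u\<bar> / sqrt (real n) * \<bar>f x - p x\<bar>"
        by (simp add: abs_mult flip: diff_divide_distrib right_diff_distrib)
      finally show "norm (iexp (u * f x / sqrt (real n)) - iexp (u * p x / sqrt (real n)))
          \<le> \<bar>u\<bar> / sqrt (real n) * \<bar>f x - p x\<bar>" .
    qed (rule int; measurable)+
    also have "\<dots> = \<bar>u\<bar> / sqrt (real n) * (\<integral>x. \<bar>f x - p x\<bar> \<partial>torus_haar)" by simp
    also have "\<dots> \<le> \<bar>u\<bar> / sqrt (real n) * (\<eta> j * sqrt (real n))"
    proof (intro mult_left_mono)
      have "(\<integral>x. \<bar>f x - p x\<bar> \<partial>torus_haar) \<le> l2norm (\<lambda>x. f x - p x)"
        by (rule integral_abs_le_l2norm[OF bounded_meas_diff[OF fb pb]])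
      also have "\<dots> \<le> \<eta> j * sqrt (real n)"
        using \<eta>(2)[of "{..<n}" 0 j] by (simp add: f_def p_def sum_subtractf)
      finally show "(\<integral>x. \<bar>f x - p x\<bar> \<partial>torus_haar) \<le> \<eta> j * sqrt (real n)" .
    qed simp
    also have "\<dots> = \<bar>u\<bar> * \<eta> j" using n by simp
    also have "\<dots> \<le> \<bar>u\<bar> * \<bar>\<eta> j\<bar>" by (intro mult_left_mono) auto
    finally show ?thesis .
  qed
  have "X \<longlonglongrightarrow> g0"
  proof (rule tendsto_of_double_limit)
    fix j :: nat
    show "\<forall>\<^sub>F n in sequentially. norm (X n - g0) \<le> \<bar>u\<bar> * \<bar>\<eta> j\<bar> + norm (Y j n - g j) + norm (g j - g0)"
      using eventually_gt_at_top[of 0]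
    proof eventually_elim
      case (elim n)
      have "norm (X n - g0) \<le> norm (X n - Y j n) + norm (Y j n - g j) + norm (g j - g0)"
        using norm_triangle_ineq[of "X n - Y j n" "Y j n - g j"] norm_triangle_ineq[of "X n - g j" "g j - g0"] by simp
      then show ?case using XY[OF elim, of j] by linarith
    qed
    have "(\<lambda>n. norm (Y j n - g j)) \<longlonglongrightarrow> 0" using Yg[of j] by (intro tendsto_norm_zero LIM_zero)
    then show "(\<lambda>n. \<bar>u\<bar> * \<bar>\<eta> j\<bar> + norm (Y j n - g j) + norm (g j - g0)) \<longlonglongrightarrow> \<bar>u\<bar> * \<bar>\<eta> j\<bar> + 0 + norm (g j - g0)"
      by (intro tendsto_add tendsto_const)
  next
    have "(\<lambda>j. \<bar>u\<bar> * \<bar>\<eta> j\<bar> + 0 + norm (g j - g0)) \<longlonglongrightarrow> \<bar>u\<bar> * \<bar>0\<bar> + 0 + norm (g0 - g0)"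
      by (intro tendsto_intros \<eta>(1) gg)
    then show "(\<lambda>j. \<bar>u\<bar> * \<bar>\<eta> j\<bar> + 0 + norm (g j - g0)) \<longlonglongrightarrow> 0" by simp
  qed
  then show ?thesis by (simp only: X_def[abs_def] g0_def)
qed

end

section \<open>Gaussian mixtures and weak convergence\<close>

lemma measure_std_normal_scaled:
  assumes "0 \<le> s"
  shows "measure std_normal_distribution {g. s * g \<le> t} = centered_gaussian_cdf s t"
proof (cases "s = 0")
  case True
  interpret real_distribution std_normal_distribution by (rule real_dist_normal_dist)
  \<comment> \<open>At scale zero the set is everything or empty according to the sign of
    \<open>t\<close>, which is the Dirac convention of \<open>centered_gaussian_cdf\<close>.\<close>
  have "cdf (return borel 0) t = indicator {..t} 0" unfolding cdf_def by (rule measure_return) simp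
  then show ?thesis using True prob_space by (simp add: centered_gaussian_cdf_def indicator_def)
next
  case False
  then have s: "s > 0" using assms by simp
  have "measure std_normal_distribution {g. s * g \<le> t}
      = (\<integral>g. indicator {g. s * g \<le> t} g \<partial>std_normal_distribution)" by simp
  also have "\<dots> = (\<integral>g. std_normal_density g *\<^sub>R indicator {g. s * g \<le> t} g \<partial>lborel)"
    by (subst integral_density) auto
  also have "\<dots> = 1 / sqrt (2 * pi) * (\<integral>g. indicator {..t} (0 + s * g) *\<^sub>R exp (- (0 + s * g)\<^sup>2 / (2 * s\<^sup>2)) \<partial>lborel)"
    unfolding integral_mult_right_zero[symmetric] using s
    by (intro Bochner_Integration.integral_cong refl)
       (auto simp: std_normal_density_def indicator_def power_mult_distrib)
  also have "(\<integral>g. indicator {..t} (0 + s * g) *\<^sub>R exp (- (0 + s * g)\<^sup>2 / (2 * s\<^sup>2)) \<partial>lborel)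
      = (1 / s) * (\<integral>v. indicator {..t} v *\<^sub>R exp (- v\<^sup>2 / (2 * s\<^sup>2)) \<partial>lborel)"
    using s lborel_integral_real_affine[of s "\<lambda>v. indicator {..t} v *\<^sub>R exp (- v\<^sup>2 / (2 * s\<^sup>2))" 0] by simp
  finally show ?thesis
    using s by (simp add: centered_gaussian_cdf_def set_lebesgue_integral_def)
qed

text \<open>Realised as the law of \<open>\<sigma> y * g\<close> with \<open>y\<close> uniform and
  \<open>g\<close> an independent standard normal. This treats \<open>\<sigma> y = 0\<close> on the
  same footing, and Fubini yields both the distribution function and the characteristic
  function.\<close>

lemma gaussian_mixture:
  fixes \<sigma> :: "'d::finite torus \<Rightarrow> real"
  assumes [measurable]: "\<sigma> \<in> borel_measurable borel" and nonneg: "\<And>y. 0 \<le> \<sigma> y"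
  obtains \<mu> where "real_distribution \<mu>"
    "\<And>t. cdf \<mu> t = (\<integral>y. centered_gaussian_cdf (\<sigma> y) t \<partial>torus_haar)"
    "\<And>u. char \<mu> u = (\<integral>y. complex_of_real (exp (- (u\<^sup>2 * (\<sigma> y)\<^sup>2 / 2))) \<partial>torus_haar)"
proof -
  interpret N: real_distribution std_normal_distribution by (rule real_dist_normal_dist)
  interpret P: pair_prob_space "torus_haar :: 'd torus measure" std_normal_distribution ..
  define G where "G z = \<sigma> (fst z) * snd z" for z :: "'d torus \<times> real"
  have G [measurable]: "G \<in> borel_measurable (torus_haar \<Otimes>\<^sub>M std_normal_distribution)"
    unfolding G_def by measurable
  define \<mu> where "\<mu> = distr (torus_haar \<Otimes>\<^sub>M std_normal_distribution) borel G"
  have fst_int: "(\<integral>z. f (G z) \<partial>(torus_haar \<Otimes>\<^sub>M std_normal_distribution))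
      = (\<integral>y. (\<integral>g. f (\<sigma> y * g) \<partial>std_normal_distribution) \<partial>torus_haar)"
    if [measurable]: "f \<in> borel_measurable borel" and "\<And>x. norm (f x) \<le> 1"
    for f :: "real \<Rightarrow> 'b::{banach, second_countable_topology}"
  proof -
    have "integrable (torus_haar \<Otimes>\<^sub>M std_normal_distribution) (\<lambda>z. f (G z))"
      by (rule P.integrable_const_bound[of _ 1]) (use that in auto)
    from P.integral_fst'[OF this] show ?thesis by (simp add: G_def)
  qed
  show ?thesis
  proof (rule that[of \<mu>])
    show "real_distribution \<mu>" unfolding \<mu>_def by (rule P.real_distribution_distr[OF G])
    show "cdf \<mu> t = (\<integral>y. centered_gaussian_cdf (\<sigma> y) t \<partial>torus_haar)" for t
    proof -
      have "cdf \<mu> t = (\<integral>x. indicator {..t} x \<partial>\<mu>)" by (simp add: cdf_def \<mu>_def)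
      also have "\<dots> = (\<integral>z. indicator {..t} (G z) \<partial>(torus_haar \<Otimes>\<^sub>M std_normal_distribution))"
        unfolding \<mu>_def by (rule integral_distr) auto
      also have "\<dots> = (\<integral>y. (\<integral>g. indicator {..t} (\<sigma> y * g) \<partial>std_normal_distribution) \<partial>torus_haar)"
        by (rule fst_int) (auto simp: indicator_def)
      also have "\<dots> = (\<integral>y. centered_gaussian_cdf (\<sigma> y) t \<partial>torus_haar)"
      proof (intro Bochner_Integration.integral_cong refl)
        fix y
        have "(\<lambda>g. indicator {..t} (\<sigma> y * g) :: real) = indicator {g. \<sigma> y * g \<le> t}"
          by (auto simp: indicator_def fun_eq_iff)
        then show "(\<integral>g. indicator {..t} (\<sigma> y * g) \<partial>std_normal_distribution) = centered_gaussian_cdf (\<sigma> y) t"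
          by (simp add: measure_std_normal_scaled[OF nonneg])
      qed
      finally show ?thesis .
    qed
    show "char \<mu> u = (\<integral>y. complex_of_real (exp (- (u\<^sup>2 * (\<sigma> y)\<^sup>2 / 2))) \<partial>torus_haar)" for u
    proof -
      have "char \<mu> u = (\<integral>z. iexp (u * G z) \<partial>(torus_haar \<Otimes>\<^sub>M std_normal_distribution))"
        unfolding char_def \<mu>_def by (rule integral_distr) auto
      also have "\<dots> = (\<integral>y. (\<integral>g. iexp (u * (\<sigma> y * g)) \<partial>std_normal_distribution) \<partial>torus_haar)"
        by (rule fst_int) auto
      also have "\<dots> = (\<integral>y. char std_normal_distribution (u * \<sigma> y) \<partial>torus_haar)"
        by (simp add: char_def mult.assoc)
      finally show ?thesis by (simp add: char_std_normal_distribution power_mult_distrib)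
    qed
  qed
qed

text \<open>The limit theorem uses a strict inequality, distribution functions a weak one; at a
  continuity point of the limit the boundary carries no mass, so the two agree there.\<close>

lemma weak_conv_lessThan:
  fixes \<mu> :: "nat \<Rightarrow> real measure" and M :: "real measure"
  assumes "\<And>n. real_distribution (\<mu> n)" "real_distribution M" "weak_conv_m \<mu> M" "isCont (cdf M) t"
  shows "(\<lambda>n. measure (\<mu> n) {..<t}) \<longlonglongrightarrow> measure M {..<t}" "measure M {..<t} = cdf M t"
proof -
  interpret M: real_distribution M by fact
  have t: "measure M {t} = 0" using assms(4) by (simp add: M.isCont_cdf)
  show "(\<lambda>n. measure (\<mu> n) {..<t}) \<longlonglongrightarrow> measure M {..<t}"
    by (rule weak_conv_imp_continuity_set_conv[OF assms(1-3)])
       (use t in \<open>auto simp: frontier_real_lessThan M.emeasure_eq_measure\<close>)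
  have "cdf M t = measure M ({..<t} \<union> {t})" unfolding cdf_def by (rule arg_cong[of _ _ "measure M"]) auto
  also have "\<dots> = measure M {..<t} + measure M {t}" by (rule M.finite_measure_Union) auto
  finally show "measure M {..<t} = cdf M t" using t by simp
qed

text \<open>The determinant criterion for invertibility is applied over a field, so the integer
  matrix is read as a complex one through \<open>cvec\<close>.\<close>

lemma transpose_kernel_trivial:
  fixes B :: "int ^ 'd ^ 'd::finite"
  assumes "det B \<noteq> 0" "transpose B *v m = 0"
  shows "m = 0"
proof (rule ccontr)
  assume "m \<noteq> 0"
  then have "cvec m \<noteq> 0" by (simp add: cvec_eq_0)
  moreover have "map_matrix of_int (transpose B) *v cvec m = 0"
    using assms(2) by (simp add: cvec_0 flip: cvec_mult)
  ultimately have "\<not> invertible (map_matrix of_int (transpose B) :: complex ^ 'd ^ 'd)"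
    using matrix_left_invertible_ker[of "map_matrix of_int (transpose B) :: complex ^ 'd ^ 'd"]
      invertible_left_inverse[of "map_matrix of_int (transpose B) :: complex ^ 'd ^ 'd"] by metis
  then have "det (map_matrix of_int (transpose B) :: complex ^ 'd ^ 'd) = 0" by (simp add: invertible_det_nz)
  moreover have "det (map_matrix of_int (transpose B) :: complex ^ 'd ^ 'd) = of_int (det (transpose B))"
    unfolding det_def by simp
  ultimately show False using assms(1) by (simp add: det_transpose)
qed

lemma torus_mult_diff: "torus_mult (M - N) x = torus_mult M x + torus_mult (- N) x"
proof transfer
  fix M N :: "int ^ 'a ^ 'a" and x :: "real ^ 'a"
  have "map_matrix real_of_int (M - N) = map_matrix of_int M + map_matrix of_int (- N)"
    by (simp add: vec_eq_iff)
  then show "map_matrix of_int (M - N) *v x - (map_matrix of_int M *v x + map_matrix of_int (- N) *v x) \<in> int_lattice"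
    by (simp add: matrix_vector_mult_add_rdistrib int_lattice_zero)
qed

theorem mainTheorem1:
  fixes A B :: "int ^ 'd::finite ^ 'd"
    and \<phi> :: "'d torus \<Rightarrow> real"
    and t :: real
  assumes "det A = 1"
    and "\<And>z. eigenvalue_of A z \<Longrightarrow> \<not> root_of_unity z"
    and "det B \<noteq> 0"
    and "hoelder_continuous \<phi>"
    and "(\<integral>x. \<phi> x \<partial>torus_haar) = 0"
    and "isCont (\<lambda>r. \<integral>y. centered_gaussian_cdf (asymptotic_sd A \<phi> y) r \<partial>torus_haar) t"
  shows "(\<lambda>n. measure torus_haar
            {x. 1 / sqrt (real n) * (\<Sum>k<n. \<phi> (torus_mult (matrix_power A k - B) x)) < t})
         \<longlonglongrightarrow> (\<integral>y. centered_gaussian_cdf (asymptotic_sd A \<phi> y) t \<partial>torus_haar)"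
proof -
  obtain \<alpha> H' where hoelder: "0 < \<alpha>" "\<alpha> \<le> 1" "\<forall>x y. \<bar>\<phi> x - \<phi> y\<bar> \<le> H' * dist x y powr \<alpha>"
    using assms(4) unfolding hoelder_continuous_def by (elim exE conjE)
  \<comment> \<open>\<open>hoelder_continuous\<close> does not ask the constant to be nonnegative,
    the locale does.\<close>
  define H where "H = max H' 0"
  have le: "\<bar>\<phi> x - \<phi> y\<bar> \<le> H * dist x y powr \<alpha>" for x y
    using hoelder(3)[rule_format, of x y] mult_right_mono[of H' H "dist x y powr \<alpha>"] by (simp add: H_def)
  obtain h \<kappa> C c D where "expanding_family (transpose A) h \<kappa> C c D"
    using expanding_family_of_ergodic[OF assms(1,2)] by blast
  then interpret toral_observable A h \<kappa> C c D \<phi> \<alpha> H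
    using le hoelder(1,2) assms(5)
    by (intro toral_observable.intro toral_automorphism.intro toral_observable_axioms.intro) (auto simp: H_def)
  define Z where "Z n x = 1 / sqrt (real n) * (\<Sum>k<n. \<phi> (torus_mult (matrix_power A k - B) x))" for n x
  have Z_eq: "Z n x = 1 / sqrt (real n) * (\<Sum>k<n. \<phi> (orbit_point (- B) 0 k x))" for n x
    by (simp add: Z_def orbit_point_def torus_mult_diff)
  have Z_meas [measurable]: "Z n \<in> borel_measurable borel" for n
    unfolding Z_eq[abs_def]
    by (intro bounded_meas_measurable bounded_meas_cmult bounded_meas_sum \<phi>_orbit_bounded_meas)
  obtain \<mu> where \<mu>: "real_distribution \<mu>"
    "\<And>t. cdf \<mu> t = (\<integral>y. centered_gaussian_cdf (sd y) t \<partial>torus_haar)"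
    "\<And>u. char \<mu> u = (\<integral>y. complex_of_real (exp (- (u\<^sup>2 * (sd y)\<^sup>2 / 2))) \<partial>torus_haar)"
    by (rule gaussian_mixture[OF sd_measurable sd_nonneg]) (rule that)
  define \<nu> where "\<nu> n = distr torus_haar borel (Z n)" for n
  have \<nu>: "real_distribution (\<nu> n)" for n
    unfolding \<nu>_def by (rule torus.real_distribution_distr) simp
  \<comment> \<open>Here \<open>det B \<noteq> 0\<close> enters: the twist \<open>E = - B\<close>
    has an injective transpose.\<close>
  have E: "m = 0" if "transpose (- B) *v m = 0" for m
  proof -
    have "transpose (- B) *v m = - (transpose B *v m)"
      by (simp add: vec_eq_iff matrix_vector_mult_def transpose_def sum_negf)
    then show ?thesis using transpose_kernel_trivial[OF assms(3), of m] that by simp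
  qed
  have "(\<lambda>n. char (\<nu> n) u) \<longlonglongrightarrow> char \<mu> u" for u
  proof -
    have "char (\<nu> n) u = (\<integral>x. iexp (u * (\<Sum>k<n. \<phi> (orbit_point (- B) 0 k x)) / sqrt (real n)) \<partial>torus_haar)" for n
    proof -
      have "char (\<nu> n) u = (\<integral>x. iexp (u * Z n x) \<partial>torus_haar)"
        unfolding char_def \<nu>_def by (rule integral_distr) auto
      then show ?thesis by (simp add: Z_eq)
    qed
    moreover have "(\<lambda>n. \<integral>x. iexp (u * (\<Sum>k<n. \<phi> (orbit_point (- B) 0 k x)) / sqrt (real n)) \<partial>torus_haar)
        \<longlonglongrightarrow> (\<integral>y. complex_of_real (exp (- (u\<^sup>2 * (sd y)\<^sup>2 / 2))) \<partial>torus_haar)"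
      by (rule twisted_char_limit) (rule E)
    ultimately show ?thesis by (simp add: \<mu>(3))
  qed
  then have weak: "weak_conv_m \<nu> \<mu>" by (rule levy_continuity[OF \<nu> \<mu>(1)])
  have "isCont (cdf \<mu>) t"
    using assms(6) by (simp add: asymptotic_sd_eq \<mu>(2)[abs_def])
  from weak_conv_lessThan[OF \<nu> \<mu>(1) weak this]
  have "(\<lambda>n. measure (\<nu> n) {..<t}) \<longlonglongrightarrow> (\<integral>y. centered_gaussian_cdf (sd y) t \<partial>torus_haar)"
    by (simp add: \<mu>(2))
  moreover have "measure (\<nu> n) {..<t} = measure torus_haar {x. Z n x < t}" for n
    unfolding \<nu>_def by (subst measure_distr) (auto simp: vimage_def)
  ultimately show ?thesis by (simp add: asymptotic_sd_eq Z_def)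
qed

end
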